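(* Let $N\ge 1$ and $m\ge 3$ be integers and let $k$ be a field whose characteristic does not divide $2$, $N$ or $m$. For $j\in\mathbb Z/m\mathbb Z$ let $\mathfrak a_{N-1}(j)$ be a copy of the Lie algebra $\mathfrak a_{N-1}$, with $L_s(j)$ denoting the element $L_s$ of this copy ($0\le s\le N-1$), and let $\langle c\rangle$ be a one-dimensional Lie algebra spanned by $c$, so that $c$ is central in the direct sum below. The $k$-linear map $$\mathrm{HH}^1(A)\longrightarrow \langle c\rangle\oplus\Big(\bigoplus_{j=0}^{m-1}\mathfrak a_{N-1}(j)\Big),\qquad E_{1,j,s}\mapsto L_s(j)\ (1\le s\le N-1),\quad E_0\mapsto\sum_{j=0}^{m-1}L_0(j),\quad C\mapsto c,$$ is an embedding (injective homomorphism) of Lie algebras. More precisely, $\mathrm{HH}^1(A)$ is the pullback (limit, in Lie algebras) of the diagram of surjective Lie algebra homomorphisms $$\big(\langle c\rangle\oplus\mathfrak a_{N-1}(j)\twoheadrightarrow\langle c,L_0\rangle\big)_{0\le j\le m-1},$$ where $\langle c,L_0\rangle$ is the two-dimensional commutative Lie algebra with basis $c,L_0$, and the $j$-th map sends $c\mapsto c$, $L_0(j)\mapsto L_0$, and $L_s(j)\mapsto 0$ for $s\ge 1$.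
   Context: $Q$ is the quiver with vertex set $\mathbb Z/m\mathbb Z$ and arrows $a_i:i\to i+1$ and $\bar a_i:i+1\to i$ for $i\in\mathbb Z/m\mathbb Z$; paths are composed from left to right and indices are taken modulo $m$. $A=kQ/\langle a_ia_{i+1},\ \bar a_{i+1}\bar a_i,\ (a_i\bar a_i)^N-(\bar a_{i-1}a_{i-1})^N \mid i\in\mathbb Z/m\mathbb Z\rangle$. $\mathrm{HH}^1(A)$ is the first Hochschild cohomology, i.e. $k$-linear derivations of $A$ modulo inner derivations, with Lie bracket (the Gerstenhaber bracket) the commutator $[f,g]=f\circ g-g\circ f$ of derivations. It has $k$-basis $\{\varphi_{1,0},\psi_{1,0},E_{1,j,s}\mid j\in\mathbb Z/m\mathbb Z,\ 1\le s\le N-1\}$, where these denote the classes of the following derivations (all vanishing on trivial paths): $\varphi_{1,0}: a_i\mapsto a_i,\ \bar a_i\mapsto 0$ for all $i$; $\psi_{1,0}: a_i\mapsto 0,\ \bar a_i\mapsto-\bar a_i$ for all $i$; $E_{1,j,s}: a_j\mapsto a_j(\bar a_ja_j)^s$ and all other arrows $\mapsto 0$. Put $C=\frac12(\varphi_{1,0}+\psi_{1,0})$ and $E_0=\frac12(\varphi_{1,0}-\psi_{1,0})$. The Virasoro algebra $\mathrm{Vir}$ has generators $L_s$ ($s\in\mathbb Z$) and a central element $c$, with $[L_s,L_r]=(r-s)L_{s+r}+\delta_{s+r,0}\frac{s^3-s}{12}c$. $\mathrm{Vir}_+$ is the Lie subalgebra generated by all $L_s$ with $s\ge 0$; for $q\ge0$,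 $\mathrm{Vir}_{>q}$ is the Lie ideal of $\mathrm{Vir}_+$ generated by all $L_s$ with $s>q$; and $\mathfrak a_q=\mathrm{Vir}_+/\mathrm{Vir}_{>q}$. Residue classes are again denoted $L_s$; thus $\mathfrak a_q$ has basis $L_0,\dots,L_q$ with $[L_s,L_r]=(r-s)L_{s+r}$ if $s+r\le q$ and $0$ otherwise. $\langle\ldots\rangle$ denotes $k$-linear span. *)

theory Defs
  imports
    "HOL-Algebra.QuotRing"
    "HOL-Algebra.Module"
    "HOL-Algebra.Algebraic_Closure_Type"
    "HOL-Library.Poly_Mapping"
    "Graph_Theory.Arc_Walk"
begin

section \<open>Algebras and Lie algebras over a field\<close>

text \<open>
  The field is a type \<open>'k::field\<close>.  A \<open>'k\<close>-algebra, associative or Lie, is a record of type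
  \<open>('k, 'a) module\<close> whose field \<^term>\<open>monoid.mult\<close> holds the product.  For a Lie algebra this product
  is the bracket, and the field \<^term>\<open>one\<close> has no meaning (it is set to zero below).
\<close>

locale lie_algebra = Module.module "ring_of_type_algebra :: 'k::field ring" L
  for L :: "('k::field, 'a) module" (structure) +
  assumes bracket_closed:
      "\<lbrakk>x \<in> carrier L; y \<in> carrier L\<rbrakk> \<Longrightarrow> x \<otimes>\<^bsub>L\<^esub> y \<in> carrier L"
    and bracket_add_left:
      "\<lbrakk>x \<in> carrier L; y \<in> carrier L; z \<in> carrier L\<rbrakk> \<Longrightarrow>
        (x \<oplus>\<^bsub>L\<^esub> y) \<otimes>\<^bsub>L\<^esub> z = x \<otimes>\<^bsub>L\<^esub> z \<oplus>\<^bsub>L\<^esub> y \<otimes>\<^bsub>L\<^esub> z"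
    and bracket_add_right:
      "\<lbrakk>x \<in> carrier L; y \<in> carrier L; z \<in> carrier L\<rbrakk> \<Longrightarrow>
        x \<otimes>\<^bsub>L\<^esub> (y \<oplus>\<^bsub>L\<^esub> z) = x \<otimes>\<^bsub>L\<^esub> y \<oplus>\<^bsub>L\<^esub> x \<otimes>\<^bsub>L\<^esub> z"
    and bracket_smult_left:
      "\<lbrakk>x \<in> carrier L; y \<in> carrier L\<rbrakk> \<Longrightarrow> (a \<odot>\<^bsub>L\<^esub> x) \<otimes>\<^bsub>L\<^esub> y = a \<odot>\<^bsub>L\<^esub> (x \<otimes>\<^bsub>L\<^esub> y)"
    and bracket_smult_right:
      "\<lbrakk>x \<in> carrier L; y \<in> carrier L\<rbrakk> \<Longrightarrow> x \<otimes>\<^bsub>L\<^esub> (a \<odot>\<^bsub>L\<^esub> y) = a \<odot>\<^bsub>L\<^esub> (x \<otimes>\<^bsub>L\<^esub> y)"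
    and bracket_self: "x \<in> carrier L \<Longrightarrow> x \<otimes>\<^bsub>L\<^esub> x = \<zero>\<^bsub>L\<^esub>"
    and jacobi:
      "\<lbrakk>x \<in> carrier L; y \<in> carrier L; z \<in> carrier L\<rbrakk> \<Longrightarrow>
        x \<otimes>\<^bsub>L\<^esub> (y \<otimes>\<^bsub>L\<^esub> z) \<oplus>\<^bsub>L\<^esub> y \<otimes>\<^bsub>L\<^esub> (z \<otimes>\<^bsub>L\<^esub> x) \<oplus>\<^bsub>L\<^esub> z \<otimes>\<^bsub>L\<^esub> (x \<otimes>\<^bsub>L\<^esub> y) = \<zero>\<^bsub>L\<^esub>"

definition lie_subalgebra :: "'a set \<Rightarrow> ('k::field, 'a) module \<Rightarrow> bool" where
  "lie_subalgebra H L \<longleftrightarrow>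
     submodule H (ring_of_type_algebra :: 'k ring) L \<and> (\<forall>x\<in>H. \<forall>y\<in>H. x \<otimes>\<^bsub>L\<^esub> y \<in> H)"

definition lie_ideal :: "'a set \<Rightarrow> ('k::field, 'a) module \<Rightarrow> bool" where
  "lie_ideal H L \<longleftrightarrow>
     submodule H (ring_of_type_algebra :: 'k ring) L \<and> (\<forall>x\<in>carrier L. \<forall>y\<in>H. x \<otimes>\<^bsub>L\<^esub> y \<in> H)"

text \<open>Linear maps are extensional, i.e. undefined outside the carrier, so that equality of
  linear maps is equality of functions.\<close>

definition linear_maps :: "('k, 'a) module \<Rightarrow> ('k, 'b) module \<Rightarrow> ('a \<Rightarrow> 'b) set" where
  "linear_maps V W = {f \<in> carrier V \<rightarrow>\<^sub>E carrier W.
     (\<forall>x\<in>carrier V. \<forall>y\<in>carrier V. f (x \<oplus>\<^bsub>V\<^esub> y) = f x \<oplus>\<^bsub>W\<^esub> f y) \<and>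
     (\<forall>a. \<forall>x\<in>carrier V. f (a \<odot>\<^bsub>V\<^esub> x) = a \<odot>\<^bsub>W\<^esub> f x)}"

definition lie_homs :: "('k, 'a) module \<Rightarrow> ('k, 'b) module \<Rightarrow> ('a \<Rightarrow> 'b) set" where
  "lie_homs V W = {f \<in> linear_maps V W.
     \<forall>x\<in>carrier V. \<forall>y\<in>carrier V. f (x \<otimes>\<^bsub>V\<^esub> y) = f x \<otimes>\<^bsub>W\<^esub> f y}"

text \<open>Quotient by an ideal (of an associative or of a Lie algebra): \<^const>\<open>FactRing\<close> together
  with the induced scalar multiplication.\<close>

definition quot_alg :: "('k, 'a) module \<Rightarrow> 'a set \<Rightarrow> ('k, 'a set) module" where
  "quot_alg V H = ring.extend (V Quot H)
     (module.fields (\<lambda>a S. \<Union>x\<in>S. H +>\<^bsub>V\<^esub> (a \<odot>\<^bsub>V\<^esub> x)))"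

definition prod_alg :: "('k, 'a) module \<Rightarrow> ('k, 'b) module \<Rightarrow> ('k, 'a \<times> 'b) module" where
  "prod_alg V W =
    \<lparr>carrier = carrier V \<times> carrier W,
     monoid.mult = (\<lambda>x y. (fst x \<otimes>\<^bsub>V\<^esub> fst y, snd x \<otimes>\<^bsub>W\<^esub> snd y)),
     one = (\<one>\<^bsub>V\<^esub>, \<one>\<^bsub>W\<^esub>),
     ring.zero = (\<zero>\<^bsub>V\<^esub>, \<zero>\<^bsub>W\<^esub>),
     add = (\<lambda>x y. (fst x \<oplus>\<^bsub>V\<^esub> fst y, snd x \<oplus>\<^bsub>W\<^esub> snd y)),
     module.smult = (\<lambda>a x. (a \<odot>\<^bsub>V\<^esub> fst x, a \<odot>\<^bsub>W\<^esub> snd x))\<rparr>"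

text \<open>For a finite index set this is the direct sum of the family.\<close>

definition Prod_alg :: "'i set \<Rightarrow> ('i \<Rightarrow> ('k, 'a) module) \<Rightarrow> ('k, 'i \<Rightarrow> 'a) module" where
  "Prod_alg I V =
    \<lparr>carrier = (\<Pi>\<^sub>E i\<in>I. carrier (V i)),
     monoid.mult = (\<lambda>x y. \<lambda>i\<in>I. x i \<otimes>\<^bsub>V i\<^esub> y i),
     one = (\<lambda>i\<in>I. \<one>\<^bsub>V i\<^esub>),
     ring.zero = (\<lambda>i\<in>I. \<zero>\<^bsub>V i\<^esub>),
     add = (\<lambda>x y. \<lambda>i\<in>I. x i \<oplus>\<^bsub>V i\<^esub> y i),
     module.smult = (\<lambda>a x. \<lambda>i\<in>I. a \<odot>\<^bsub>V i\<^esub> x i)\<rparr>"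

text \<open>The one-dimensional Lie algebra, with basis vector \<open>1\<close>.\<close>

definition lie_line :: "('k::field, 'k) module" where
  "lie_line = \<lparr>carrier = UNIV, monoid.mult = (\<lambda>_ _. 0), one = 0, ring.zero = 0, add = (+), module.smult = (*)\<rparr>"

text \<open>
  \<open>P\<close> with the maps \<open>p i\<close> is the limit, in Lie algebras over \<open>'k\<close>, of the diagram
  \<open>(\<pi> i : V i \<rightarrow> W)\<close> indexed by \<open>i \<in> I\<close>.  Test objects have carriers in the type \<open>'x\<close>.
  The leg of a cone to \<open>W\<close> is left implicit; it is determined by the others as \<open>I \<noteq> {}\<close>.
\<close>

definition is_lie_pullback ::
  "'x itself \<Rightarrow> 'i set \<Rightarrow> ('i \<Rightarrow> ('k::field, 'b) module) \<Rightarrow> ('k, 'c) module \<Rightarrow> ('i \<Rightarrow> 'b \<Rightarrow> 'c) \<Rightarrow>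
   ('k, 'p) module \<Rightarrow> ('i \<Rightarrow> 'p \<Rightarrow> 'b) \<Rightarrow> bool" where
  "is_lie_pullback (_ :: 'x itself) I V W \<pi> P p \<longleftrightarrow>
     I \<noteq> {} \<and> lie_algebra W \<and> (\<forall>i\<in>I. lie_algebra (V i) \<and> \<pi> i \<in> lie_homs (V i) W) \<and>
     lie_algebra P \<and> (\<forall>i\<in>I. p i \<in> lie_homs P (V i)) \<and>
     (\<forall>i\<in>I. \<forall>j\<in>I. \<forall>x\<in>carrier P. \<pi> i (p i x) = \<pi> j (p j x)) \<and>
     (\<forall>(Y :: ('k, 'x) module) g.
        lie_algebra Y \<and> (\<forall>i\<in>I. g i \<in> lie_homs Y (V i)) \<and>
        (\<forall>i\<in>I. \<forall>j\<in>I. \<forall>x\<in>carrier Y. \<pi> i (g i x) = \<pi> j (g j x)) \<longrightarrow>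
        (\<exists>!u. u \<in> lie_homs Y P \<and> (\<forall>i\<in>I. \<forall>x\<in>carrier Y. p i (u x) = g i x)))"


section \<open>First Hochschild cohomology\<close>

definition derivations :: "('k, 'a) module \<Rightarrow> ('a \<Rightarrow> 'a) set" where
  "derivations A = {D \<in> linear_maps A A.
     \<forall>x\<in>carrier A. \<forall>y\<in>carrier A. D (x \<otimes>\<^bsub>A\<^esub> y) = D x \<otimes>\<^bsub>A\<^esub> y \<oplus>\<^bsub>A\<^esub> x \<otimes>\<^bsub>A\<^esub> D y}"

definition der_alg :: "('k, 'a) module \<Rightarrow> ('k, 'a \<Rightarrow> 'a) module" where
  "der_alg A =
    \<lparr>carrier = derivations A,
     monoid.mult = (\<lambda>f g. \<lambda>x\<in>carrier A. f (g x) \<ominus>\<^bsub>A\<^esub> g (f x)),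
     one = (\<lambda>x\<in>carrier A. \<zero>\<^bsub>A\<^esub>),
     ring.zero = (\<lambda>x\<in>carrier A. \<zero>\<^bsub>A\<^esub>),
     add = (\<lambda>f g. \<lambda>x\<in>carrier A. f x \<oplus>\<^bsub>A\<^esub> g x),
     module.smult = (\<lambda>a f. \<lambda>x\<in>carrier A. a \<odot>\<^bsub>A\<^esub> f x)\<rparr>"

definition inner_derivations :: "('k, 'a) module \<Rightarrow> ('a \<Rightarrow> 'a) set" where
  "inner_derivations A =
     (\<lambda>b. \<lambda>x\<in>carrier A. b \<otimes>\<^bsub>A\<^esub> x \<ominus>\<^bsub>A\<^esub> x \<otimes>\<^bsub>A\<^esub> b) ` carrier A"

definition HH1 :: "('k, 'a) module \<Rightarrow> ('k, ('a \<Rightarrow> 'a) set) module" where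
  "HH1 A = quot_alg (der_alg A) (inner_derivations A)"

definition HH1_class :: "('k, 'a) module \<Rightarrow> ('a \<Rightarrow> 'a) \<Rightarrow> ('a \<Rightarrow> 'a) set" where
  "HH1_class A D = inner_derivations A +>\<^bsub>der_alg A\<^esub> D"


section \<open>Path algebras\<close>

definition scale :: "'k::field \<Rightarrow> ('b \<Rightarrow>\<^sub>0 'k) \<Rightarrow> ('b \<Rightarrow>\<^sub>0 'k)" where
  "scale a f = Poly_Mapping.map ((*) a) f"

definition bilinear_ext ::
  "('b \<Rightarrow> 'b \<Rightarrow> ('b \<Rightarrow>\<^sub>0 'k)) \<Rightarrow> ('b \<Rightarrow>\<^sub>0 'k) \<Rightarrow> ('b \<Rightarrow>\<^sub>0 'k) \<Rightarrow> ('b \<Rightarrow>\<^sub>0 'k::field)" where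
  "bilinear_ext \<beta> f g =
     (\<Sum>x\<in>Poly_Mapping.keys f. \<Sum>y\<in>Poly_Mapping.keys g.
        scale (Poly_Mapping.lookup f x * Poly_Mapping.lookup g y) (\<beta> x y))"

text \<open>A path is a triple of its source, its list of arrows (composed from left to right) and its
  target; the trivial path at \<open>v\<close> is \<open>(v, [], v)\<close>.\<close>

type_synonym ('v, 'e) path = "'v \<times> 'e list \<times> 'v"

definition paths :: "('v, 'e) pre_digraph \<Rightarrow> ('v, 'e) path set" where
  "paths G = {(u, p, v). pre_digraph.awalk G u p v}"

fun path_mult :: "('v, 'e) path \<Rightarrow> ('v, 'e) path \<Rightarrow> (('v, 'e) path \<Rightarrow>\<^sub>0 'k::field)" where
  "path_mult (u, p, v) (u', q, w) = (if v = u' then Poly_Mapping.single (u, p @ q, w) 1 else 0)"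

definition path_algebra :: "('v, 'e) pre_digraph \<Rightarrow> ('k::field, ('v, 'e) path \<Rightarrow>\<^sub>0 'k) module" where
  "path_algebra G =
    \<lparr>carrier = {f. Poly_Mapping.keys f \<subseteq> paths G},
     monoid.mult = bilinear_ext path_mult,
     one = (\<Sum>v\<in>verts G. Poly_Mapping.single (v, [], v) 1),
     ring.zero = 0,
     add = (+),
     module.smult = scale\<rparr>"


section \<open>The quiver and the algebra \<open>A\<close>\<close>

text \<open>Vertices are represented by \<open>0, \<dots>, m - 1\<close>; \<open>Arr i\<close> is the arrow \<open>a\<^sub>i\<close> and \<open>Bar i\<close> the
  arrow in the opposite direction.\<close>

datatype arrow = Arr int | Bar int

definition quiver :: "nat \<Rightarrow> (int, arrow) pre_digraph" where
  "quiver m =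
    \<lparr>verts = {0..<int m},
     arcs = Arr ` {0..<int m} \<union> Bar ` {0..<int m},
     tail = (\<lambda>e. case e of Arr i \<Rightarrow> i | Bar i \<Rightarrow> (i + 1) mod int m),
     head = (\<lambda>e. case e of Arr i \<Rightarrow> (i + 1) mod int m | Bar i \<Rightarrow> i)\<rparr>"

type_synonym 'k kQ = "(int, arrow) path \<Rightarrow>\<^sub>0 'k"

definition Q_vert :: "nat \<Rightarrow> int \<Rightarrow> 'k::field kQ" where
  "Q_vert m i = Poly_Mapping.single (i mod int m, [], i mod int m) 1"

definition Q_arr :: "nat \<Rightarrow> int \<Rightarrow> 'k::field kQ" where
  "Q_arr m i = Poly_Mapping.single (i mod int m, [Arr (i mod int m)], (i + 1) mod int m) 1"

definition Q_bar :: "nat \<Rightarrow> int \<Rightarrow> 'k::field kQ" where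
  "Q_bar m i = Poly_Mapping.single ((i + 1) mod int m, [Bar (i mod int m)], i mod int m) 1"

definition relations :: "nat \<Rightarrow> nat \<Rightarrow> 'k::field kQ set" where
  "relations m N = (let R = (path_algebra (quiver m) :: ('k, 'k kQ) module); a = Q_arr m; b = Q_bar m in
     {a i \<otimes>\<^bsub>R\<^esub> a (i + 1) | i. i \<in> {0..<int m}} \<union>
     {b (i + 1) \<otimes>\<^bsub>R\<^esub> b i | i. i \<in> {0..<int m}} \<union>
     {(a i \<otimes>\<^bsub>R\<^esub> b i) [^]\<^bsub>R\<^esub> N \<ominus>\<^bsub>R\<^esub> (b (i - 1) \<otimes>\<^bsub>R\<^esub> a (i - 1)) [^]\<^bsub>R\<^esub> N | i. i \<in> {0..<int m}})"

text \<open>An ideal of a unital algebra is a linear subspace, so the ring-theoretic ideal is enough.\<close>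

definition rel_ideal :: "nat \<Rightarrow> nat \<Rightarrow> 'k::field kQ set" where
  "rel_ideal m N = Idl\<^bsub>path_algebra (quiver m)\<^esub> (relations m N)"

definition alg_A :: "nat \<Rightarrow> nat \<Rightarrow> ('k::field, 'k kQ set) module" where
  "alg_A m N = quot_alg (path_algebra (quiver m)) (rel_ideal m N)"

definition A_class :: "nat \<Rightarrow> nat \<Rightarrow> 'k::field kQ \<Rightarrow> 'k kQ set" where
  "A_class m N x = rel_ideal m N +>\<^bsub>path_algebra (quiver m)\<^esub> x"

abbreviation A_vert where "A_vert m N i \<equiv> A_class m N (Q_vert m i)"
abbreviation A_arr where "A_arr m N i \<equiv> A_class m N (Q_arr m i)"
abbreviation A_bar where "A_bar m N i \<equiv> A_class m N (Q_bar m i)"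

text \<open>The derivation of \<open>A\<close> that vanishes on trivial paths and has the values \<open>u i\<close>, \<open>v i\<close> on the
  arrows.  As the trivial paths and the arrows generate \<open>A\<close>, there is at most one.\<close>

definition arrow_derivation ::
  "nat \<Rightarrow> nat \<Rightarrow> (int \<Rightarrow> 'k::field kQ set) \<Rightarrow> (int \<Rightarrow> 'k kQ set) \<Rightarrow> 'k kQ set \<Rightarrow> 'k kQ set" where
  "arrow_derivation m N u v = (THE D. D \<in> derivations (alg_A m N) \<and>
     (\<forall>i\<in>{0..<int m}. D (A_vert m N i) = \<zero>\<^bsub>alg_A m N\<^esub> \<and>
        D (A_arr m N i) = u i \<and> D (A_bar m N i) = v i))"

type_synonym 'k HH1_elem = "('k kQ set \<Rightarrow> 'k kQ set) set"

definition phi_class :: "nat \<Rightarrow> nat \<Rightarrow> 'k::field HH1_elem" where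
  "phi_class m N = HH1_class (alg_A m N)
     (arrow_derivation m N (A_arr m N) (\<lambda>_. \<zero>\<^bsub>alg_A m N\<^esub>))"

definition psi_class :: "nat \<Rightarrow> nat \<Rightarrow> 'k::field HH1_elem" where
  "psi_class m N = HH1_class (alg_A m N)
     (arrow_derivation m N (\<lambda>_. \<zero>\<^bsub>alg_A m N\<^esub>) (\<lambda>i. \<ominus>\<^bsub>alg_A m N\<^esub> A_bar m N i))"

definition E_class :: "nat \<Rightarrow> nat \<Rightarrow> int \<Rightarrow> nat \<Rightarrow> 'k::field HH1_elem" where
  "E_class m N j s = (let A = (alg_A m N :: ('k, 'k kQ set) module) in HH1_class A
     (arrow_derivation m N
        (\<lambda>i. if i = j then A_arr m N j \<otimes>\<^bsub>A\<^esub> (A_bar m N j \<otimes>\<^bsub>A\<^esub> A_arr m N j) [^]\<^bsub>A\<^esub> s else \<zero>\<^bsub>A\<^esub>)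
        (\<lambda>_. \<zero>\<^bsub>A\<^esub>)))"

definition C_class :: "nat \<Rightarrow> nat \<Rightarrow> 'k::field HH1_elem" where
  "C_class m N = (let H = HH1 (alg_A m N :: ('k, 'k kQ set) module) in
     (1/2) \<odot>\<^bsub>H\<^esub> (phi_class m N \<oplus>\<^bsub>H\<^esub> psi_class m N))"

definition E0_class :: "nat \<Rightarrow> nat \<Rightarrow> 'k::field HH1_elem" where
  "E0_class m N = (let H = HH1 (alg_A m N :: ('k, 'k kQ set) module) in
     (1/2) \<odot>\<^bsub>H\<^esub> (phi_class m N \<ominus>\<^bsub>H\<^esub> psi_class m N))"


section \<open>The Virasoro algebra and its subquotients\<close>

datatype vir_gen = VL int | VC

text \<open>The coefficient \<open>(s\<^sup>3 - s)/12\<close> of the central element is read as \<open>(s\<^sup>3 - s)/6 \<in> \<int>\<close> divided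
  by \<open>2\<close>; this is the same unless the characteristic is \<open>3\<close>, where division by \<open>12\<close> in the field
  makes no sense.\<close>

fun vir_gen_bracket :: "vir_gen \<Rightarrow> vir_gen \<Rightarrow> (vir_gen \<Rightarrow>\<^sub>0 'k::field)" where
  "vir_gen_bracket (VL s) (VL r) =
     Poly_Mapping.single (VL (s + r)) (of_int (r - s)) +
     (if s + r = 0 then Poly_Mapping.single VC (of_int ((s ^ 3 - s) div 6) / 2) else 0)"
| "vir_gen_bracket _ _ = 0"

definition virasoro :: "('k::field, vir_gen \<Rightarrow>\<^sub>0 'k) module" where
  "virasoro =
    \<lparr>carrier = UNIV, monoid.mult = bilinear_ext vir_gen_bracket, one = 0, ring.zero = 0, add = (+), module.smult = scale\<rparr>"

definition vir_L :: "int \<Rightarrow> (vir_gen \<Rightarrow>\<^sub>0 'k::field)" where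
  "vir_L s = Poly_Mapping.single (VL s) 1"

definition vir_plus :: "('k::field, vir_gen \<Rightarrow>\<^sub>0 'k) module" where
  "vir_plus = virasoro\<lparr>carrier := \<Inter>{H. lie_subalgebra H virasoro \<and> vir_L ` {0..} \<subseteq> H}\<rparr>"

definition vir_gt :: "nat \<Rightarrow> (vir_gen \<Rightarrow>\<^sub>0 'k::field) set" where
  "vir_gt q = \<Inter>{H. lie_ideal H vir_plus \<and> vir_L ` {int q<..} \<subseteq> H}"

type_synonym 'k fa_elem = "(vir_gen \<Rightarrow>\<^sub>0 'k) set"

definition lie_a :: "nat \<Rightarrow> ('k::field, 'k fa_elem) module" where
  "lie_a q = quot_alg vir_plus (vir_gt q)"

definition a_L :: "nat \<Rightarrow> nat \<Rightarrow> 'k::field fa_elem" where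
  "a_L q s = vir_gt q +>\<^bsub>vir_plus\<^esub> vir_L (int s)"


section \<open>Source and target Lie algebras\<close>

definition HH1_A :: "nat \<Rightarrow> nat \<Rightarrow> ('k::field, 'k HH1_elem) module" where
  "HH1_A m N = HH1 (alg_A m N)"

definition target :: "nat \<Rightarrow> nat \<Rightarrow> ('k::field, 'k \<times> (int \<Rightarrow> 'k fa_elem)) module" where
  "target m N = prod_alg lie_line (Prod_alg {0..<int m} (\<lambda>_. lie_a (N - 1)))"

definition target_c :: "nat \<Rightarrow> nat \<Rightarrow> 'k::field \<times> (int \<Rightarrow> 'k fa_elem)" where
  "target_c m N = (1, \<lambda>i\<in>{0..<int m}. \<zero>\<^bsub>lie_a (N - 1)\<^esub>)"

definition target_L :: "nat \<Rightarrow> nat \<Rightarrow> int \<Rightarrow> nat \<Rightarrow> 'k::field \<times> (int \<Rightarrow> 'k fa_elem)" where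
  "target_L m N j s =
     (0, \<lambda>i\<in>{0..<int m}. if i = j then a_L (N - 1) s else \<zero>\<^bsub>lie_a (N - 1)\<^esub>)"

text \<open>The Lie algebra \<open>\<langle>c\<rangle> \<oplus> \<aa>\<^bsub>N-1\<^esub>(j)\<close>, the same for all \<open>j\<close>.\<close>

definition corner :: "nat \<Rightarrow> ('k::field, 'k \<times> 'k fa_elem) module" where
  "corner N = prod_alg lie_line (lie_a (N - 1))"

text \<open>The Lie algebra \<open>\<langle>c, L\<^sub>0\<rangle>\<close> with \<open>c = (1, 0)\<close> and \<open>L\<^sub>0 = (0, 1)\<close>.\<close>

definition base :: "('k::field, 'k \<times> 'k) module" where
  "base = prod_alg lie_line lie_line"

definition is_embedding_map ::
  "nat \<Rightarrow> nat \<Rightarrow> ('k::field HH1_elem \<Rightarrow> 'k \<times> (int \<Rightarrow> 'k fa_elem)) \<Rightarrow> bool" where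
  "is_embedding_map m N \<Phi> \<longleftrightarrow>
     \<Phi> \<in> linear_maps (HH1_A m N) (target m N) \<and>
     (\<forall>j\<in>{0..<int m}. \<forall>s\<in>{1..N - 1}. \<Phi> (E_class m N j s) = target_L m N j s) \<and>
     \<Phi> (E0_class m N) = (\<Oplus>\<^bsub>target m N\<^esub> j\<in>{0..<int m}. target_L m N j 0) \<and>
     \<Phi> (C_class m N) = target_c m N"

definition is_corner_map :: "nat \<Rightarrow> ('k::field \<times> 'k fa_elem \<Rightarrow> 'k \<times> 'k) \<Rightarrow> bool" where
  "is_corner_map N \<pi> \<longleftrightarrow>
     \<pi> \<in> linear_maps (corner N) base \<and>
     \<pi> (1, \<zero>\<^bsub>lie_a (N - 1)\<^esub>) = (1, 0) \<and>
     \<pi> (0, a_L (N - 1) 0) = (0, 1) \<and>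
     (\<forall>s\<in>{1..N - 1}. \<pi> (0, a_L (N - 1) s) = (0, 0))"

end

(*
  Sending a_j to E_12 and its reverse to t E_21 in the j-th of m copies of the 2 x 2 matrices over k[[t]]
  represents the path algebra; the relations a_i a_{i+1} and their reverses are killed, and A becomes the
  quotient of the image by the matrices that vanish modulo t^N (off the socle), the two entries t^N that
  represent the same socle element being identified.

  In this model a derivation that vanishes on the trivial paths is, in the j-th copy, a vector field
  t P_j d/dt applied entrywise plus the commutator with diag(mu_j, 0).  The relation
  (a_i abar_i)^N = (abar_{i-1} a_{i-1})^N forces N P_i(0) = N P_{i-1}(0), so all P_j have the same constant
  term.  Such a derivation is inner exactly when all P_j vanish modulo t^N and the sum over j of
  2 mu_j(0) - P_j(0) is zero; therefore HH^1(A) is the set of pairs of a scalar x and a family (P_j) modulo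
  t^N with common constant term.  The commutator of t P d/dt and t Q d/dt is t [P, Q] d/dt with
  [P, Q] = t (P Q' - Q P'), which is also the bracket of the Virasoro quotient under L_s |-> t^s, and the
  pairs (x, (P_j)) are visibly the pullback.
*)
theory Submission
  imports Defs "HOL-Computational_Algebra.Formal_Power_Series"
begin

section \<open>Algebras and their quotients\<close>

text \<open>Power series are convenient because t d/dt never lowers the order of vanishing: matrix
  identities hold exactly, and truncation can wait. The obstacle is that A is given by generators
  and relations, so the matrix model must be shown to determine A. \<open>Lred\<close> rewrites
  modulo the relations into short alternating paths, and \<open>I_eq\<close> identifies the relation
  ideal with the preimage of \<open>J\<close>. A pair \<open>\<mu>\<close>, \<open>P\<close> read
  off from the values of a derivation on the arrows acts on matrices before it is known to preserve
  \<open>J\<close>. It is therefore compared with the derivation as a map from the path algebra to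
  A. An inner derivation by a diagonal matrix changes mu_j(0) by differences z_j - z_{j+1}, so only
  the sum of the mu_j(0) around the cycle survives. The weight 2 mu_j(0) - P_j(0) is a
  normalisation: it gives C the coordinates x = 1, P = 0 and E_0 the coordinates x = 0, P = 1. Of
  the three numbers invertible in k, N is cancelled in the comparison of the P_j(0), 2 in the
  normalisation, and m in the passage from the sum to the mean.\<close>

text \<open>Not necessarily associative algebras, so that the lemmas apply to \<open>A\<close>, to its
  derivations and to Lie algebras.\<close>

locale nalg = Module.module "ring_of_type_algebra :: 'k::field ring" V
  for V :: "('k::field, 'a) module" (structure) +
  assumes mult_closed [simp, intro]:
      "\<lbrakk>x \<in> carrier V; y \<in> carrier V\<rbrakk> \<Longrightarrow> x \<otimes> y \<in> carrier V"
    and mult_add_left: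
      "\<lbrakk>x \<in> carrier V; y \<in> carrier V; z \<in> carrier V\<rbrakk> \<Longrightarrow>
        (x \<oplus> y) \<otimes> z = x \<otimes> z \<oplus> y \<otimes> z"
    and mult_add_right:
      "\<lbrakk>x \<in> carrier V; y \<in> carrier V; z \<in> carrier V\<rbrakk> \<Longrightarrow>
        x \<otimes> (y \<oplus> z) = x \<otimes> y \<oplus> x \<otimes> z"
    and mult_smult_left:
      "\<lbrakk>x \<in> carrier V; y \<in> carrier V\<rbrakk> \<Longrightarrow> (a \<odot> x) \<otimes> y = a \<odot> (x \<otimes> y)"
    and mult_smult_right:
      "\<lbrakk>x \<in> carrier V; y \<in> carrier V\<rbrakk> \<Longrightarrow> x \<otimes> (a \<odot> y) = a \<odot> (x \<otimes> y)"

lemma ring_of_type_algebra_simps [simp]: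
  "carrier (ring_of_type_algebra :: 'k::field ring) = UNIV"
  "a \<oplus>\<^bsub>ring_of_type_algebra\<^esub> b = (a + b :: 'k::field)"
  "a \<otimes>\<^bsub>ring_of_type_algebra\<^esub> b = (a * b :: 'k::field)"
  "\<one>\<^bsub>ring_of_type_algebra\<^esub> = (1 :: 'k::field)"
  "\<zero>\<^bsub>ring_of_type_algebra\<^esub> = (0 :: 'k::field)"
  by (auto simp: ring_of_type_algebra_def)

lemma ring_of_type_algebra_uminus [simp]: "\<ominus>\<^bsub>ring_of_type_algebra\<^esub> a = (- a :: 'k::field)"
proof -
  interpret cring "ring_of_type_algebra :: 'k ring" by (rule cring_from_type_algebra)
  show ?thesis using minus_equality[of "- a" a] by simp
qed

lemma nalgI:
  fixes V :: "('k::field, 'a) module" (structure)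
  assumes "abelian_group V"
    and "\<And>a x. x \<in> carrier V \<Longrightarrow> a \<odot> x \<in> carrier V"
    and "\<And>a b x. x \<in> carrier V \<Longrightarrow> (a + b) \<odot> x = a \<odot> x \<oplus> b \<odot> x"
    and "\<And>a x y. \<lbrakk>x \<in> carrier V; y \<in> carrier V\<rbrakk> \<Longrightarrow> a \<odot> (x \<oplus> y) = a \<odot> x \<oplus> a \<odot> y"
    and "\<And>a b x. x \<in> carrier V \<Longrightarrow> (a * b) \<odot> x = a \<odot> (b \<odot> x)"
    and "\<And>x. x \<in> carrier V \<Longrightarrow> 1 \<odot> x = x"
    and "\<And>x y. \<lbrakk>x \<in> carrier V; y \<in> carrier V\<rbrakk> \<Longrightarrow> x \<otimes> y \<in> carrier V"
    and "\<And>x y z. \<lbrakk>x \<in> carrier V; y \<in> carrier V; z \<in> carrier V\<rbrakk> \<Longrightarrow> (x \<oplus> y) \<otimes> z = x \<otimes> z \<oplus> y \<otimes> z"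
    and "\<And>x y z. \<lbrakk>x \<in> carrier V; y \<in> carrier V; z \<in> carrier V\<rbrakk> \<Longrightarrow> x \<otimes> (y \<oplus> z) = x \<otimes> y \<oplus> x \<otimes> z"
    and "\<And>a x y. \<lbrakk>x \<in> carrier V; y \<in> carrier V\<rbrakk> \<Longrightarrow> (a \<odot> x) \<otimes> y = a \<odot> (x \<otimes> y)"
    and "\<And>a x y. \<lbrakk>x \<in> carrier V; y \<in> carrier V\<rbrakk> \<Longrightarrow> x \<otimes> (a \<odot> y) = a \<odot> (x \<otimes> y)"
  shows "nalg V"
  by (intro nalg.intro nalg_axioms.intro Module.moduleI) (use assms in \<open>auto intro: cring_from_type_algebra\<close>)

lemma lie_algebra_iff:
  fixes V :: "('k::field, 'a) module" (structure)
  shows "lie_algebra V \<longleftrightarrow> nalg V \<and> (\<forall>x\<in>carrier V. x \<otimes> x = \<zero>) \<and>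
    (\<forall>x\<in>carrier V. \<forall>y\<in>carrier V. \<forall>z\<in>carrier V.
       x \<otimes> (y \<otimes> z) \<oplus> y \<otimes> (z \<otimes> x) \<oplus> z \<otimes> (x \<otimes> y) = \<zero>)"
  unfolding lie_algebra_def nalg_def lie_algebra_axioms_def nalg_axioms_def by auto

context nalg
begin

lemma nalg_smult_closed [simp]: "x \<in> carrier V \<Longrightarrow> a \<odot> x \<in> carrier V"
  using smult_closed[of a x] by simp

lemma nalg_smult_zero [simp]: "x \<in> carrier V \<Longrightarrow> 0 \<odot> x = \<zero>"
  using smult_l_null[of x] by simp

lemma nalg_smult_one [simp]: "x \<in> carrier V \<Longrightarrow> 1 \<odot> x = x"
  using smult_one[of x] by simp

lemma nalg_smult_zero_right [simp]: "a \<odot> \<zero> = \<zero>"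
  using smult_r_null[of a] by simp

lemma nalg_smult_minus: "x \<in> carrier V \<Longrightarrow> (- a) \<odot> x = \<ominus> (a \<odot> x)"
  using smult_l_minus[of a x] by simp

lemma nalg_smult_minus_right: "x \<in> carrier V \<Longrightarrow> a \<odot> (\<ominus> x) = \<ominus> (a \<odot> x)"
  using smult_r_minus[of a x] by simp

lemma nalg_smult_add: "x \<in> carrier V \<Longrightarrow> (a + b) \<odot> x = a \<odot> x \<oplus> b \<odot> x"
  using smult_l_distr[of a b x] by simp

lemma nalg_smult_add_right:
  "\<lbrakk>x \<in> carrier V; y \<in> carrier V\<rbrakk> \<Longrightarrow> a \<odot> (x \<oplus> y) = a \<odot> x \<oplus> a \<odot> y"
  using smult_r_distr[of a x y] by simp

lemma nalg_smult_assoc: "x \<in> carrier V \<Longrightarrow> (a * b) \<odot> x = a \<odot> (b \<odot> x)"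
  using smult_assoc1[of a b x] by simp

lemma nalg_zero_mult [simp]: "x \<in> carrier V \<Longrightarrow> \<zero> \<otimes> x = \<zero>"
  using mult_smult_left[of \<zero> x 0] by simp

lemma nalg_mult_zero [simp]: "x \<in> carrier V \<Longrightarrow> x \<otimes> \<zero> = \<zero>"
  using mult_smult_right[of x \<zero> 0] by simp

lemma nalg_minus_mult: "\<lbrakk>x \<in> carrier V; y \<in> carrier V\<rbrakk> \<Longrightarrow> (\<ominus> x) \<otimes> y = \<ominus> (x \<otimes> y)"
  using mult_smult_left[of x y "-1"] nalg_smult_minus[of _ 1] by simp

lemma nalg_mult_minus: "\<lbrakk>x \<in> carrier V; y \<in> carrier V\<rbrakk> \<Longrightarrow> x \<otimes> (\<ominus> y) = \<ominus> (x \<otimes> y)"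
  using mult_smult_right[of x y "-1"] nalg_smult_minus[of _ 1] by simp

end

text \<open>The axioms are identities together with the existence of negatives, so they pass along
  any surjection that respects the operations. Quotients are the case of interest.\<close>

lemma nalg_image:
  fixes V :: "('k::field, 'a) module" and W :: "('k, 'b) module"
  assumes V: "nalg V" and car: "carrier W = q ` carrier V" and zero: "\<zero>\<^bsub>W\<^esub> = q \<zero>\<^bsub>V\<^esub>"
    and add: "\<And>x y. \<lbrakk>x \<in> carrier V; y \<in> carrier V\<rbrakk> \<Longrightarrow> q x \<oplus>\<^bsub>W\<^esub> q y = q (x \<oplus>\<^bsub>V\<^esub> y)"
    and mult: "\<And>x y. \<lbrakk>x \<in> carrier V; y \<in> carrier V\<rbrakk> \<Longrightarrow> q x \<otimes>\<^bsub>W\<^esub> q y = q (x \<otimes>\<^bsub>V\<^esub> y)"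
    and smult: "\<And>a x. x \<in> carrier V \<Longrightarrow> a \<odot>\<^bsub>W\<^esub> q x = q (a \<odot>\<^bsub>V\<^esub> x)"
  shows "nalg W"
proof -
  interpret V: nalg V by fact
  have ag: "abelian_group W"
  proof (rule abelian_groupI)
    show "\<exists>y\<in>carrier W. y \<oplus>\<^bsub>W\<^esub> x = \<zero>\<^bsub>W\<^esub>" if "x \<in> carrier W" for x
    proof -
      from that obtain v where v: "v \<in> carrier V" "x = q v" by (auto simp: car)
      show ?thesis
        by (rule bexI[of _ "q (\<ominus>\<^bsub>V\<^esub> v)"]) (use v in \<open>auto simp: car zero add V.l_neg\<close>)
    qed
  qed (auto simp: car zero add V.a_assoc intro!: arg_cong[where f=q] V.a_comm)
  show ?thesis
    by (rule nalgI[OF ag])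
      (auto simp: car add mult smult V.nalg_smult_add V.nalg_smult_add_right V.nalg_smult_assoc
        V.mult_add_left V.mult_add_right V.mult_smult_left V.mult_smult_right)
qed

locale nalg_ideal = nalg V for V :: "('k::field, 'a) module" (structure) +
  fixes H :: "'a set"
  assumes H: "submodule H (ring_of_type_algebra :: 'k ring) V"
    and left: "\<lbrakk>x \<in> carrier V; y \<in> H\<rbrakk> \<Longrightarrow> x \<otimes> y \<in> H"
    and right: "\<lbrakk>x \<in> carrier V; y \<in> H\<rbrakk> \<Longrightarrow> y \<otimes> x \<in> H"
begin

lemma abelian_subgroup: "abelian_subgroup H V"
proof -
  have "subgroup H (add_monoid V)" using H unfolding submodule_def by blast
  then have "additive_subgroup H V" by (rule additive_subgroupI)
  then show ?thesis by (rule abelian_subgroupI3) (rule abelian_group_axioms)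
qed

sublocale H: abelian_subgroup H V by (rule abelian_subgroup)

lemma H_smult: "y \<in> H \<Longrightarrow> a \<odot> y \<in> H"
  using H unfolding submodule_def submodule_axioms_def by auto

lemma coset_eq_iff: "\<lbrakk>x \<in> carrier V; y \<in> carrier V\<rbrakk> \<Longrightarrow> H +> x = H +> y \<longleftrightarrow> x \<ominus> y \<in> H"
  using H.a_rcos_module[of y x] a_repr_independence[of x H y, OF _ _ H.a_subgroup] H.a_rcos_self[of x]
  unfolding minus_eq by metis

lemma coset_eqI: "\<lbrakk>x \<in> carrier V; h \<in> H\<rbrakk> \<Longrightarrow> H +> (h \<oplus> x) = H +> x"
  by (subst coset_eq_iff) (auto simp: minus_eq a_assoc r_neg)

lemma in_coset: "\<lbrakk>x \<in> carrier V; z \<in> H +> x\<rbrakk> \<Longrightarrow> \<exists>h\<in>H. z = h \<oplus> x"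
  by (auto simp: a_r_coset_def')

lemma quot_carrier: "carrier (quot_alg V H) = (\<lambda>x. H +> x) ` carrier V"
  by (auto simp: quot_alg_def FactRing_def ring.extend_def module.fields_def A_RCOSETS_def')

lemma quot_zero: "\<zero>\<^bsub>quot_alg V H\<^esub> = H +> \<zero>"
  by (simp add: quot_alg_def FactRing_def ring.extend_def module.fields_def a_coset_add_zero[OF H.a_subset])

lemma quot_one: "\<one>\<^bsub>quot_alg V H\<^esub> = H +> \<one>"
  by (simp add: quot_alg_def FactRing_def ring.extend_def module.fields_def)

lemma quot_add:
  "\<lbrakk>x \<in> carrier V; y \<in> carrier V\<rbrakk> \<Longrightarrow> (H +> x) \<oplus>\<^bsub>quot_alg V H\<^esub> (H +> y) = H +> (x \<oplus> y)"
  by (simp add: quot_alg_def FactRing_def ring.extend_def module.fields_def H.a_rcos_sum)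

text \<open>\<open>FactRing\<close> multiplies cosets by a union over all pairs of representatives.
  The members of this union coincide because a change of representatives alters the product by an
  element of the two-sided ideal.\<close>

lemma quot_mult:
  assumes x: "x \<in> carrier V" and y: "y \<in> carrier V"
  shows "(H +> x) \<otimes>\<^bsub>quot_alg V H\<^esub> (H +> y) = H +> (x \<otimes> y)"
proof -
  have "H +> (a \<otimes> b) = H +> (x \<otimes> y)" if a: "a \<in> H +> x" and b: "b \<in> H +> y" for a b
  proof -
    obtain h h' where h: "h \<in> H" "a = h \<oplus> x" and h': "h' \<in> H" "b = h' \<oplus> y"
      using in_coset[OF x a] in_coset[OF y b] by auto
    then have c: "h \<in> carrier V" "h' \<in> carrier V" by auto
    have "a \<otimes> b = (h \<otimes> (h' \<oplus> y) \<oplus> x \<otimes> h') \<oplus> x \<otimes> y"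
      using c x y by (simp add: h h' mult_add_left mult_add_right a_assoc a_lcomm)
    moreover have "h \<otimes> (h' \<oplus> y) \<oplus> x \<otimes> h' \<in> H"
      using c h h' x y by (intro H.a_closed left right) auto
    ultimately show ?thesis using x y by (auto intro!: coset_eqI)
  qed
  moreover have "x \<in> H +> x" "y \<in> H +> y" using x y by (auto intro: H.a_rcos_self)
  ultimately have "(\<Union>a\<in>H +> x. \<Union>b\<in>H +> y. H +> (a \<otimes> b)) = H +> (x \<otimes> y)" by blast
  then show ?thesis
    by (simp add: quot_alg_def FactRing_def ring.extend_def module.fields_def rcoset_mult_def)
qed

lemma quot_smult:
  assumes x: "x \<in> carrier V"
  shows "a \<odot>\<^bsub>quot_alg V H\<^esub> (H +> x) = H +> (a \<odot> x)"
proof -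
  have "H +> (a \<odot> z) = H +> (a \<odot> x)" if z: "z \<in> H +> x" for z
  proof -
    obtain h where h: "h \<in> H" "z = h \<oplus> x" using in_coset[OF x z] by auto
    then show ?thesis using x by (auto simp: nalg_smult_add_right intro!: coset_eqI H_smult)
  qed
  moreover have "x \<in> H +> x" using x by (auto intro: H.a_rcos_self)
  ultimately have "(\<Union>z\<in>H +> x. H +> (a \<odot> z)) = H +> (a \<odot> x)" by blast
  then show ?thesis
    by (simp add: quot_alg_def FactRing_def ring.extend_def module.fields_def)
qed

lemmas quot_simps = quot_carrier quot_zero quot_one quot_add quot_mult quot_smult

lemma nalg_quot: "nalg (quot_alg V H)"
  by (rule nalg_image[OF nalg_axioms, where q = "\<lambda>x. H +> x"]) (auto simp: quot_simps)

end

lemma (in nalg) submoduleI':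
  assumes "S \<subseteq> carrier V" "\<zero> \<in> S" "\<And>x y. \<lbrakk>x \<in> S; y \<in> S\<rbrakk> \<Longrightarrow> x \<oplus> y \<in> S"
    "\<And>a x. x \<in> S \<Longrightarrow> a \<odot> x \<in> S"
  shows "submodule S (ring_of_type_algebra :: 'k ring) V"
proof (rule submoduleI)
  show "\<ominus> x \<in> S" if "x \<in> S" for x
    using assms(4)[of x "-1"] nalg_smult_minus[of x 1] assms(1) that by auto
qed (use assms in auto)

lemma nalg_ring:
  fixes V :: "('k::field, 'a) module" (structure)
  assumes "nalg V" and "\<one> \<in> carrier V"
    and "\<And>x y z. \<lbrakk>x \<in> carrier V; y \<in> carrier V; z \<in> carrier V\<rbrakk> \<Longrightarrow> (x \<otimes> y) \<otimes> z = x \<otimes> (y \<otimes> z)"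
    and "\<And>x. x \<in> carrier V \<Longrightarrow> \<one> \<otimes> x = x" and "\<And>x. x \<in> carrier V \<Longrightarrow> x \<otimes> \<one> = x"
  shows "ring V"
proof -
  interpret nalg V by fact
  show ?thesis
    by (intro ringI abelian_group_axioms monoidI)
      (use assms in \<open>auto simp: mult_add_left mult_add_right\<close>)
qed

lemma (in nalg_ideal) ring_quot:
  assumes "ring V" shows "ring (quot_alg V H)"
proof -
  note m = ring.is_monoid[OF assms]
  show ?thesis
    by (rule nalg_ring[OF nalg_quot])
      (auto simp: quot_simps monoid.m_assoc[OF m] monoid.l_one[OF m] monoid.r_one[OF m] monoid.one_closed[OF m])
qed

lemma nalg_prod_alg:
  assumes "nalg V" "nalg W" shows "nalg (prod_alg V W)"
proof -
  interpret V: nalg V by fact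
  interpret W: nalg W by fact
  have "abelian_group (prod_alg V W)"
  proof (rule abelian_groupI)
    show "\<exists>y\<in>carrier (prod_alg V W). y \<oplus>\<^bsub>prod_alg V W\<^esub> x = \<zero>\<^bsub>prod_alg V W\<^esub>"
      if "x \<in> carrier (prod_alg V W)" for x
      by (rule bexI[of _ "(\<ominus>\<^bsub>V\<^esub> fst x, \<ominus>\<^bsub>W\<^esub> snd x)"])
        (use that in \<open>auto simp: prod_alg_def V.l_neg W.l_neg\<close>)
  qed (auto simp: prod_alg_def V.a_ac W.a_ac)
  then show ?thesis
    by (rule nalgI) (auto simp: prod_alg_def V.nalg_smult_add V.nalg_smult_add_right V.nalg_smult_assoc
        V.mult_add_left V.mult_add_right V.mult_smult_left V.mult_smult_right
        W.nalg_smult_add W.nalg_smult_add_right W.nalg_smult_assoc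
        W.mult_add_left W.mult_add_right W.mult_smult_left W.mult_smult_right)
qed

lemma lie_algebra_prod_alg:
  assumes "lie_algebra V" "lie_algebra W" shows "lie_algebra (prod_alg V W)"
  using assms nalg_prod_alg[of V W] by (auto simp: lie_algebra_iff prod_alg_def)

lemma nalg_Prod_alg:
  assumes "\<And>i. i \<in> I \<Longrightarrow> nalg (V i)" shows "nalg (Prod_alg I V)"
proof -
  note n = nalg.axioms(1)[OF assms, THEN module.axioms(2)] and a = nalg.mult_closed[OF assms]
  have m: "abelian_monoid (V i)" if "i \<in> I" for i using n[OF that] by (simp add: abelian_group_def)
  have "abelian_group (Prod_alg I V)"
  proof (rule abelian_groupI)
    show "\<exists>y\<in>carrier (Prod_alg I V). y \<oplus>\<^bsub>Prod_alg I V\<^esub> x = \<zero>\<^bsub>Prod_alg I V\<^esub>"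
      if "x \<in> carrier (Prod_alg I V)" for x
      by (rule bexI[of _ "\<lambda>i\<in>I. \<ominus>\<^bsub>V i\<^esub> x i"])
        (use that n in \<open>auto simp: Prod_alg_def abelian_group.l_neg[OF n] abelian_group.a_inv_closed[OF n] PiE_def Pi_def intro!: restrict_ext\<close>)
  qed (auto simp: Prod_alg_def abelian_monoid.a_assoc[OF m] abelian_monoid.a_comm[OF m] abelian_monoid.a_lcomm[OF m] abelian_monoid.r_zero[OF m] abelian_monoid.a_closed[OF m]
      abelian_monoid.zero_closed[OF m] abelian_monoid.l_zero[OF m] PiE_iff extensional_def intro!: restrict_ext ext)
  then show ?thesis
    by (rule nalgI)
      (auto simp: Prod_alg_def PiE_iff extensional_def nalg.nalg_smult_closed[OF assms] nalg.nalg_smult_one[OF assms] abelian_monoid.a_closed[OF m]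
       nalg.nalg_smult_add[OF assms] nalg.nalg_smult_add_right[OF assms] nalg.nalg_smult_assoc[OF assms]
        nalg.mult_add_left[OF assms] nalg.mult_add_right[OF assms] nalg.mult_smult_left[OF assms] nalg.mult_smult_right[OF assms]
        intro!: restrict_ext ext a)
qed

lemma lie_algebra_Prod_alg:
  assumes "\<And>i. i \<in> I \<Longrightarrow> lie_algebra (V i)" shows "lie_algebra (Prod_alg I V)"
  unfolding lie_algebra_iff
proof (intro conjI ballI)
  show "nalg (Prod_alg I V)" using assms by (intro nalg_Prod_alg) (auto simp: lie_algebra_iff)
qed (use assms in \<open>auto simp: Prod_alg_def PiE_iff lie_algebra.bracket_self lie_algebra.jacobi intro!: restrict_ext\<close>)

section \<open>Derivations\<close>

context nalg
begin

lemma minus_add_cancel: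
  "\<lbrakk>u \<in> carrier V; v \<in> carrier V; w \<in> carrier V\<rbrakk> \<Longrightarrow> (u \<oplus> w) \<ominus> (v \<oplus> w) = u \<ominus> v"
  by (simp add: minus_eq minus_add a_assoc a_lcomm[of w] r_neg)

lemma add_minus_add:
  "\<lbrakk>a \<in> carrier V; b \<in> carrier V; c \<in> carrier V; d \<in> carrier V\<rbrakk> \<Longrightarrow>
    (a \<oplus> b) \<ominus> (c \<oplus> d) = (a \<ominus> c) \<oplus> (b \<ominus> d)"
  by (simp add: minus_eq minus_add a_ac)

lemma minus_telescope:
  "\<lbrakk>u \<in> carrier V; v \<in> carrier V; w \<in> carrier V\<rbrakk> \<Longrightarrow> (u \<ominus> v) \<oplus> (v \<ominus> w) = u \<ominus> w"
  by (simp add: minus_eq a_assoc r_neg1 l_neg r_neg2)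

lemma minus_minus_eq:
  "\<lbrakk>u \<in> carrier V; v \<in> carrier V\<rbrakk> \<Longrightarrow> \<ominus> (u \<ominus> v) = v \<ominus> u"
  by (simp add: minus_eq minus_add a_comm)

lemma smult_minus_distrib:
  "\<lbrakk>x \<in> carrier V; y \<in> carrier V\<rbrakk> \<Longrightarrow> a \<odot> (x \<ominus> y) = a \<odot> x \<ominus> a \<odot> y"
  by (simp add: minus_eq nalg_smult_add_right nalg_smult_minus_right)

lemma minus_smult: "\<lbrakk>x \<in> carrier V\<rbrakk> \<Longrightarrow> (- 1) \<odot> x = \<ominus> x"
  using nalg_smult_minus[of x 1] by simp

lemma derivationsI:
  assumes "\<And>x. x \<in> carrier V \<Longrightarrow> f x \<in> carrier V"
    and "\<And>x. x \<notin> carrier V \<Longrightarrow> f x = undefined"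
    and "\<And>x y. \<lbrakk>x \<in> carrier V; y \<in> carrier V\<rbrakk> \<Longrightarrow> f (x \<oplus> y) = f x \<oplus> f y"
    and "\<And>a x. x \<in> carrier V \<Longrightarrow> f (a \<odot> x) = a \<odot> f x"
    and "\<And>x y. \<lbrakk>x \<in> carrier V; y \<in> carrier V\<rbrakk> \<Longrightarrow> f (x \<otimes> y) = f x \<otimes> y \<oplus> x \<otimes> f y"
  shows "f \<in> derivations V"
  using assms by (auto simp: derivations_def linear_maps_def)

lemma derivationsD:
  assumes "f \<in> derivations V"
  shows "x \<in> carrier V \<Longrightarrow> f x \<in> carrier V"
    and "x \<notin> carrier V \<Longrightarrow> f x = undefined"
    and "\<lbrakk>x \<in> carrier V; y \<in> carrier V\<rbrakk> \<Longrightarrow> f (x \<oplus> y) = f x \<oplus> f y"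
    and "x \<in> carrier V \<Longrightarrow> f (a \<odot> x) = a \<odot> f x"
    and "\<lbrakk>x \<in> carrier V; y \<in> carrier V\<rbrakk> \<Longrightarrow> f (x \<otimes> y) = f x \<otimes> y \<oplus> x \<otimes> f y"
  using assms by (auto simp: derivations_def linear_maps_def)

lemma derivation_zero: "f \<in> derivations V \<Longrightarrow> f \<zero> = \<zero>"
  using derivationsD(4)[of f \<zero> 0] derivationsD(1)[of f \<zero>] by simp

lemma derivation_uminus: "\<lbrakk>f \<in> derivations V; x \<in> carrier V\<rbrakk> \<Longrightarrow> f (\<ominus> x) = \<ominus> f x"
  using derivationsD(4)[of f x "- 1"] derivationsD(1)[of f x] by (simp add: minus_smult)

lemma derivation_minus: "\<lbrakk>f \<in> derivations V; x \<in> carrier V; y \<in> carrier V\<rbrakk> \<Longrightarrow> f (x \<ominus> y) = f x \<ominus> f y"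
  by (simp add: minus_eq derivationsD(3) derivation_uminus)

lemma der_alg_simps [simp]:
  "carrier (der_alg V) = derivations V" "\<zero>\<^bsub>der_alg V\<^esub> = (\<lambda>x\<in>carrier V. \<zero>)"
  "f \<oplus>\<^bsub>der_alg V\<^esub> g = (\<lambda>x\<in>carrier V. f x \<oplus> g x)"
  "f \<otimes>\<^bsub>der_alg V\<^esub> g = (\<lambda>x\<in>carrier V. f (g x) \<ominus> g (f x))"
  "a \<odot>\<^bsub>der_alg V\<^esub> f = (\<lambda>x\<in>carrier V. a \<odot> f x)"
  by (simp_all add: der_alg_def)

lemma derivation_bracket:
  assumes f: "f \<in> derivations V" and g: "g \<in> derivations V"
  shows "(\<lambda>x\<in>carrier V. f (g x) \<ominus> g (f x)) \<in> derivations V"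
proof (rule derivationsI)
  note F = derivationsD[OF f] and G = derivationsD[OF g]
  show "(\<lambda>x\<in>carrier V. f (g x) \<ominus> g (f x)) (x \<otimes> y) =
    (\<lambda>x\<in>carrier V. f (g x) \<ominus> g (f x)) x \<otimes> y \<oplus> x \<otimes> (\<lambda>x\<in>carrier V. f (g x) \<ominus> g (f x)) y"
    if x: "x \<in> carrier V" and y: "y \<in> carrier V" for x y
  proof -
    \<comment> \<open>The mixed terms are the same for both orders of composition and cancel in the
      commutator.\<close>
    let ?w = "g x \<otimes> f y \<oplus> f x \<otimes> g y"
    have 1: "f (g (x \<otimes> y)) = (f (g x) \<otimes> y \<oplus> x \<otimes> f (g y)) \<oplus> ?w"
      using x y by (simp add: F G a_ac)
    have 2: "g (f (x \<otimes> y)) = (g (f x) \<otimes> y \<oplus> x \<otimes> g (f y)) \<oplus> ?w"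
      using x y by (simp add: F G a_ac)
    show ?thesis
      using x y unfolding restrict_apply'[OF mult_closed[OF x y]] 1 2
      by (simp add: minus_add_cancel add_minus_add F G)
        (simp add: minus_eq mult_add_left mult_add_right nalg_minus_mult nalg_mult_minus F G)
  qed
qed (use derivationsD[OF f] derivationsD[OF g] in \<open>auto simp: add_minus_add smult_minus_distrib\<close>)

lemma derivation_add:
  assumes f: "f \<in> derivations V" and g: "g \<in> derivations V"
  shows "(\<lambda>x\<in>carrier V. f x \<oplus> g x) \<in> derivations V"
  by (rule derivationsI)
    (use derivationsD[OF f] derivationsD[OF g] in \<open>auto simp: a_ac nalg_smult_add_right mult_add_left mult_add_right\<close>)

lemma derivation_smult:
  assumes f: "f \<in> derivations V"
  shows "(\<lambda>x\<in>carrier V. a \<odot> f x) \<in> derivations V"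
  by (rule derivationsI)
    (use derivationsD[OF f] in \<open>auto simp: nalg_smult_add_right mult_smult_left mult_smult_right mult.commute simp flip: nalg_smult_assoc\<close>)

lemma nalg_der_alg: "nalg (der_alg V)"
proof (rule nalgI)
  have z: "(\<lambda>x\<in>carrier V. \<zero>) \<in> derivations V" by (rule derivationsI) auto
  show "abelian_group (der_alg V)"
  proof (rule abelian_groupI)
    show "\<exists>g\<in>carrier (der_alg V). g \<oplus>\<^bsub>der_alg V\<^esub> f = \<zero>\<^bsub>der_alg V\<^esub>" if "f \<in> carrier (der_alg V)" for f
      using that derivationsD(1)[of f] by (intro bexI[of _ "\<lambda>x\<in>carrier V. (- 1) \<odot> f x"])
        (auto simp: minus_smult l_neg derivation_smult intro!: restrict_ext)
    show "\<zero>\<^bsub>der_alg V\<^esub> \<oplus>\<^bsub>der_alg V\<^esub> f = f" if "f \<in> carrier (der_alg V)" for f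
      using that derivationsD(1,2)[of f] by (auto intro!: ext)
  qed (auto simp: z derivation_add derivationsD(1) a_ac intro!: restrict_ext)
next
  show "1 \<odot>\<^bsub>der_alg V\<^esub> f = f" if "f \<in> carrier (der_alg V)" for f
    using that derivationsD(1,2)[of f] by (auto intro!: ext)
qed (auto simp: derivation_bracket derivation_smult derivationsD nalg_smult_add nalg_smult_add_right
    nalg_smult_assoc add_minus_add smult_minus_distrib intro!: restrict_ext)

end

definition inner_der :: "('k, 'a) module \<Rightarrow> 'a \<Rightarrow> 'a \<Rightarrow> 'a" where
  "inner_der A b = (\<lambda>x\<in>carrier A. b \<otimes>\<^bsub>A\<^esub> x \<ominus>\<^bsub>A\<^esub> x \<otimes>\<^bsub>A\<^esub> b)"

lemma inner_derivations_eq: "inner_derivations A = inner_der A ` carrier A"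
  by (simp add: inner_derivations_def inner_der_def image_def)

context nalg
begin

context
  assumes ring: "ring V"
begin

lemmas V_assoc = monoid.m_assoc[OF ring.is_monoid[OF ring]]

lemma inner_der_derivation:
  assumes b: "b \<in> carrier V" shows "inner_der V b \<in> derivations V"
proof (rule derivationsI)
  show "inner_der V b (x \<otimes> y) = inner_der V b x \<otimes> y \<oplus> x \<otimes> inner_der V b y"
    if x: "x \<in> carrier V" and y: "y \<in> carrier V" for x y
  proof -
    \<comment> \<open>The middle term \<open>x \<otimes> (b \<otimes> y)\<close> occurs with both
      signs; associativity identifies its two forms.\<close>
    have "inner_der V b x \<otimes> y \<oplus> x \<otimes> inner_der V b y =
      (b \<otimes> (x \<otimes> y) \<ominus> x \<otimes> (b \<otimes> y)) \<oplus> (x \<otimes> (b \<otimes> y) \<ominus> (x \<otimes> y) \<otimes> b)"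
      using x y b by (simp add: inner_der_def)
        (simp add: minus_eq mult_add_left mult_add_right nalg_minus_mult nalg_mult_minus V_assoc)
    also have "\<dots> = inner_der V b (x \<otimes> y)"
      using x y b by (simp add: minus_telescope inner_der_def)
    finally show ?thesis ..
  qed
qed (use b in \<open>auto simp: inner_der_def mult_add_left mult_add_right add_minus_add mult_smult_left mult_smult_right smult_minus_distrib\<close>)

lemma inner_der_add: "\<lbrakk>b \<in> carrier V; c \<in> carrier V\<rbrakk> \<Longrightarrow>
    inner_der V b \<oplus>\<^bsub>der_alg V\<^esub> inner_der V c = inner_der V (b \<oplus> c)"
  by (auto simp: inner_der_def mult_add_left mult_add_right add_minus_add intro!: restrict_ext)

lemma inner_der_smult: "b \<in> carrier V \<Longrightarrow> a \<odot>\<^bsub>der_alg V\<^esub> inner_der V b = inner_der V (a \<odot> b)"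
  by (auto simp: inner_der_def mult_smult_left mult_smult_right smult_minus_distrib intro!: restrict_ext)

lemma inner_der_zero: "inner_der V \<zero> = \<zero>\<^bsub>der_alg V\<^esub>"
  by (auto simp: inner_der_def minus_eq r_neg intro!: restrict_ext)

text \<open>When D(bx - xb) is expanded by the Leibniz rule, the terms containing \<open>D x\<close>
  cancel. This makes the inner derivations an ideal.\<close>

lemma bracket_inner_der:
  assumes D: "D \<in> derivations V" and b: "b \<in> carrier V"
  shows "D \<otimes>\<^bsub>der_alg V\<^esub> inner_der V b = inner_der V (D b)"
proof -
  note F = derivationsD[OF D] derivation_minus[OF D]
  have "D (b \<otimes> x \<ominus> x \<otimes> b) \<ominus> (b \<otimes> D x \<ominus> D x \<otimes> b) = D b \<otimes> x \<ominus> x \<otimes> D b" if x: "x \<in> carrier V" for x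
  proof -
    have "D (b \<otimes> x \<ominus> x \<otimes> b) = (D b \<otimes> x \<ominus> x \<otimes> D b) \<oplus> (b \<otimes> D x \<ominus> D x \<otimes> b)"
      using b x by (simp add: F add_minus_add[symmetric] a_comm[of "x \<otimes> D b"])
    then show ?thesis using b x F(1) by (simp add: minus_eq a_assoc r_neg)
  qed
  then show ?thesis using F(1) by (auto simp: inner_der_def intro!: restrict_ext)
qed

lemma bracket_anti:
  assumes f: "f \<in> derivations V" and g: "g \<in> derivations V"
  shows "g \<otimes>\<^bsub>der_alg V\<^esub> f = (- 1) \<odot>\<^bsub>der_alg V\<^esub> (f \<otimes>\<^bsub>der_alg V\<^esub> g)"
  using derivationsD(1)[OF f] derivationsD(1)[OF g] by (auto simp: minus_smult minus_minus_eq intro!: restrict_ext)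

lemma nalg_ideal_inner: "nalg_ideal (der_alg V) (inner_derivations V)"
proof (intro nalg_ideal.intro nalg_der_alg nalg_ideal_axioms.intro)
  interpret D: nalg "der_alg V" by (rule nalg_der_alg)
  show "submodule (inner_derivations V) (ring_of_type_algebra :: 'k ring) (der_alg V)"
    by (rule D.submoduleI')
      (auto simp: inner_derivations_eq inner_der_derivation inner_der_add[unfolded der_alg_simps]
        inner_der_smult[unfolded der_alg_simps] inner_der_zero[unfolded der_alg_simps, symmetric])
  fix f g assume f: "f \<in> carrier (der_alg V)" and g: "g \<in> inner_derivations V"
  then obtain b where b: "b \<in> carrier V" "g = inner_der V b" by (auto simp: inner_derivations_eq)
  have fb: "f b \<in> carrier V" using f b derivationsD(1) by simp
  have 1: "f \<otimes>\<^bsub>der_alg V\<^esub> g = inner_der V (f b)" using bracket_inner_der f b by auto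
  then show "f \<otimes>\<^bsub>der_alg V\<^esub> g \<in> inner_derivations V" using fb by (auto simp: inner_derivations_eq)
  have "g \<otimes>\<^bsub>der_alg V\<^esub> f = (- 1) \<odot>\<^bsub>der_alg V\<^esub> (f \<otimes>\<^bsub>der_alg V\<^esub> g)"
    using f b inner_der_derivation by (intro bracket_anti) auto
  also have "\<dots> = inner_der V ((- 1) \<odot> f b)" unfolding 1 using fb by (rule inner_der_smult)
  finally show "g \<otimes>\<^bsub>der_alg V\<^esub> f \<in> inner_derivations V" using fb by (auto simp: inner_derivations_eq)
qed

end

end

lemma linear_mapsD:
  assumes "f \<in> linear_maps V W"
  shows "x \<in> carrier V \<Longrightarrow> f x \<in> carrier W" "x \<notin> carrier V \<Longrightarrow> f x = undefined"
    "\<lbrakk>x \<in> carrier V; y \<in> carrier V\<rbrakk> \<Longrightarrow> f (x \<oplus>\<^bsub>V\<^esub> y) = f x \<oplus>\<^bsub>W\<^esub> f y"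
    "x \<in> carrier V \<Longrightarrow> f (a \<odot>\<^bsub>V\<^esub> x) = a \<odot>\<^bsub>W\<^esub> f x"
  using assms by (auto simp: linear_maps_def)

lemma lie_homsD:
  assumes "f \<in> lie_homs V W"
  shows "f \<in> linear_maps V W" "\<lbrakk>x \<in> carrier V; y \<in> carrier V\<rbrakk> \<Longrightarrow> f (x \<otimes>\<^bsub>V\<^esub> y) = f x \<otimes>\<^bsub>W\<^esub> f y"
  using assms by (auto simp: lie_homs_def)

lemma lie_homsI:
  assumes "\<And>x. x \<in> carrier V \<Longrightarrow> f x \<in> carrier W" "\<And>x. x \<notin> carrier V \<Longrightarrow> f x = undefined"
    "\<And>x y. \<lbrakk>x \<in> carrier V; y \<in> carrier V\<rbrakk> \<Longrightarrow> f (x \<oplus>\<^bsub>V\<^esub> y) = f x \<oplus>\<^bsub>W\<^esub> f y"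
    "\<And>a x. x \<in> carrier V \<Longrightarrow> f (a \<odot>\<^bsub>V\<^esub> x) = a \<odot>\<^bsub>W\<^esub> f x"
    "\<And>x y. \<lbrakk>x \<in> carrier V; y \<in> carrier V\<rbrakk> \<Longrightarrow> f (x \<otimes>\<^bsub>V\<^esub> y) = f x \<otimes>\<^bsub>W\<^esub> f y"
  shows "f \<in> lie_homs V W"
  using assms by (auto simp: lie_homs_def linear_maps_def)

lemma lie_algebra_lie_line: "lie_algebra (lie_line :: ('k::field, 'k) module)"
  unfolding lie_algebra_iff
proof (intro conjI nalgI)
  show "abelian_group (lie_line :: ('k, 'k) module)"
  proof (rule abelian_groupI)
    show "\<exists>y\<in>carrier lie_line. y \<oplus>\<^bsub>lie_line\<^esub> x = \<zero>\<^bsub>lie_line\<^esub>" for x :: 'k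
      by (intro bexI[of _ "- x"]) (auto simp: lie_line_def)
  qed (auto simp: lie_line_def add_ac)
qed (auto simp: lie_line_def algebra_simps)

section \<open>Bilinear extension and path algebras\<close>

abbreviation single :: "'a \<Rightarrow> 'b \<Rightarrow> ('a \<Rightarrow>\<^sub>0 'b::zero)" where "single \<equiv> Poly_Mapping.single"
abbreviation keys :: "('a \<Rightarrow>\<^sub>0 'b::zero) \<Rightarrow> 'a set" where "keys \<equiv> Poly_Mapping.keys"
abbreviation lookup :: "('a \<Rightarrow>\<^sub>0 'b::zero) \<Rightarrow> 'a \<Rightarrow> 'b" where "lookup \<equiv> Poly_Mapping.lookup"

lemma lookup_scale [simp]: "lookup (scale a f) x = a * lookup f x"
  by (simp add: scale_def Poly_Mapping.map.rep_eq when_def)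

lemma scale_simps [simp]:
  "scale a 0 = 0" "scale 0 f = 0" "scale 1 f = f" "scale a (scale b f) = scale (a * b) f"
  "scale a (single x c) = single x (a * c)"
  by (auto intro!: poly_mapping_eqI simp: lookup_single when_def)

lemma scale_distribs:
  "scale a (f + g) = scale a f + scale a g" "scale (a + b) f = scale a f + scale b f"
  "scale a (- f) = - scale a f" "scale (- a) f = - scale a f"
  by (auto intro!: poly_mapping_eqI simp: lookup_add algebra_simps)

lemma scale_sum: "scale a (sum f S) = (\<Sum>x\<in>S. scale a (f x))"
  by (induction S rule: infinite_finite_induct) (auto simp: scale_distribs)

text \<open>A finitely supported function is the sum of its one-term parts, so a property closed
  under sums can be checked on multiples of basis elements. Linear and bilinear statements about
  paths or about the L_s are reduced to the basis in this way.\<close>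

lemma poly_mapping_span_induct [consumes 1, case_names zero single add]:
  fixes f :: "'a \<Rightarrow>\<^sub>0 'b::comm_monoid_add"
  assumes keys: "keys f \<subseteq> S"
    and zero: "P 0"
    and single: "\<And>x c. x \<in> S \<Longrightarrow> P (single x c)"
    and add: "\<And>f g. \<lbrakk>P f; P g\<rbrakk> \<Longrightarrow> P (f + g)"
  shows "P f"
proof -
  have "P (\<Sum>x\<in>T. single x (lookup f x))" if "T \<subseteq> keys f" for T
  proof -
    from that have "finite T" using finite_subset finite_keys by blast
    then show ?thesis using that by (induction T) (use keys in \<open>auto intro!: zero single add\<close>)
  qed
  moreover have "f = (\<Sum>x\<in>keys f. single x (lookup f x))"
    by (rule poly_mapping_eqI)
      (auto simp: lookup_sum lookup_single when_def sum.delta not_in_keys_iff_lookup_eq_zero)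
  ultimately show ?thesis by (metis order_refl)
qed

text \<open>The scalar multiplication is an argument because values are taken both in formal sums
  (\<open>scale\<close>) and in matrices (\<open>mscale\<close>).\<close>

definition lin :: "('k \<Rightarrow> 'b \<Rightarrow> 'b) \<Rightarrow> ('a \<Rightarrow> 'b) \<Rightarrow> ('a \<Rightarrow>\<^sub>0 'k::field) \<Rightarrow> 'b::ab_group_add" where
  "lin sc \<phi> f = (\<Sum>x\<in>keys f. sc (lookup f x) (\<phi> x))"

lemma module_scale: "Modules.module (scale :: 'k::field \<Rightarrow> _)"
  by unfold_locales (auto simp: scale_distribs)

context
  fixes sc :: "'k::field \<Rightarrow> 'b \<Rightarrow> 'b::ab_group_add"
  assumes sc: "Modules.module sc"
begin

interpretation sc: Modules.module sc by (rule sc)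

lemma lin_superset:
  "\<lbrakk>finite S; keys f \<subseteq> S\<rbrakk> \<Longrightarrow> lin sc \<phi> f = (\<Sum>x\<in>S. sc (lookup f x) (\<phi> x))"
  unfolding lin_def by (rule sum.mono_neutral_left) (auto simp: not_in_keys_iff_lookup_eq_zero)

lemma lin_zero: "lin sc \<phi> 0 = 0"
  by (simp add: lin_def)

lemma lin_single: "lin sc \<phi> (single x c) = sc c (\<phi> x)"
  by (subst lin_superset[of "{x}"]) auto

lemma lin_add: "lin sc \<phi> (f + g) = lin sc \<phi> f + lin sc \<phi> g"
proof -
  let ?S = "keys f \<union> keys g"
  have "keys (f + g) \<subseteq> ?S" by (rule keys_add)
  then show ?thesis
    by (simp add: lin_superset[of ?S] lookup_add sc.scale_left_distrib sum.distrib)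
qed

lemma lin_scale: "lin sc \<phi> (scale a f) = sc a (lin sc \<phi> f)"
  by (subst lin_superset[of "keys f"])
    (auto simp: lin_def sc.scale_sum_right in_keys_iff)

lemma lin_fun_add: "lin sc (\<lambda>x. \<phi> x + \<psi> x) f = lin sc \<phi> f + lin sc \<psi> f"
  by (simp add: lin_def sc.scale_right_distrib sum.distrib)

lemma lin_fun_scale: "lin sc (\<lambda>x. sc a (\<phi> x)) f = sc a (lin sc \<phi> f)"
  by (auto simp: lin_def sc.scale_sum_right intro!: sum.cong) (metis mult.commute)

lemma lin_fun_zero: "lin sc (\<lambda>_. 0) f = 0"
  by (simp add: lin_def)

end

lemma bilinear_ext_lin: "bilinear_ext \<beta> f g = lin scale (\<lambda>x. lin scale (\<beta> x) g) f"
  by (simp add: bilinear_ext_def lin_def scale_sum)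

lemma bilinear_ext_simps [simp]:
  "bilinear_ext \<beta> 0 g = 0" "bilinear_ext \<beta> f 0 = 0"
  "bilinear_ext \<beta> (single x a) (single y b) = scale (a * b) (\<beta> x y)"
  "bilinear_ext \<beta> (scale a f) g = scale a (bilinear_ext \<beta> f g)"
  "bilinear_ext \<beta> f (scale a g) = scale a (bilinear_ext \<beta> f g)"
  by (auto simp: bilinear_ext_lin lin_zero[OF module_scale] lin_fun_zero[OF module_scale]
      lin_single[OF module_scale] lin_scale[OF module_scale] lin_fun_scale[OF module_scale] mult.commute)

lemma bilinear_ext_add:
  "bilinear_ext \<beta> (f + f') g = bilinear_ext \<beta> f g + bilinear_ext \<beta> f' g"
  "bilinear_ext \<beta> f (g + g') = bilinear_ext \<beta> f g + bilinear_ext \<beta> f g'"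
  by (auto simp: bilinear_ext_lin lin_add[OF module_scale] lin_fun_add[OF module_scale])

lemma keys_bilinear_ext:
  assumes "keys f \<subseteq> S" "keys g \<subseteq> T"
    and "\<And>x y. \<lbrakk>x \<in> S; y \<in> T\<rbrakk> \<Longrightarrow> keys (\<beta> x y) \<subseteq> U"
  shows "keys (bilinear_ext \<beta> f g) \<subseteq> U"
proof
  fix z assume z: "z \<in> keys (bilinear_ext \<beta> f g)"
  have "\<exists>x\<in>keys f. \<exists>y\<in>keys g. lookup (\<beta> x y) z \<noteq> 0"
  proof (rule ccontr)
    assume "\<not> ?thesis"
    then have "lookup (bilinear_ext \<beta> f g) z = 0"
      by (auto simp: bilinear_ext_def lookup_sum)
    then show False using z by (simp add: in_keys_iff)
  qed
  then show "z \<in> U" using assms by (meson in_keys_iff subsetD)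
qed

lemma keys_scale: "keys (scale a f) \<subseteq> keys f"
  by (auto simp: in_keys_iff)

abbreviation pm :: "(_ \<Rightarrow>\<^sub>0 'k::field) \<Rightarrow> _" where "pm \<equiv> bilinear_ext path_mult"

text \<open>\<open>path_mult\<close> compares end points and nothing else, so on triples both sides
  are the concatenation of all three if the end points match, and zero otherwise.\<close>

lemma path_mult_assoc:
  "pm (pm f g) h = pm f (pm g (h :: _ \<Rightarrow>\<^sub>0 'k::field))"
proof -
  have "keys f \<subseteq> UNIV" "keys g \<subseteq> UNIV" "keys h \<subseteq> UNIV" by auto
  then show ?thesis
  proof (induction f rule: poly_mapping_span_induct)
    case (single x c)
    from single.prems(1) show ?case
    proof (induction g rule: poly_mapping_span_induct)
      case (single y d)
      from \<open>keys h \<subseteq> UNIV\<close> show ?case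
      proof (induction h rule: poly_mapping_span_induct)
        case (single z e)
        show ?case by (cases x; cases y; cases z) (auto simp: algebra_simps)
      qed (auto simp: bilinear_ext_add)
    qed (auto simp: bilinear_ext_add)
  qed (auto simp: bilinear_ext_add)
qed

lemma pre_digraph_cas_append:
  "\<lbrakk>pre_digraph.cas G u p v; pre_digraph.cas G v q w\<rbrakk> \<Longrightarrow> pre_digraph.cas G u (p @ q) w"
  by (induction p arbitrary: u) (auto simp: pre_digraph.cas.simps)

lemmas paths_simps = paths_def pre_digraph.awalk_def pre_digraph.cas.simps

lemma paths_append: "\<lbrakk>(u, p, v) \<in> paths G; (v, q, w) \<in> paths G\<rbrakk> \<Longrightarrow> (u, p @ q, w) \<in> paths G"
  by (auto simp: paths_def pre_digraph.awalk_def intro: pre_digraph_cas_append)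

lemma path_algebra_simps [simp]:
  "carrier (path_algebra G) = {f. keys f \<subseteq> paths G}"
  "f \<oplus>\<^bsub>path_algebra G\<^esub> g = f + g" "f \<otimes>\<^bsub>path_algebra G\<^esub> g = pm f g"
  "\<zero>\<^bsub>path_algebra G\<^esub> = 0" "a \<odot>\<^bsub>path_algebra G\<^esub> f = scale a f"
  by (simp_all add: path_algebra_def)

lemma keys_path_mult:
  assumes "keys f \<subseteq> paths G" "keys g \<subseteq> paths G"
  shows "keys (pm f g :: _ \<Rightarrow>\<^sub>0 'k::field) \<subseteq> paths G"
  using assms
proof (rule keys_bilinear_ext)
  fix x y assume "x \<in> paths G" "y \<in> paths G"
  then show "keys (path_mult x y :: _ \<Rightarrow>\<^sub>0 'k) \<subseteq> paths G"
    by (cases x; cases y) (auto intro: paths_append split: if_splits)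
qed

lemma nalg_path_algebra: "nalg (path_algebra G :: ('k::field, _) module)"
proof (rule nalgI)
  show "abelian_group (path_algebra G :: ('k, _) module)"
  proof (rule abelian_groupI)
    show "\<exists>y\<in>carrier (path_algebra G). y \<oplus>\<^bsub>path_algebra G\<^esub> x = \<zero>\<^bsub>path_algebra G\<^esub>"
      if "x \<in> carrier (path_algebra G :: ('k, _) module)" for x
      using that by (intro bexI[of _ "- x"]) auto
  qed (auto simp: add_ac dest!: subsetD[OF keys_add])
next
  show "a \<odot>\<^bsub>path_algebra G\<^esub> f \<in> carrier (path_algebra G)"
    if "f \<in> carrier (path_algebra G)" for a :: 'k and f
    using that keys_scale[of a f] by auto
next
  show "f \<otimes>\<^bsub>path_algebra G\<^esub> g \<in> carrier (path_algebra G)"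
    if "f \<in> carrier (path_algebra G)" "g \<in> carrier (path_algebra G)" for f g :: "_ \<Rightarrow>\<^sub>0 'k"
    using that keys_path_mult[of f G g] by simp
qed (simp_all add: scale_distribs bilinear_ext_add)

lemma keys_path_algebra_one:
  "keys (\<one>\<^bsub>path_algebra G\<^esub> :: _ \<Rightarrow>\<^sub>0 'k::field) \<subseteq> paths G"
proof -
  have "keys (\<Sum>v\<in>verts G. single (v, [], v) 1 :: _ \<Rightarrow>\<^sub>0 'k) \<subseteq>
      (\<Union>v\<in>verts G. keys (single (v, [], v) 1 :: _ \<Rightarrow>\<^sub>0 'k))"
    by (rule keys_sum)
  also have "\<dots> \<subseteq> paths G"
    by (auto simp: paths_simps)
  finally show ?thesis by (simp add: path_algebra_def)
qed

lemma bilinear_ext_sum: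
  "bilinear_ext \<beta> (sum f S) g = (\<Sum>x\<in>S. bilinear_ext \<beta> (f x) g)"
  "bilinear_ext \<beta> g (sum f S) = (\<Sum>x\<in>S. bilinear_ext \<beta> g (f x))"
  by (induction S rule: infinite_finite_induct) (auto simp: bilinear_ext_add)

lemma cas_last: "\<lbrakk>pre_digraph.cas G u p v; u \<in> verts G; set p \<subseteq> arcs G; \<And>e. e \<in> arcs G \<Longrightarrow> head G e \<in> verts G\<rbrakk>
    \<Longrightarrow> v \<in> verts G"
  by (induction p arbitrary: u) (auto simp: pre_digraph.cas.simps)

text \<open>A \<open>pre_digraph\<close> carries no well-formedness. The condition on heads ensures
  that a path ends at a vertex, so that its trivial path there is a summand of the unit; finiteness
  makes the sum defining the unit meaningful.\<close>

lemma ring_path_algebra: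
  assumes "finite (verts G)" and head: "\<And>e. e \<in> arcs G \<Longrightarrow> head G e \<in> verts G"
  shows "ring (path_algebra G :: ('k::field, _) module)"
proof (rule nalg_ring[OF nalg_path_algebra])
  fix x :: "_ \<Rightarrow>\<^sub>0 'k" assume "x \<in> carrier (path_algebra G)"
  then have "keys x \<subseteq> paths G" by simp
  then have "pm \<one>\<^bsub>path_algebra G\<^esub> x = x \<and> pm x \<one>\<^bsub>path_algebra G\<^esub> = x"
  proof (induction x rule: poly_mapping_span_induct)
    case (single x c)
    obtain u p v where x: "x = (u, p, v)" by (cases x)
    have v: "u \<in> verts G" "v \<in> verts G"
      using single cas_last[OF _ _ _ head] by (auto simp: x paths_def pre_digraph.awalk_def)
    have *: "scale a (if P then b else 0) = (if P then scale a b else 0)" for a :: 'k and P and b :: "_ \<Rightarrow>\<^sub>0 'k"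
      by simp
    show ?case using assms(1) v
      by (simp add: x path_algebra_def bilinear_ext_sum * sum.delta sum.delta' cong: if_cong)
  qed (auto simp: bilinear_ext_add)
  then show "\<one>\<^bsub>path_algebra G\<^esub> \<otimes>\<^bsub>path_algebra G\<^esub> x = x" "x \<otimes>\<^bsub>path_algebra G\<^esub> \<one>\<^bsub>path_algebra G\<^esub> = x"
    by auto
qed (simp_all add: keys_path_algebra_one path_mult_assoc)

lemma bilinear_ext_diff: "bilinear_ext \<beta> (f - f') g = bilinear_ext \<beta> f g - bilinear_ext \<beta> f' g"
  using bilinear_ext_add(1)[of \<beta> "f - f'" f' g] by (simp add: algebra_simps)

section \<open>Power series and vector fields\<close>

datatype 'a mat2 = M2 (m11: 'a) (m12: 'a) (m21: 'a) (m22: 'a)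

instantiation mat2 :: (comm_ring_1) ring_1
begin

definition "0 = M2 0 0 0 0"
definition "1 = M2 1 0 0 1"
definition "A + B = M2 (m11 A + m11 B) (m12 A + m12 B) (m21 A + m21 B) (m22 A + m22 B)"
definition "A - B = M2 (m11 A - m11 B) (m12 A - m12 B) (m21 A - m21 B) (m22 A - m22 B)"
definition "- A = M2 (- m11 A) (- m12 A) (- m21 A) (- m22 A)"
definition "A * B = M2 (m11 A * m11 B + m12 A * m21 B) (m11 A * m12 B + m12 A * m22 B)
  (m21 A * m11 B + m22 A * m21 B) (m21 A * m12 B + m22 A * m22 B)"

lemmas mat2_defs = zero_mat2_def one_mat2_def plus_mat2_def minus_mat2_def uminus_mat2_def times_mat2_def

instance
  by standard (simp_all add: mat2_defs algebra_simps)

end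

lemma mat2_sels [simp]:
  "m11 0 = 0" "m12 0 = 0" "m21 0 = 0" "m22 0 = 0"
  "m11 1 = 1" "m12 1 = 0" "m21 1 = 0" "m22 1 = 1"
  "m11 (A + B) = m11 A + m11 B" "m12 (A + B) = m12 A + m12 B"
  "m21 (A + B) = m21 A + m21 B" "m22 (A + B) = m22 A + m22 B"
  "m11 (A - B) = m11 A - m11 B" "m12 (A - B) = m12 A - m12 B"
  "m21 (A - B) = m21 A - m21 B" "m22 (A - B) = m22 A - m22 B"
  "m11 (- A) = - m11 A" "m12 (- A) = - m12 A" "m21 (- A) = - m21 A" "m22 (- A) = - m22 A"
  "m11 (A * B) = m11 A * m11 B + m12 A * m21 B" "m12 (A * B) = m11 A * m12 B + m12 A * m22 B"
  "m21 (A * B) = m21 A * m11 B + m22 A * m21 B" "m22 (A * B) = m21 A * m12 B + m22 A * m22 B"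
  by (simp_all add: mat2_defs)

definition mscale :: "'k::field \<Rightarrow> 'k fps mat2 \<Rightarrow> 'k fps mat2" where
  "mscale c A = map_mat2 ((*) (fps_const c)) A"

lemma mscale_sels [simp]:
  "m11 (mscale c A) = fps_const c * m11 A" "m12 (mscale c A) = fps_const c * m12 A"
  "m21 (mscale c A) = fps_const c * m21 A" "m22 (mscale c A) = fps_const c * m22 A"
  by (auto simp: mscale_def mat2.map_sel)

lemma module_mscale: "Modules.module (mscale :: 'k::field \<Rightarrow> _)"
  by unfold_locales (auto simp: algebra_simps mat2.expand simp flip: fps_const_add fps_const_mult intro!: mat2.expand)

lemma mscale_mult: "mscale a A * B = mscale a (A * B)" "A * mscale a B = mscale a (A * B)"
  by (auto intro!: mat2.expand simp: algebra_simps)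

fun alt :: "'a \<Rightarrow> 'a \<Rightarrow> nat \<Rightarrow> 'a list" where
  "alt x y 0 = []"
| "alt x y (Suc n) = x # alt y x n"

lemma alt_add: "alt x y (n + k) = alt x y n @ (if even n then alt x y k else alt y x k)"
  by (induction x y n rule: alt.induct) auto

lemma set_alt: "set (alt x y n) \<subseteq> {x, y}"
  by (induction x y n rule: alt.induct) auto

lemma paths_split:
  assumes "(u, p @ q, v) \<in> paths G" and head: "\<And>e. e \<in> arcs G \<Longrightarrow> head G e \<in> verts G"
  obtains w where "(u, p, w) \<in> paths G" "(w, q, v) \<in> paths G"
proof -
  have "\<exists>w. pre_digraph.cas G u p w \<and> pre_digraph.cas G w q v" if "pre_digraph.cas G u (p @ q) v"
    using that by (induction p arbitrary: u) (auto simp: pre_digraph.cas.simps)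
  with assms(1) obtain w where w: "pre_digraph.cas G u p w" "pre_digraph.cas G w q v"
    by (auto simp: paths_def pre_digraph.awalk_def)
  moreover have "w \<in> verts G"
    using cas_last[OF w(1) _ _ head] assms(1) by (auto simp: paths_def pre_digraph.awalk_def)
  ultimately show ?thesis
    using assms(1) by (intro that[of w]) (auto simp: paths_def pre_digraph.awalk_def)
qed

text \<open>Divisibility by t^k, that is, order of vanishing at least \<open>k\<close>.\<close>

definition vo :: "nat \<Rightarrow> 'k::field fps \<Rightarrow> bool" where
  "vo k a \<longleftrightarrow> (\<forall>i<k. a $ i = 0)"

lemma vo_zero [simp]: "vo k 0" "vo 0 a"
  by (auto simp: vo_def)

lemma vo_add: "vo k a \<Longrightarrow> vo k b \<Longrightarrow> vo k (a + b)"
  and vo_diff: "vo k a \<Longrightarrow> vo k b \<Longrightarrow> vo k (a - b)"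
  and vo_uminus: "vo k a \<Longrightarrow> vo k (- a)"
  by (auto simp: vo_def)

lemma vo_mult: "vo k a \<Longrightarrow> vo l b \<Longrightarrow> vo (k + l) (a * b)"
proof -
  assume a: "vo k a" and b: "vo l b"
  have "a $ i * b $ (n - i) = 0" if "n < k + l" "i \<le> n" for n i
    using a b that by (cases "i < k") (auto simp: vo_def)
  then show ?thesis by (auto simp: vo_def fps_mult_nth intro!: sum.neutral)
qed

lemma vo_mult_left: "vo k b \<Longrightarrow> vo k (a * b)"
  using vo_mult[of 0 a k b] by simp

lemma vo_mult_right: "vo k a \<Longrightarrow> vo k (a * b)"
  using vo_mult[of k a 0 b] by simp

text \<open>In the convolution only the term with the constant coefficient of \<open>a\<close>
  survives. With \<open>k\<close> equal to \<open>N\<close> this computes how multiplication acts on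
  the socle.\<close>

lemma vo_mult_nth_left: "vo k b \<Longrightarrow> (a * b) $ k = a $ 0 * b $ k"
proof -
  assume b: "vo k b"
  have "(a * b) $ k = (\<Sum>i=0..k. if i = 0 then a $ 0 * b $ k else 0)"
    unfolding fps_mult_nth using b by (intro sum.cong) (auto simp: vo_def)
  then show ?thesis by simp
qed

lemma vo_mult_nth_right: "vo k a \<Longrightarrow> (a * b) $ k = a $ k * b $ 0"
  using vo_mult_nth_left[of k a b] by (simp add: mult.commute)

lemma vo_mono: "vo k a \<Longrightarrow> l \<le> k \<Longrightarrow> vo l a"
  by (auto simp: vo_def)

lemma vo_nth: "vo k a \<Longrightarrow> i < k \<Longrightarrow> a $ i = 0"
  by (auto simp: vo_def)

lemma vo_1_iff: "vo (Suc 0) a \<longleftrightarrow> a $ 0 = 0"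
  by (auto simp: vo_def)

lemma vo_X_power [simp]: "vo k (fps_X ^ l) \<longleftrightarrow> k \<le> l"
  by (auto simp: vo_def fps_X_power_nth)

lemma sum_diag: "(\<Sum>v\<in>S. M2 (f v) 0 0 (g v)) = M2 (sum f S) 0 0 (sum g S)"
  by (induction S rule: infinite_finite_induct) (auto simp: mat2_defs)

text \<open>The operator t d/dt multiplies the i-th coefficient by i, whereas the derivative alone
  would shift coefficients down.\<close>

lemma vo_X_deriv: "vo k a \<Longrightarrow> vo k (fps_X * fps_deriv a)"
  by (auto simp: vo_def)

text \<open>\<open>[t P d/dt, t Q d/dt] = t (brk P Q) d/dt\<close>, and \<open>brk (t\<^sup>s) (t\<^sup>r) =
  (r - s) t\<^sup>s\<^sup>+\<^sup>r\<close> as for \<open>L\<^sub>s\<close>,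
  \<open>L\<^sub>r\<close>.\<close>

definition brk :: "'k::field fps \<Rightarrow> 'k fps \<Rightarrow> 'k fps" where
  "brk P Q = fps_X * (P * fps_deriv Q - Q * fps_deriv P)"

lemma brk_alt: "brk P Q = P * (fps_X * fps_deriv Q) - Q * (fps_X * fps_deriv P)"
  by (simp add: brk_def algebra_simps)

lemma brk_simps [simp]: "brk P P = 0" "brk 0 Q = 0" "brk P 0 = 0" "brk P Q $ 0 = 0"
  by (simp_all add: brk_def)

lemma brk_add: "brk (P + P') Q = brk P Q + brk P' Q" "brk P (Q + Q') = brk P Q + brk P Q'"
  by (simp_all add: brk_def algebra_simps)

lemma brk_scale: "brk (fps_const a * P) Q = fps_const a * brk P Q" "brk P (fps_const a * Q) = fps_const a * brk P Q"
  by (simp_all add: brk_def algebra_simps)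

lemma brk_jacobi: "brk P (brk Q U) + brk Q (brk U P) + brk U (brk P Q) = 0"
  by (simp add: brk_def algebra_simps)

lemma brk_power: "brk (fps_X ^ i) (fps_X ^ k) = fps_const (of_int (int k - int i)) * (fps_X ^ (i + k) :: 'k::field fps)"
proof -
  have "fps_X * fps_deriv (fps_X ^ n) = fps_const (of_nat n) * (fps_X ^ n :: 'k fps)" for n
    by (rule fps_ext) (simp add: fps_X_power_nth)
  then show ?thesis by (simp add: brk_alt power_add algebra_simps flip: fps_const_sub)
qed

text \<open>The bracket involves the derivative through t d/dt, which preserves every ideal (t^k),
  so it descends to truncated series. The arguments are exchanged one at a time.\<close>

lemma brk_cong:
  assumes "vo k (P - P')" "vo k (Q - Q')" shows "vo k (brk P Q - brk P' Q')"
proof -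
  have "brk P Q - brk P' Q' = (P - P') * (fps_X * fps_deriv Q) + P' * (fps_X * fps_deriv (Q - Q')) -
     ((Q - Q') * (fps_X * fps_deriv P) + Q' * (fps_X * fps_deriv (P - P')))"
    by (simp add: brk_alt algebra_simps)
  then show ?thesis
    using vo_diff[OF vo_add[OF vo_mult_right[OF assms(1)] vo_mult_left[OF vo_X_deriv[OF assms(2)]]]
        vo_add[OF vo_mult_right[OF assms(2)] vo_mult_left[OF vo_X_deriv[OF assms(1)]]]]
    by (simp only:)
qed

text \<open>The derivation \<open>t P d/dt + [diag(\<mu>, 0), -]\<close> of the algebra of matrices.\<close>

definition dd :: "'k::field fps \<Rightarrow> 'k fps \<Rightarrow> 'k fps mat2 \<Rightarrow> 'k fps mat2" where
  "dd \<mu> P M = M2 (P * (fps_X * fps_deriv (m11 M))) (P * (fps_X * fps_deriv (m12 M)) + \<mu> * m12 M)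
     (P * (fps_X * fps_deriv (m21 M)) - \<mu> * m21 M) (P * (fps_X * fps_deriv (m22 M)))"

lemma dd_add: "dd \<mu> P (M + M') = dd \<mu> P M + dd \<mu> P M'"
  by (rule mat2.expand) (simp add: dd_def algebra_simps)

lemma dd_diff: "dd \<mu> P (M - M') = dd \<mu> P M - dd \<mu> P M'"
  by (rule mat2.expand) (simp add: dd_def algebra_simps)

lemma dd_mscale: "dd \<mu> P (mscale c M) = mscale c (dd \<mu> P M)"
  by (rule mat2.expand) (simp add: dd_def algebra_simps)

lemma dd_mult: "dd \<mu> P (M * M') = dd \<mu> P M * M' + M * dd \<mu> P M'"
  by (rule mat2.expand) (simp add: dd_def algebra_simps)

lemma dd_param_add: "dd (\<mu> + \<mu>') (P + P') M = dd \<mu> P M + dd \<mu>' P' M"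
  by (rule mat2.expand) (simp add: dd_def algebra_simps)

lemma dd_param_scale: "dd (fps_const c * \<mu>) (fps_const c * P) M = mscale c (dd \<mu> P M)"
  by (rule mat2.expand) (simp add: dd_def algebra_simps)

text \<open>The two diagonal matrices commute, so the new diagonal parameter comes from each vector
  field differentiating the diagonal matrix of the other.\<close>

lemma dd_bracket:
  "dd \<mu> P (dd \<nu> Q M) - dd \<nu> Q (dd \<mu> P M) =
     dd (fps_X * (P * fps_deriv \<nu> - Q * fps_deriv \<mu>)) (brk P Q) M"
  by (rule mat2.expand) (simp add: dd_def brk_def algebra_simps)

section \<open>The truncations of the Virasoro algebra\<close>

lemma virasoro_simps [simp]:
  "carrier virasoro = UNIV" "f \<oplus>\<^bsub>virasoro\<^esub> g = f + g" "\<zero>\<^bsub>virasoro\<^esub> = 0"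
  "f \<otimes>\<^bsub>virasoro\<^esub> g = bilinear_ext vir_gen_bracket f g" "a \<odot>\<^bsub>virasoro\<^esub> f = scale a f"
  by (simp_all add: virasoro_def)

lemma nalg_virasoro: "nalg (virasoro :: ('k::field, _) module)"
proof (rule nalgI)
  show "abelian_group (virasoro :: ('k, _) module)"
  proof (rule abelian_groupI)
    show "\<exists>g\<in>carrier virasoro. g \<oplus>\<^bsub>virasoro\<^esub> f = \<zero>\<^bsub>virasoro\<^esub>" for f :: "vir_gen \<Rightarrow>\<^sub>0 'k"
      by (intro bexI[of _ "- f"]) auto
  qed (auto simp: add_ac)
qed (auto simp: scale_distribs bilinear_ext_add)

lemma submoduleD:
  assumes "submodule S (ring_of_type_algebra :: 'k::field ring) V"
  shows "S \<subseteq> carrier V" "\<zero>\<^bsub>V\<^esub> \<in> S" "\<lbrakk>x \<in> S; y \<in> S\<rbrakk> \<Longrightarrow> x \<oplus>\<^bsub>V\<^esub> y \<in> S" "x \<in> S \<Longrightarrow> a \<odot>\<^bsub>V\<^esub> x \<in> S"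
proof -
  have s: "subgroup S (add_monoid V)" using assms by (simp add: submodule_def)
  show "S \<subseteq> carrier V" "\<zero>\<^bsub>V\<^esub> \<in> S" "\<lbrakk>x \<in> S; y \<in> S\<rbrakk> \<Longrightarrow> x \<oplus>\<^bsub>V\<^esub> y \<in> S"
    using subgroup.subset[OF s] subgroup.one_closed[OF s] subgroup.m_closed[OF s] by auto
  show "x \<in> S \<Longrightarrow> a \<odot>\<^bsub>V\<^esub> x \<in> S" using assms by (auto simp: submodule_def submodule_axioms_def)
qed

definition vspan :: "int set \<Rightarrow> (vir_gen \<Rightarrow>\<^sub>0 'k::field) set" where
  "vspan S = {f. keys f \<subseteq> VL ` S}"

abbreviation VP :: "(vir_gen \<Rightarrow>\<^sub>0 'k::field) set" where
  "VP \<equiv> vspan {0..}"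

lemma vspan_closed:
  "0 \<in> vspan S" "\<lbrakk>f \<in> vspan S; g \<in> vspan S\<rbrakk> \<Longrightarrow> f + g \<in> vspan S"
  "f \<in> vspan S \<Longrightarrow> scale a f \<in> vspan S" "f \<in> vspan S \<Longrightarrow> - f \<in> vspan S"
  "s \<in> S \<Longrightarrow> single (VL s) a \<in> vspan S"
  using keys_add[of f g] keys_scale[of a f] by (auto simp: vspan_def keys_minus)

lemma vspan_mono: "S \<subseteq> T \<Longrightarrow> f \<in> vspan S \<Longrightarrow> f \<in> vspan T"
  using image_mono[of S T VL] by (auto simp: vspan_def)

text \<open>For non-negative indices \<open>s + r = 0\<close> forces \<open>s = r = 0\<close>, where
  s^3 - s vanishes. The central element \<open>VC\<close> therefore never appears, and the indices
  alone decide where the bracket lies.\<close>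

lemma vspan_bracket:
  assumes f: "f \<in> vspan S" and g: "g \<in> vspan T"
    and ST: "\<And>s r. \<lbrakk>s \<in> S; r \<in> T\<rbrakk> \<Longrightarrow> s + r \<in> U \<and> s \<ge> 0 \<and> r \<ge> 0"
  shows "bilinear_ext vir_gen_bracket f (g :: _ \<Rightarrow>\<^sub>0 'k::field) \<in> vspan U"
  unfolding vspan_def mem_Collect_eq
proof (rule keys_bilinear_ext)
  show "keys f \<subseteq> VL ` S" "keys g \<subseteq> VL ` T" using f g by (auto simp: vspan_def)
  fix x y assume "x \<in> VL ` S" "y \<in> VL ` T"
  then obtain s r where x: "x = VL s" "y = VL r" "s + r \<in> U" "s \<ge> 0" "r \<ge> 0" using ST by auto
  show "keys (vir_gen_bracket x y :: _ \<Rightarrow>\<^sub>0 'k) \<subseteq> VL ` U"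
  proof (cases "s + r = 0")
    case True
    then have "s = 0" "r = 0" using x by auto
    then show ?thesis using x by simp
  next
    case False
    then show ?thesis using x by (auto split: if_splits)
  qed
qed

text \<open>The minimality half of the computation of a generated subalgebra or ideal. The
  operations are hypotheses so that it applies to \<open>virasoro\<close> and to
  \<open>vir_plus\<close> alike.\<close>

lemma span_subset:
  assumes S: "submodule S (ring_of_type_algebra :: 'k::field ring) V"
    and ops: "\<zero>\<^bsub>V\<^esub> = 0" "\<And>f g. f \<oplus>\<^bsub>V\<^esub> g = f + g" "\<And>a f. a \<odot>\<^bsub>V\<^esub> f = scale a f"
    and L: "vir_L ` T \<subseteq> S" and f: "f \<in> vspan T"
  shows "f \<in> S"
  using f unfolding vspan_def mem_Collect_eq
proof (induction f rule: poly_mapping_span_induct)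
  case zero
  then show ?case using submoduleD(2)[OF S] by (simp add: ops)
next
  case (single x c)
  then obtain s where "s \<in> T" "x = VL s" by auto
  then show ?case using submoduleD(4)[OF S, of "vir_L s" c] L by (auto simp: ops vir_L_def)
next
  case (add f g)
  then show ?case using submoduleD(3)[OF S add] by (simp add: ops)
qed

lemma vir_L_vspan: "s \<in> S \<Longrightarrow> (vir_L s :: _ \<Rightarrow>\<^sub>0 'k::field) \<in> vspan S"
  by (simp add: vir_L_def vspan_closed)

lemma vir_plus_carrier: "carrier (vir_plus :: ('k::field, _) module) = VP"
proof -
  interpret V: nalg "virasoro :: ('k, _) module" by (rule nalg_virasoro)
  have "lie_subalgebra VP (virasoro :: ('k, _) module)"
    unfolding lie_subalgebra_def
    by (intro conjI V.submoduleI') (auto intro!: vspan_closed intro: vspan_bracket)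
  moreover have "vir_L ` {0..} \<subseteq> (VP :: (_ \<Rightarrow>\<^sub>0 'k) set)" by (auto intro: vir_L_vspan)
  moreover have "VP \<subseteq> S" if "lie_subalgebra S (virasoro :: ('k, _) module)" "vir_L ` {0..} \<subseteq> S" for S
    using that span_subset[of S virasoro "{0..}"] by (auto simp: lie_subalgebra_def)
  ultimately show ?thesis unfolding vir_plus_def by auto
qed

lemma vir_plus_simps [simp]:
  "f \<oplus>\<^bsub>vir_plus\<^esub> g = f + g" "\<zero>\<^bsub>vir_plus\<^esub> = 0"
  "f \<otimes>\<^bsub>vir_plus\<^esub> g = bilinear_ext vir_gen_bracket f g" "a \<odot>\<^bsub>vir_plus\<^esub> f = scale a f"
  by (simp_all add: vir_plus_def virasoro_def)

lemma VP_bracket: "\<lbrakk>f \<in> VP; g \<in> VP\<rbrakk> \<Longrightarrow> bilinear_ext vir_gen_bracket f g \<in> VP"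
  by (rule vspan_bracket) auto

lemma nalg_vir_plus: "nalg (vir_plus :: ('k::field, _) module)"
proof (rule nalgI)
  show "abelian_group (vir_plus :: ('k, _) module)"
  proof (rule abelian_groupI)
    show "\<exists>g\<in>carrier vir_plus. g \<oplus>\<^bsub>vir_plus\<^esub> f = \<zero>\<^bsub>vir_plus\<^esub>" if "f \<in> carrier vir_plus" for f :: "vir_gen \<Rightarrow>\<^sub>0 'k"
      using that by (intro bexI[of _ "- f"]) (auto simp: vir_plus_carrier vspan_closed VP_bracket)
  qed (auto simp: add_ac vir_plus_carrier vspan_closed VP_bracket)
qed (auto simp: scale_distribs bilinear_ext_add vir_plus_carrier vspan_closed VP_bracket)

lemma vir_gt_eq: "vir_gt q = (vspan {int q<..} :: (_ \<Rightarrow>\<^sub>0 'k::field) set)"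
proof -
  interpret V: nalg "vir_plus :: ('k, _) module" by (rule nalg_vir_plus)
  let ?G = "vspan {int q<..} :: (_ \<Rightarrow>\<^sub>0 'k) set"
  have "lie_ideal ?G (vir_plus :: ('k, _) module)"
    unfolding lie_ideal_def
    by (intro conjI V.submoduleI')
      (auto simp: vir_plus_carrier intro!: vspan_closed intro: vspan_bracket vspan_mono[of "{int q<..}" "{0..}"])
  moreover have "vir_L ` {int q<..} \<subseteq> ?G" by (auto intro: vir_L_vspan)
  moreover have "?G \<subseteq> S" if "lie_ideal S (vir_plus :: ('k, _) module)" "vir_L ` {int q<..} \<subseteq> S" for S
    using that span_subset[of S vir_plus "{int q<..}"] by (auto simp: lie_ideal_def)
  ultimately show ?thesis unfolding vir_gt_def by blast
qed

lemma nalg_ideal_vir_gt: "nalg_ideal (vir_plus :: ('k::field, _) module) (vir_gt q)"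
proof (intro nalg_ideal.intro nalg_vir_plus nalg_ideal_axioms.intro)
  interpret V: nalg "vir_plus :: ('k, _) module" by (rule nalg_vir_plus)
  show "submodule (vir_gt q) (ring_of_type_algebra :: 'k ring) vir_plus"
    by (intro V.submoduleI')
      (auto simp: vir_plus_carrier vir_gt_eq intro!: vspan_closed intro: vspan_mono[of "{int q<..}" "{0..}"])
qed (auto simp: vir_plus_carrier vir_gt_eq intro: vspan_bracket)

text \<open>L_n becomes t^n. On \<open>VP\<close>, where neither negative indices nor
  \<open>VC\<close> occur, no information is lost.\<close>

definition wV :: "(vir_gen \<Rightarrow>\<^sub>0 'k::field) \<Rightarrow> 'k fps" where
  "wV f = Abs_fps (\<lambda>n. lookup f (VL (int n)))"

lemma wV_simps [simp]:
  "wV (f + g) = wV f + wV g" "wV (scale a f) = fps_const a * wV f" "wV 0 = 0" "wV (f - g) = wV f - wV g"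
  by (auto simp: wV_def lookup_add lookup_minus intro!: fps_ext)

lemma wV_single: "wV (single (VL (int n)) c) = fps_const c * fps_X ^ n"
  by (auto simp: wV_def lookup_single when_def fps_X_power_nth intro!: fps_ext)

lemma wV_bracket:
  assumes "f \<in> VP" "g \<in> VP"
  shows "wV (bilinear_ext vir_gen_bracket f g) = brk (wV f) (wV g)"
proof -
  have f: "keys f \<subseteq> VL ` {0..}" and g: "keys g \<subseteq> VL ` {0..}"
    using assms by (auto simp: vspan_def)
  from f show ?thesis
  proof (induction f rule: poly_mapping_span_induct)
    case (single x a)
    then obtain i where x: "x = VL (int i)" by (metis atLeast_iff imageE nonneg_int_cases)
    from g show ?case
    proof (induction g rule: poly_mapping_span_induct)
      case (single y b)
      then obtain k where y: "y = VL (int k)" by (metis atLeast_iff imageE nonneg_int_cases)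
      have "bilinear_ext vir_gen_bracket (single x a) (single y b) =
        single (VL (int (i + k))) (a * b * of_int (int k - int i))"
        by (cases "i = 0 \<and> k = 0") (auto simp: x y)
      then show ?case
        by (simp only: x y wV_single brk_scale brk_power) (simp add: mult.assoc mult.left_commute flip: fps_const_mult)
    qed (auto simp: bilinear_ext_add brk_add)
  qed (auto simp: bilinear_ext_add brk_add)
qed

lemma vir_gt_iff: "f \<in> VP \<Longrightarrow> f \<in> vir_gt q \<longleftrightarrow> vo (Suc q) (wV f)"
proof
  assume "f \<in> VP" and v: "vo (Suc q) (wV f)"
  have "x \<in> VL ` {int q<..}" if x: "x \<in> keys f" for x
  proof -
    obtain n where n: "x = VL (int n)" using x \<open>f \<in> VP\<close> unfolding vspan_def by (auto dest!: subsetD) (metis nonneg_int_cases)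
    have "wV f $ n \<noteq> 0" using x by (simp add: wV_def n in_keys_iff)
    then have "n > q" using v by (auto simp: vo_def not_less_eq)
    then show ?thesis by (simp add: n)
  qed
  then show "f \<in> vir_gt q" by (auto simp: vir_gt_eq vspan_def)
next
  assume "f \<in> vir_gt q"
  then have "VL (int i) \<notin> keys f" if "i < Suc q" for i
    using that by (auto simp: vir_gt_eq vspan_def)
  then show "vo (Suc q) (wV f)" by (simp add: vo_def wV_def in_keys_iff)
qed

text \<open>Elements of \<open>vir_plus\<close> are finite sums whereas \<open>P\<close> may be an
  infinite series, hence the cut at \<open>q\<close>, which is harmless modulo
  \<open>vir_gt q\<close>. The coefficients of vector fields can thus be inserted directly.\<close>

definition aq :: "nat \<Rightarrow> 'k::field fps \<Rightarrow> 'k fa_elem" where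
  "aq q P = vir_gt q +>\<^bsub>vir_plus\<^esub> (\<Sum>s\<le>q. single (VL (int s)) (P $ s))"

lemma VP_sum: "(\<Sum>s\<le>(q :: nat). single (VL (int s)) (P s)) \<in> VP"
proof -
  have "(\<Sum>s\<in>S. single (VL (int s)) (P s)) \<in> VP" for S
    by (induction S rule: infinite_finite_induct) (auto intro!: vspan_closed)
  then show ?thesis .
qed

lemma vir_coset_eq: "\<lbrakk>f \<in> VP; g \<in> VP\<rbrakk> \<Longrightarrow>
    vir_gt q +>\<^bsub>vir_plus\<^esub> f = vir_gt q +>\<^bsub>vir_plus\<^esub> g \<longleftrightarrow> vo (Suc q) (wV f - wV g)"
proof -
  interpret V: nalg "vir_plus :: ('a, _) module" by (rule nalg_vir_plus)
  assume f: "f \<in> VP" and g: "g \<in> VP"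
  have "\<ominus>\<^bsub>vir_plus\<^esub> g = - g" using g by (intro V.minus_equality) (auto simp: vir_plus_carrier vspan_closed)
  then have "f \<ominus>\<^bsub>vir_plus\<^esub> g = f - g" by (simp add: a_minus_def)
  moreover have "f - g \<in> VP" using vspan_closed(2)[OF f vspan_closed(4)[OF g]] by simp
  ultimately show ?thesis
    using nalg_ideal.coset_eq_iff[OF nalg_ideal_vir_gt, of f g q] f g vir_gt_iff[of "f - g" q]
    by (simp add: vir_plus_carrier)
qed

lemma vo_wV_trunc: "vo (Suc q) (wV (\<Sum>s\<le>q. single (VL (int s)) (P $ s)) - P)"
  by (auto simp: vo_def wV_def lookup_sum lookup_single when_def)

lemma vo_trans: "vo k (a - b) \<Longrightarrow> vo k (b - c) \<Longrightarrow> vo k (a - c)"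
  and vo_sym: "vo k (a - b) \<Longrightarrow> vo k (b - a)"
  by (auto simp: vo_def)

lemma aq_eq: "aq q P = aq q Q \<longleftrightarrow> vo (Suc q) (P - Q)"
  unfolding aq_def vir_coset_eq[OF VP_sum VP_sum]
  using vo_wV_trunc[of q P] vo_wV_trunc[of q Q] vo_trans vo_sym by metis

lemma coset_aq: "f \<in> VP \<Longrightarrow> vir_gt q +>\<^bsub>vir_plus\<^esub> f = aq q (wV f)"
  unfolding aq_def vir_coset_eq[OF _ VP_sum] using vo_wV_trunc vo_sym by blast

lemma lie_a_carrier: "carrier (lie_a q :: ('k::field, _) module) = range (aq q)"
proof -
  have "carrier (lie_a q :: ('k, _) module) = (\<lambda>f. vir_gt q +>\<^bsub>vir_plus\<^esub> f) ` VP"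
    unfolding lie_a_def by (simp add: nalg_ideal.quot_carrier[OF nalg_ideal_vir_gt] vir_plus_carrier)
  also have "\<dots> = range (aq q)"
    using VP_sum coset_aq by (auto simp: aq_def image_iff) blast+
  finally show ?thesis .
qed

lemma lie_a_zero: "\<zero>\<^bsub>lie_a q\<^esub> = aq q 0"
  unfolding lie_a_def by (simp add: nalg_ideal.quot_zero[OF nalg_ideal_vir_gt] coset_aq vspan_closed)

lemma lie_a_add: "aq q P \<oplus>\<^bsub>lie_a q\<^esub> aq q Q = aq q (P + Q)"
proof -
  let ?f = "\<lambda>P. \<Sum>s\<le>q. single (VL (int s)) (P $ s)"
  have "aq q P \<oplus>\<^bsub>lie_a q\<^esub> aq q Q = vir_gt q +>\<^bsub>vir_plus\<^esub> (?f P + ?f Q)"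
    unfolding lie_a_def aq_def[of q P] aq_def[of q Q]
    by (simp add: nalg_ideal.quot_add[OF nalg_ideal_vir_gt] vir_plus_carrier VP_sum)
  also have "\<dots> = aq q (wV (?f P + ?f Q))" by (intro coset_aq vspan_closed VP_sum)
  also have "\<dots> = aq q (P + Q)"
    unfolding aq_eq using vo_add[OF vo_wV_trunc[of q P] vo_wV_trunc[of q Q]] by (simp add: algebra_simps)
  finally show ?thesis .
qed

lemma lie_a_smult: "a \<odot>\<^bsub>lie_a q\<^esub> aq q P = aq q (fps_const a * P)"
proof -
  let ?f = "\<lambda>P. \<Sum>s\<le>q. single (VL (int s)) (P $ s)"
  have "a \<odot>\<^bsub>lie_a q\<^esub> aq q P = vir_gt q +>\<^bsub>vir_plus\<^esub> (scale a (?f P))"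
    unfolding lie_a_def aq_def[of q P]
    by (simp add: nalg_ideal.quot_smult[OF nalg_ideal_vir_gt] vir_plus_carrier VP_sum)
  also have "\<dots> = aq q (wV (scale a (?f P)))" by (intro coset_aq vspan_closed VP_sum)
  also have "\<dots> = aq q (fps_const a * P)"
    unfolding aq_eq using vo_mult_left[OF vo_wV_trunc[of q P], of "fps_const a"] by (simp add: algebra_simps)
  finally show ?thesis .
qed

lemma lie_a_bracket: "aq q P \<otimes>\<^bsub>lie_a q\<^esub> aq q Q = aq q (brk P Q)"
proof -
  let ?f = "\<lambda>P. \<Sum>s\<le>q. single (VL (int s)) (P $ s)"
  have "aq q P \<otimes>\<^bsub>lie_a q\<^esub> aq q Q = vir_gt q +>\<^bsub>vir_plus\<^esub> (bilinear_ext vir_gen_bracket (?f P) (?f Q))"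
    unfolding lie_a_def aq_def[of q P] aq_def[of q Q]
    by (simp add: nalg_ideal.quot_mult[OF nalg_ideal_vir_gt] vir_plus_carrier VP_sum)
  also have "\<dots> = aq q (wV (bilinear_ext vir_gen_bracket (?f P) (?f Q)))" by (intro coset_aq VP_bracket VP_sum)
  also have "\<dots> = aq q (brk P Q)"
    unfolding aq_eq wV_bracket[OF VP_sum VP_sum] by (intro brk_cong vo_wV_trunc)
  finally show ?thesis .
qed

lemma a_L_eq: "a_L q s = aq q (fps_X ^ s)"
  unfolding a_L_def vir_L_def by (subst coset_aq) (auto simp: wV_single intro: vspan_closed)

lemma lie_algebra_lie_a: "lie_algebra (lie_a q :: ('k::field, _) module)"
proof -
  have "nalg (lie_a q :: ('k, _) module)"
    unfolding lie_a_def by (rule nalg_ideal.nalg_quot[OF nalg_ideal_vir_gt])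
  then show ?thesis
    by (auto simp: lie_algebra_iff lie_a_carrier lie_a_bracket lie_a_add lie_a_zero brk_jacobi)
qed

section \<open>The quiver algebra as an algebra of matrices\<close>

locale quiver_alg =
  fixes m N :: nat and ty :: "'k::field itself"
  assumes m3: "m \<ge> 3" and N1: "N \<ge> 1"
    and two_nz: "(2 :: 'k) \<noteq> 0" and N_nz: "(of_nat N :: 'k) \<noteq> 0" and m_nz: "(of_nat m :: 'k) \<noteq> 0"
begin

abbreviation V :: "int set" where "V \<equiv> {0..<int m}"

abbreviation R :: "('k, 'k kQ) module" where "R \<equiv> path_algebra (quiver m)"
abbreviation I :: "'k kQ set" where "I \<equiv> rel_ideal m N"

lemma mod_verts [simp]: "0 \<le> i mod int m" "i mod int m < int m"
  using m3 by auto

text \<open>The last inequality is where m >= 3 enters: the two neighbours of a vertex are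
  distinct.\<close>

lemma mod_succ_neq: "i mod int m \<noteq> (i + 1) mod int m" "(i + 1) mod int m \<noteq> i mod int m"
    "(i + 1) mod int m \<noteq> (i - 1) mod int m"
proof -
  have "\<not> int m dvd 1" "\<not> int m dvd 2" using m3 zdvd_imp_le[of "int m" 1] zdvd_imp_le[of "int m" 2] by auto
  then show "i mod int m \<noteq> (i + 1) mod int m" "(i + 1) mod int m \<noteq> i mod int m"
    "(i + 1) mod int m \<noteq> (i - 1) mod int m"
    by (auto simp: mod_eq_dvd_iff)
qed

lemma mod_add1_eq_iff: "(i + 1) mod int m = (j + 1) mod int m \<longleftrightarrow> i mod int m = j mod int m"
  by (auto simp: mod_eq_dvd_iff)

lemma quiver_simps [simp]:
  "verts (quiver m) = V" "arcs (quiver m) = Arr ` V \<union> Bar ` V"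
  "tail (quiver m) (Arr i) = i" "tail (quiver m) (Bar i) = (i + 1) mod int m"
  "head (quiver m) (Arr i) = (i + 1) mod int m" "head (quiver m) (Bar i) = i"
  by (simp_all add: quiver_def)

lemma quiver_head: "e \<in> arcs (quiver m) \<Longrightarrow> head (quiver m) e \<in> verts (quiver m)"
  by auto

lemma ring_R: "ring R"
  by (rule ring_path_algebra) (use quiver_head in auto)

sublocale R: nalg R by (rule nalg_path_algebra)

section \<open>Matrix representation of the path algebra\<close>

definition vrep :: "int \<Rightarrow> int \<Rightarrow> 'k fps mat2" where
  "vrep j u = M2 (of_bool (u = j mod int m)) 0 0 (of_bool (u = (j + 1) mod int m))"

fun arep :: "int \<Rightarrow> arrow \<Rightarrow> 'k fps mat2" where
  "arep j (Arr i) = (if i = j mod int m then M2 0 1 0 0 else 0)"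
| "arep j (Bar i) = (if i = j mod int m then M2 0 0 fps_X 0 else 0)"

fun prep :: "int \<Rightarrow> (int, arrow) path \<Rightarrow> 'k fps mat2" where
  "prep j (u, p, v) = vrep j u * prod_list (map (arep j) p)"

text \<open>\<open>hm f j\<close> is the image of \<open>f\<close> in the \<open>j\<close>-th copy of the
  matrix algebra; here and below \<open>j\<close> is read modulo \<open>m\<close>.\<close>

definition hm :: "'k kQ \<Rightarrow> int \<Rightarrow> 'k fps mat2" where
  "hm f j = lin mscale (prep j) f"

lemma vrep_mult: "vrep j u * vrep j v = (if u = v then vrep j u else 0)"
  by (auto intro!: mat2.expand simp: vrep_def)

lemma arep_head: "e \<in> arcs (quiver m) \<Longrightarrow> arep j e * vrep j (head (quiver m) e) = arep j e"
  by (cases e) (auto intro!: mat2.expand simp: vrep_def mod_simps)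

text \<open>\<open>prep\<close> writes the idempotent of the source explicitly; that of the target
  is absorbed because each arrow absorbs the idempotent of its head. Whether two paths compose is
  then tested by the product of two idempotents.\<close>

lemma prep_vrep: "(u, p, v) \<in> paths (quiver m) \<Longrightarrow> prep j (u, p, v) * vrep j v = prep j (u, p, v)"
proof (induction p arbitrary: u)
  case (Cons e p)
  then have e: "e \<in> arcs (quiver m)" and "(head (quiver m) e, p, v) \<in> paths (quiver m)"
    using quiver_head by (auto simp: paths_simps)
  then have IH: "prep j (head (quiver m) e, p, v) * vrep j v = prep j (head (quiver m) e, p, v)"
    using Cons.IH by blast
  have "prep j (u, e # p, v) = vrep j u * arep j e * prep j (head (quiver m) e, p, v)"
  proof -
    have "arep j e * z = arep j e * (vrep j (head (quiver m) e) * z)" for z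
      by (simp only: mult.assoc[symmetric] arep_head[OF e])
    from this[of "prod_list (map (arep j) p)"] show ?thesis
      by (simp only: prep.simps list.map prod_list.Cons mult.assoc)
  qed
  then show ?case by (simp only: mult.assoc IH)
qed (auto simp: paths_simps vrep_mult)

lemma hm_add: "hm (f + g) j = hm f j + hm g j"
  and hm_scale: "hm (scale a f) j = mscale a (hm f j)"
  and hm_zero [simp]: "hm 0 j = 0"
  and hm_single: "hm (single p c) j = mscale c (prep j p)"
  by (simp_all add: hm_def lin_add[OF module_mscale] lin_scale[OF module_mscale]
      lin_zero[OF module_mscale] lin_single[OF module_mscale])

lemma hm_uminus: "hm (- f) j = - hm f j"
  using hm_add[of f "- f" j] by (simp add: eq_neg_iff_add_eq_0 add.commute)

lemma hm_diff: "hm (f - g) j = hm f j - hm g j"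
  using hm_add[of f "- g" j] by (simp add: hm_uminus)

lemma mscale_simps [simp]: "mscale c 0 = 0" "mscale 0 M = 0" "mscale 1 M = M"
  by (auto intro!: mat2.expand)

lemma prep_path_mult:
  assumes "x \<in> paths (quiver m)" "y \<in> paths (quiver m)"
  shows "hm (path_mult x y) j = prep j x * prep j y"
proof -
  obtain u p v u' q w where x: "x = (u, p, v)" and y: "y = (u', q, w)"
    by (cases x; cases y)
  have xv: "prep j x * vrep j v = prep j x" using prep_vrep assms by (simp only: x)
  have "prep j x * prep j y = prep j x * vrep j v * (vrep j u' * prod_list (map (arep j) q))"
    by (simp only: xv y prep.simps)
  also have "\<dots> = prep j x * (vrep j v * vrep j u') * prod_list (map (arep j) q)"
    by (simp only: mult.assoc)
  also have "\<dots> = (if v = u' then prep j (u, p @ q, w) else 0)"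
    by (simp only: vrep_mult mult.assoc[symmetric] xv split: if_split) (simp add: x mult.assoc)
  also have "\<dots> = hm (path_mult x y) j"
    by (simp add: x y hm_single)
  finally show ?thesis ..
qed

lemma hm_mult:
  assumes "f \<in> carrier R" "g \<in> carrier R"
  shows "hm (f \<otimes>\<^bsub>R\<^esub> g) j = hm f j * hm g j"
proof -
  from assms have f: "keys f \<subseteq> paths (quiver m)" and g: "keys g \<subseteq> paths (quiver m)"
    by auto
  from f have "hm (pm f g) j = hm f j * hm g j"
  proof (induction f rule: poly_mapping_span_induct)
    case (single x c)
    from g show ?case
    proof (induction g rule: poly_mapping_span_induct)
      case (single y d)
      show ?case using \<open>x \<in> _\<close> \<open>y \<in> _\<close>
        by (auto simp: hm_scale hm_single prep_path_mult mscale_mult simp flip: fps_const_mult intro!: mat2.expand)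
    qed (auto simp: bilinear_ext_add hm_add algebra_simps)
  qed (auto simp: bilinear_ext_add hm_add algebra_simps)
  then show ?thesis by simp
qed

lemma hm_mod: "hm f (j mod int m) = hm f j"
proof -
  have "vrep (j mod int m) = vrep j" by (auto simp: vrep_def mod_simps)
  moreover have "arep (j mod int m) = arep j"
  proof
    show "arep (j mod int m) e = arep j e" for e by (cases e) auto
  qed
  ultimately have "prep (j mod int m) p = prep j p" for p by (cases p) simp
  then have "prep (j mod int m) = prep j" by (rule ext)
  then show ?thesis by (simp add: hm_def)
qed

lemma hm_one: "hm \<one>\<^bsub>R\<^esub> j = 1"
proof -
  have "hm (sum f S) j = (\<Sum>x\<in>S. hm (f x) j)" for f and S :: "int set"
    by (induction S rule: infinite_finite_induct) (auto simp: hm_add)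
  then have "hm \<one>\<^bsub>R\<^esub> j = (\<Sum>v\<in>V. vrep j v)"
    by (simp add: path_algebra_def hm_single)
  also have "\<dots> = M2 (\<Sum>v\<in>V. of_bool (v = j mod int m)) 0 0
      (\<Sum>v\<in>V. of_bool (v = (j + 1) mod int m))"
    unfolding vrep_def by (rule sum_diag)
  also have "\<dots> = 1"
    by (simp add: one_mat2_def of_bool_def sum.delta)
  finally show ?thesis .
qed

text \<open>The path of length \<open>n\<close> that alternates between \<open>a\<^sub>j\<close> and its
  reverse; it starts at \<open>j\<close> if \<open>d\<close> holds and at \<open>j + 1\<close>
  otherwise.\<close>

definition apath :: "bool \<Rightarrow> int \<Rightarrow> nat \<Rightarrow> (int, arrow) path" where
  "apath d j n = (let i = j mod int m; i' = (j + 1) mod int m in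
     if d then (i, alt (Arr i) (Bar i) n, if even n then i else i')
     else (i', alt (Bar i) (Arr i) n, if even n then i' else i))"

text \<open>The matrix of an alternating path of positive length. The exponent counts its reversed
  arrows, each of which contributes a factor t; hence the extra 1 for odd paths that begin with
  one.\<close>

definition munit :: "bool \<Rightarrow> nat \<Rightarrow> 'k fps mat2" where
  "munit d n =
     (if d then (if even n then M2 (fps_X ^ (n div 2)) 0 0 0 else M2 0 (fps_X ^ (n div 2)) 0 0)
      else (if even n then M2 0 0 0 (fps_X ^ (n div 2)) else M2 0 0 (fps_X ^ (n div 2 + 1)) 0))"

text \<open>The coefficient of \<open>apath d j n\<close> in \<open>M\<close>.  A trivial path is counted
  twice, as \<open>(True, j, 0)\<close> and as \<open>(False, j - 1, 0)\<close>.\<close>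

definition cf :: "(int \<Rightarrow> 'k fps mat2) \<Rightarrow> bool \<Rightarrow> int \<Rightarrow> nat \<Rightarrow> 'k" where
  "cf M d j n =
     (if d then (if even n then m11 (M j) $ (n div 2) else m12 (M j) $ (n div 2))
      else (if even n then m22 (M j) $ (n div 2) else m21 (M j) $ (n div 2 + 1)))"

lemma apath_in_paths [simp]: "apath d j n \<in> paths (quiver m)"
proof -
  have *: "pre_digraph.cas (quiver m) i (alt (Arr i) (Bar i) n) (if even n then i else (i + 1) mod int m) \<and>
      pre_digraph.cas (quiver m) ((i + 1) mod int m) (alt (Bar i) (Arr i) n) (if even n then (i + 1) mod int m else i)" for i
    by (induction n) (auto simp: pre_digraph.cas.simps)
  have "set (alt (Arr (j mod int m)) (Bar (j mod int m)) n) \<subseteq> arcs (quiver m)"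
    "set (alt (Bar (j mod int m)) (Arr (j mod int m)) n) \<subseteq> arcs (quiver m)"
    using set_alt[of "Arr (j mod int m)" "Bar (j mod int m)" n] set_alt[of "Bar (j mod int m)" "Arr (j mod int m)" n]
    by fastforce+
  with *[of "j mod int m"] show ?thesis
    by (auto simp: apath_def Let_def paths_def pre_digraph.awalk_def mod_simps)
qed

text \<open>Only the row selected by the idempotent of the source is recorded: for
  \<open>n = 0\<close> the product is the identity, whose other row is not zero.\<close>

lemma prod_alt:
  assumes "i mod int m = j"
  shows "m11 (prod_list (map (arep i) (alt (Arr j) (Bar j) n))) = (if even n then fps_X ^ (n div 2) else 0) \<and>
    m12 (prod_list (map (arep i) (alt (Arr j) (Bar j) n))) = (if even n then 0 else fps_X ^ (n div 2)) \<and>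
    m21 (prod_list (map (arep i) (alt (Bar j) (Arr j) n))) = (if even n then 0 else fps_X ^ (n div 2 + 1)) \<and>
    m22 (prod_list (map (arep i) (alt (Bar j) (Arr j) n))) = (if even n then fps_X ^ (n div 2) else 0)"
  using assms by (induction n) auto

text \<open>A path of positive length lives in a single copy, that of its edge. A trivial path acts
  in the two copies adjacent to its vertex, whence \<open>n \<ge> 1\<close>.\<close>

lemma prep_apath:
  assumes "n \<ge> 1"
  shows "prep i (apath d j n) = (if i mod int m = j mod int m then munit d n else 0)"
proof (cases "i mod int m = j mod int m")
  case True
  have s: "(j + 1) mod int m = (i + 1) mod int m" using True by (simp add: mod_add1_eq_iff)
  show ?thesis
    using prod_alt[of i "j mod int m" n] True mod_succ_neq[of i]
    by (auto simp: apath_def Let_def vrep_def munit_def s intro!: mat2.expand)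
next
  case False
  obtain n' where "n = Suc n'" using assms by (cases n) auto
  with False show ?thesis by (auto simp: apath_def Let_def)
qed

lemma cf_hm_add: "cf (hm (f + g)) d j n = cf (hm f) d j n + cf (hm g) d j n"
  by (simp add: cf_def hm_add)

lemma cf_hm_zero [simp]: "cf (hm 0) d j n = 0"
  by (simp add: cf_def)

lemma cf_hm_single: "cf (hm (single p c)) d j n = c * cf (\<lambda>j. prep j p) d j n"
  by (simp add: cf_def hm_single)

lemma cf_apath:
  "n \<ge> 1 \<Longrightarrow> cf (\<lambda>j. prep j (apath d j' n)) d' i n' =
     of_bool (d = d' \<and> i mod int m = j' mod int m \<and> n = n')"
  by (auto simp: cf_def prep_apath munit_def fps_X_power_nth simp del: power_Suc
      dest: even_two_times_div_two odd_two_times_div_two_succ)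

lemma cf_vert:
  "cf (\<lambda>j. prep j (u, [], u)) d i n = of_bool (n = 0 \<and> u = (if d then i mod int m else (i + 1) mod int m))"
  by (cases "n = 0") (auto simp: cf_def vrep_def elim: evenE)

text \<open>On the image of \<open>f\<close> this is a combination of alternating paths of length at most
  \<open>2N\<close> congruent to \<open>f\<close> modulo the relations.\<close>

definition Lred :: "(int \<Rightarrow> 'k fps mat2) \<Rightarrow> 'k kQ" where
  "Lred M = (\<Sum>j\<in>V. single (j, [], j) (cf M True j 0) +
     (\<Sum>n\<in>{1..2 * N}. single (apath True j n) (cf M True j n) +
        single (apath False j n) (cf M False j n)))"

lemma Lred_add: "Lred (hm (f + g)) = Lred (hm f) + Lred (hm g)"
  by (simp add: Lred_def cf_hm_add single_add sum.distrib add_ac)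

lemma R_uminus: "f \<in> carrier R \<Longrightarrow> \<ominus>\<^bsub>R\<^esub> f = - f"
  using R.minus_equality[of "- f" f] by simp

lemma R_minus: "\<lbrakk>f \<in> carrier R; g \<in> carrier R\<rbrakk> \<Longrightarrow> f \<ominus>\<^bsub>R\<^esub> g = f - g"
  using R_uminus[of g] by (simp add: a_minus_def del: path_algebra_simps(1))

lemma Q_arr_apath: "Q_arr m i = single (apath True i 1) (1 :: 'k)"
  and Q_bar_apath: "Q_bar m i = single (apath False i 1) (1 :: 'k)"
  by (simp_all add: Q_arr_def Q_bar_def apath_def Let_def)

lemma single_carrier [simp]: "p \<in> paths (quiver m) \<Longrightarrow> single p (c :: 'k) \<in> carrier R"
  by simp

text \<open>\<open>n\<close> is positive because the zeroth power is the unit of the path algebra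
  and not the trivial path at one vertex.\<close>

lemma arr_bar_pow:
  assumes "n \<ge> 1"
  shows "(Q_arr m i \<otimes>\<^bsub>R\<^esub> Q_bar m i) [^]\<^bsub>R\<^esub> n = single (apath True i (2 * n)) 1"
    and "(Q_bar m i \<otimes>\<^bsub>R\<^esub> Q_arr m i) [^]\<^bsub>R\<^esub> n = single (apath False i (2 * n)) 1"
proof -
  interpret r: ring R by (rule ring_R)
  have 2: "Q_arr m i \<otimes>\<^bsub>R\<^esub> Q_bar m i = single (apath True i 2) (1 :: 'k)"
    "Q_bar m i \<otimes>\<^bsub>R\<^esub> Q_arr m i = single (apath False i 2) (1 :: 'k)"
    by (simp_all add: Q_arr_def Q_bar_def apath_def Let_def numeral_2_eq_2)
  have pow_step: "single (apath d i (2 * n)) 1 \<otimes>\<^bsub>R\<^esub> single (apath d i 2) 1 =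
      single (apath d i (2 * n + 2)) (1 :: 'k)" for d n
    by (simp add: apath_def Let_def alt_add[of _ _ "2 * n" 2] del: alt.simps add_2_eq_Suc add_2_eq_Suc')
  have "single (apath d i 2) (1 :: 'k) [^]\<^bsub>R\<^esub> n = single (apath d i (2 * n)) 1" for d
    using assms
  proof (induction n rule: dec_induct)
    case base
    show ?case using r.l_one[of "single (apath d i 2) (1 :: 'k)"]
      by (simp del: path_algebra_simps add: single_carrier)
  next
    case (step n)
    then show ?case using pow_step[of d n] by (simp del: path_algebra_simps)
  qed
  then show "(Q_arr m i \<otimes>\<^bsub>R\<^esub> Q_bar m i) [^]\<^bsub>R\<^esub> n = single (apath True i (2 * n)) 1"
    "(Q_bar m i \<otimes>\<^bsub>R\<^esub> Q_arr m i) [^]\<^bsub>R\<^esub> n = single (apath False i (2 * n)) 1"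
    by (simp_all add: 2 del: path_algebra_simps)
qed

lemma relations_eq: "relations m N =
   {Q_arr m i \<otimes>\<^bsub>R\<^esub> Q_arr m (i + 1) | i. i \<in> V} \<union>
   {Q_bar m (i + 1) \<otimes>\<^bsub>R\<^esub> Q_bar m i | i. i \<in> V} \<union>
   {single (apath True i (2 * N)) 1 - single (apath False (i - 1) (2 * N)) 1 | i. i \<in> V}"
  unfolding relations_def Let_def arr_bar_pow[OF N1]
  by (subst R_minus) (auto simp del: path_algebra_simps)

lemma ideal_I: "ideal I R" and relations_I: "relations m N \<subseteq> I"
proof -
  interpret r: ring R by (rule ring_R)
  have "f - g \<in> carrier R" if "f \<in> carrier R" "g \<in> carrier R" for f g :: "'k kQ"
    using R.minus_closed[OF that] R_minus[OF that] by simp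
  then have sub: "relations m N \<subseteq> carrier R"
    unfolding relations_eq Q_arr_apath Q_bar_apath
    by (auto intro!: r.m_closed single_carrier simp del: path_algebra_simps)
  show "ideal I R" "relations m N \<subseteq> I"
    unfolding rel_ideal_def using r.genideal_ideal[OF sub] r.genideal_self[OF sub] by auto
qed

lemma I_carrier: "f \<in> I \<Longrightarrow> f \<in> carrier R"
  and I_zero [simp]: "0 \<in> I"
  and I_add: "\<lbrakk>f \<in> I; g \<in> I\<rbrakk> \<Longrightarrow> f + g \<in> I"
  and I_left: "\<lbrakk>f \<in> carrier R; g \<in> I\<rbrakk> \<Longrightarrow> pm f g \<in> I"
  and I_right: "\<lbrakk>f \<in> I; g \<in> carrier R\<rbrakk> \<Longrightarrow> pm f g \<in> I"
proof -
  interpret ideal I R by (rule ideal_I)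
  show "f \<in> I \<Longrightarrow> f \<in> carrier R" using a_subset by auto
  show "0 \<in> I" using zero_closed by simp
  show "\<lbrakk>f \<in> I; g \<in> I\<rbrakk> \<Longrightarrow> f + g \<in> I" using a_closed[of f g] by simp
  show "\<lbrakk>f \<in> carrier R; g \<in> I\<rbrakk> \<Longrightarrow> pm f g \<in> I" using I_l_closed[of g f] by simp
  show "\<lbrakk>f \<in> I; g \<in> carrier R\<rbrakk> \<Longrightarrow> pm f g \<in> I" using I_r_closed[of f g] by simp
qed

text \<open>\<open>rel_ideal\<close> is generated as a ring ideal; scaling by \<open>c\<close> is
  multiplication by \<open>c\<close> times the unit.\<close>

lemma I_scale: "f \<in> I \<Longrightarrow> scale c f \<in> I"
proof -
  assume f: "f \<in> I"
  interpret r: ring R by (rule ring_R)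
  have "scale c \<one>\<^bsub>R\<^esub> \<otimes>\<^bsub>R\<^esub> f = scale c f"
    using r.l_one[OF I_carrier[OF f]] by simp
  moreover have "scale c \<one>\<^bsub>R\<^esub> \<in> carrier R" using R.nalg_smult_closed[OF r.one_closed, of c] by simp
  ultimately show ?thesis using I_left[OF _ f] by (metis path_algebra_simps(3))
qed

lemma I_uminus: "f \<in> I \<Longrightarrow> - f \<in> I"
  using I_scale[of f "-1"] by (simp add: scale_distribs)

lemma I_diff: "\<lbrakk>f \<in> I; g \<in> I\<rbrakk> \<Longrightarrow> f - g \<in> I"
  using I_add[of f "- g"] I_uminus[of g] by simp

lemma I_sum: "(\<And>x. x \<in> S \<Longrightarrow> f x \<in> I) \<Longrightarrow> sum f S \<in> I"
  by (induction S rule: infinite_finite_induct) (auto intro: I_add)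

lemma single_I: "single p 1 \<in> I \<Longrightarrow> single p c \<in> I"
  using I_scale[of "single p 1" c] by simp

section \<open>Rewriting paths modulo the relations\<close>

definition badpair :: "arrow \<Rightarrow> arrow \<Rightarrow> bool" where
  "badpair e e' \<longleftrightarrow> (\<exists>i. (e = Arr (i mod int m) \<and> e' = Arr ((i + 1) mod int m)) \<or>
     (e = Bar ((i + 1) mod int m) \<and> e' = Bar (i mod int m)))"

text \<open>In the path algebra such a path has a monomial relation as a factor. In the
  representation its two arrows act in different copies, so their product is zero.\<close>

lemma bad_path:
  assumes p: "(u, xs @ [e, e'] @ ys, v) \<in> paths (quiver m)" and bad: "badpair e e'"
  shows "single (u, xs @ [e, e'] @ ys, v) c \<in> I" and "prep j (u, xs @ [e, e'] @ ys, v) = 0"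
proof -
  have "arep j e * arep j e' = 0"
    using bad mod_succ_neq by (fastforce simp: badpair_def intro!: mat2.expand)
  then show "prep j (u, xs @ [e, e'] @ ys, v) = 0"
    by (simp add: mult.assoc[symmetric])
  obtain w where w: "(u, xs, w) \<in> paths (quiver m)" "(w, [e, e'] @ ys, v) \<in> paths (quiver m)"
    using paths_split[OF p quiver_head] by blast
  obtain w' where w': "(w, [e, e'], w') \<in> paths (quiver m)" "(w', ys, v) \<in> paths (quiver m)"
    using paths_split[OF w(2) quiver_head] by blast
  have "single (w, [e, e'], w') 1 \<in> I"
  proof -
    from bad obtain i where i: "(e = Arr (i mod int m) \<and> e' = Arr ((i + 1) mod int m)) \<or>
       (e = Bar ((i + 1) mod int m) \<and> e' = Bar (i mod int m))"
      by (auto simp: badpair_def)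
    define i0 where "i0 = i mod int m"
    have i0: "i0 \<in> V" by (simp add: i0_def)
    have "(i + 1) mod int m = (i0 + 1) mod int m" "i0 mod int m = i0" by (simp_all add: i0_def mod_simps)
    then have "single (w, [e, e'], w') (1 :: 'k) =
        Q_arr m i0 \<otimes>\<^bsub>R\<^esub> Q_arr m (i0 + 1) \<or>
      single (w, [e, e'], w') (1 :: 'k) = Q_bar m (i0 + 1) \<otimes>\<^bsub>R\<^esub> Q_bar m i0"
      using i w'(1) by (auto simp: paths_simps Q_arr_def Q_bar_def mod_simps
          simp flip: i0_def)
    then have "single (w, [e, e'], w') (1 :: 'k) \<in> relations m N"
      unfolding relations_eq using i0 by blast
    then show ?thesis using relations_I by blast
  qed
  then have "pm (pm (single (u, xs, w) c)
      (single (w, [e, e'], w') 1)) (single (w', ys, v) 1) \<in> I"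
    using w w' by (intro I_left I_right) auto
  then show "single (u, xs @ [e, e'] @ ys, v) c \<in> I"
    by simp
qed

text \<open>After a_i a path continues with the reverse of a_i or with a_{i+1}, and the latter makes
  a bad pair; similarly for reversed arrows. A path without bad pairs therefore oscillates along one
  edge.\<close>

lemma path_nf:
  assumes "(u, p, v) \<in> paths (quiver m)" "p \<noteq> []"
  shows "(\<exists>d j n. n \<ge> 1 \<and> (u, p, v) = apath d j n) \<or> (\<exists>xs e e' ys. p = xs @ [e, e'] @ ys \<and> badpair e e')"
  using assms
proof (induction p arbitrary: u)
  case (Cons e p)
  have e: "e \<in> arcs (quiver m)" "u = tail (quiver m) e"
    and p: "(head (quiver m) e, p, v) \<in> paths (quiver m)"
    using Cons.prems quiver_head by (auto simp: paths_simps)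
  show ?case
  proof (cases "p = []")
    case True
    then have v: "v = head (quiver m) e"
      using p by (auto simp: paths_simps)
    show ?thesis
    proof (cases e)
      case (Arr i)
      then show ?thesis using e v True
        by (intro disjI1 exI[of _ True] exI[of _ i] exI[of _ 1]) (auto simp: apath_def Let_def)
    next
      case (Bar i)
      then show ?thesis using e v True
        by (intro disjI1 exI[of _ False] exI[of _ i] exI[of _ 1]) (auto simp: apath_def Let_def)
    qed
  next
    case False
    from Cons.IH[OF p False] show ?thesis
    proof (elim disjE exE conjE)
      fix xs e1 e2 ys assume "p = xs @ [e1, e2] @ ys" "badpair e1 e2"
      then show ?thesis by (metis append_Cons)
    next
      fix d j and n :: nat assume n: "1 \<le> n" and eq: "(head (quiver m) e, p, v) = apath d j n"
      obtain n' where n': "n = Suc n'" using n by (cases n) auto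
      have j: "(j mod int m + 1) mod int m = (j + 1) mod int m" by (simp add: mod_simps)
      \<comment> \<open>\<open>d\<close> is the direction of the first arrow of the remaining path.
        If \<open>e\<close> has the same direction, the two form a bad pair; otherwise they run
        along the same edge and \<open>e\<close> prolongs the alternation.\<close>
      consider i where "e = Arr i" "i \<in> V" d | i where "e = Arr i" "i \<in> V" "\<not> d"
        | i where "e = Bar i" "i \<in> V" d | i where "e = Bar i" "i \<in> V" "\<not> d"
        using e(1) by (cases e; cases d) auto
      then show ?thesis
      proof cases
        case 1
        then have "p = Arr ((i + 1) mod int m) # alt (Bar (j mod int m)) (Arr (j mod int m)) n'" "i = i mod int m"
          using eq by (auto simp: apath_def Let_def n')
        then have "e # p = [] @ [Arr (i mod int m), Arr ((i + 1) mod int m)] @ alt (Bar (j mod int m)) (Arr (j mod int m)) n'"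
          using 1 by simp
        moreover have "badpair (Arr (i mod int m)) (Arr ((i + 1) mod int m))" by (auto simp: badpair_def)
        ultimately show ?thesis by blast
      next
        case 2
        then have "(i + 1) mod int m = (j + 1) mod int m" using eq by (auto simp: apath_def Let_def)
        then have "i = j mod int m" using 2 by (simp add: mod_add1_eq_iff)
        then have "(u, e # p, v) = apath True j (Suc n)"
          using eq 2 e by (auto simp: apath_def Let_def split: if_splits)
        then show ?thesis by (metis le_add1 plus_1_eq_Suc)
      next
        case 3
        then have "i = j mod int m" using eq by (auto simp: apath_def Let_def)
        then have "(u, e # p, v) = apath False j (Suc n)"
          using eq 3 e j by (auto simp: apath_def Let_def split: if_splits)
        then show ?thesis by (metis le_add1 plus_1_eq_Suc)
      next
        case 4
        then have "p = Bar (j mod int m) # alt (Arr (j mod int m)) (Bar (j mod int m)) n'" "i = (j + 1) mod int m"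
          using eq by (auto simp: apath_def Let_def n')
        then have "e # p = [] @ [Bar ((j + 1) mod int m), Bar (j mod int m)] @ alt (Arr (j mod int m)) (Bar (j mod int m)) n'"
          using 4 by simp
        moreover have "badpair (Bar ((j + 1) mod int m)) (Bar (j mod int m))" by (auto simp: badpair_def)
        ultimately show ?thesis by blast
      qed
    qed
  qed
qed simp

lemma path_cases [consumes 1, case_names triv alt bad]:
  assumes "p \<in> paths (quiver m)"
  obtains u where "p = (u, [], u)" "u \<in> V"
  | d j n where "p = apath d j n" "n \<ge> 1"
  | "\<And>c. single p c \<in> I" "\<And>j. prep j p = 0"
proof -
  obtain u w v where p: "p = (u, w, v)" by (cases p)
  show ?thesis
  proof (cases "w = []")
    case True
    then show ?thesis using that(1)[of u] assms
      by (auto simp: p paths_simps)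
  next
    case False
    from path_nf[OF assms[unfolded p] False] show ?thesis
      using that(2,3) bad_path[of u _ _ _ _ v] assms unfolding p by blast
  qed
qed

lemma cf_const_zero [simp]: "cf (\<lambda>j. 0) d j n = 0"
  by (simp add: cf_def)

lemma Lred_const_zero [simp]: "Lred (\<lambda>j. 0) = 0"
  by (simp add: Lred_def)

lemma alt_snoc: "alt x y (Suc (2 * N)) = alt x y (2 * N) @ [x]"
  using alt_add[of x y "2 * N" 1] by (simp only: Suc_eq_plus1) simp

lemma apath_cong: "j mod int m = j' mod int m \<Longrightarrow> apath d j n = apath d j' n"
  using mod_add1_eq_iff[of j j'] by (simp add: apath_def)

lemma top_rel:
  "single (apath True j (2 * N)) 1 - single (apath False (j - 1) (2 * N)) 1 \<in> I"
proof -
  have "apath True (j mod int m) (2 * N) = apath True j (2 * N)"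
    "apath False (j mod int m - 1) (2 * N) = apath False (j - 1) (2 * N)"
    by (rule apath_cong; simp add: mod_simps)+
  then have "single (apath True j (2 * N)) 1 - single (apath False (j - 1) (2 * N)) (1 :: 'k)
      \<in> relations m N"
    unfolding relations_eq by (auto intro!: exI[of _ "j mod int m"])
  then show ?thesis using relations_I by blast
qed

lemma alt_even: "alt x y (2 * N) = alt x y (2 * N - 1) @ [y]"
  using alt_add[of x y "2 * N - 1" 1] N1 by simp

text \<open>Length 2N + 1 is critical. Multiply the relation between the two closed paths of length
  2N at a vertex by an arrow leaving it: one path goes on alternating, the other acquires a bad
  pair. As the second product lies in the ideal, so does the first.\<close>

lemma long_path_I:
  assumes n: "n > 2 * N"
  shows "single (apath d j n) c \<in> I"
proof -
  let ?s = "\<lambda>p. single p (1 :: 'k)"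
  have 1: "?s (apath True j (2 * N + 1)) \<in> I"
  proof -
    have "pm (?s (apath True j (2 * N)) - ?s (apath False (j - 1) (2 * N))) (Q_arr m j) \<in> I"
      by (rule I_right[OF top_rel]) (simp add: Q_arr_apath)
    moreover have "pm (?s (apath True j (2 * N))) (Q_arr m j) = ?s (apath True j (2 * N + 1))"
      by (simp add: apath_def Let_def Q_arr_def alt_snoc del: alt.simps(2))
    moreover have "pm (?s (apath False (j - 1) (2 * N))) (Q_arr m j) \<in> I"
    proof -
      let ?w = "alt (Bar ((j - 1) mod int m)) (Arr ((j - 1) mod int m)) (2 * N - 1) @
        [Arr ((j - 1) mod int m), Arr (j mod int m)] @ []"
      have eq: "pm (?s (apath False (j - 1) (2 * N))) (Q_arr m j) =
        ?s (j mod int m, ?w, (j + 1) mod int m)"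
        by (simp add: apath_def Let_def Q_arr_def alt_even del: alt.simps(2))
      have "(j mod int m, ?w, (j + 1) mod int m) \<in> paths (quiver m)"
        using paths_append[OF apath_in_paths[of False "j - 1" "2 * N", unfolded apath_def Let_def, simplified]
            apath_in_paths[of True j 1, unfolded apath_def Let_def, simplified]]
        by (simp add: alt_even del: alt.simps(2))
      moreover have "badpair (Arr ((j - 1) mod int m)) (Arr (j mod int m))"
        by (auto simp: badpair_def intro!: exI[of _ "j - 1"])
      ultimately show ?thesis unfolding eq by (rule bad_path(1))
    qed
    ultimately show ?thesis
      using I_add[of "pm (?s (apath True j (2 * N)) - ?s (apath False (j - 1) (2 * N))) (Q_arr m j)"
          "pm (?s (apath False (j - 1) (2 * N))) (Q_arr m j)"]
      by (simp add: bilinear_ext_diff del: bilinear_ext_simps)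
  qed
  have 2: "?s (apath False j (2 * N + 1)) \<in> I"
  proof -
    have "pm (?s (apath True (j + 1) (2 * N)) - ?s (apath False j (2 * N))) (Q_bar m j) \<in> I"
      by (rule I_right) (use top_rel[of "j + 1"] in \<open>simp_all add: Q_bar_apath\<close>)
    moreover have "pm (?s (apath False j (2 * N))) (Q_bar m j) = ?s (apath False j (2 * N + 1))"
      by (simp add: apath_def Let_def Q_bar_def alt_snoc del: alt.simps(2))
    moreover have "pm (?s (apath True (j + 1) (2 * N))) (Q_bar m j) \<in> I"
    proof -
      let ?w = "alt (Arr ((j + 1) mod int m)) (Bar ((j + 1) mod int m)) (2 * N - 1) @
        [Bar ((j + 1) mod int m), Bar (j mod int m)] @ []"
      have eq: "pm (?s (apath True (j + 1) (2 * N))) (Q_bar m j) =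
        ?s ((j + 1) mod int m, ?w, j mod int m)"
        by (simp add: apath_def Let_def Q_bar_def alt_even del: alt.simps(2))
      have "((j + 1) mod int m, ?w, j mod int m) \<in> paths (quiver m)"
        using paths_append[OF apath_in_paths[of True "j + 1" "2 * N", unfolded apath_def Let_def, simplified]
            apath_in_paths[of False j 1, unfolded apath_def Let_def, simplified]]
        by (simp add: alt_even del: alt.simps(2))
      moreover have "badpair (Bar ((j + 1) mod int m)) (Bar (j mod int m))"
        by (auto simp: badpair_def)
      ultimately show ?thesis unfolding eq by (rule bad_path(1))
    qed
    ultimately show ?thesis
      using I_diff[of "pm (?s (apath True (j + 1) (2 * N))) (Q_bar m j)"
          "pm (?s (apath True (j + 1) (2 * N)) - ?s (apath False j (2 * N))) (Q_bar m j)"]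
      by (simp add: bilinear_ext_diff del: bilinear_ext_simps)
  qed
  \<comment> \<open>The initial segment has odd length, so the rest starts at the other end of the
    edge, in the direction \<open>\<not> d\<close>.\<close>
  have "?s (apath d j n) = pm (?s (apath d j (2 * N + 1))) (?s (apath (\<not> d) j (n - (2 * N + 1))))"
  proof -
    obtain k where k: "n = (2 * N + 1) + k" using n by (metis add.assoc less_imp_add_positive Suc_eq_plus1_left less_iff_Suc_add add.commute)
    show ?thesis unfolding k
      by (auto simp: apath_def Let_def alt_add[of _ _ "Suc (2 * N)" k] simp del: alt.simps add_Suc Suc_eq_plus1 Suc_eq_plus1_left)
  qed
  moreover have "?s (apath d j (2 * N + 1)) \<in> I" using 1 2 by (cases d) auto
  ultimately have "?s (apath d j n) \<in> I" using I_right[of "?s (apath d j (2 * N + 1))" "?s (apath (\<not> d) j (n - (2 * N + 1)))"]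
    by (simp del: bilinear_ext_simps)
  then show ?thesis by (rule single_I)
qed

lemma Lred_single_aux:
  fixes c :: 'k
  assumes j: "(j :: int) \<in> V" and n: "n \<in> {1..2 * N}"
  shows "(\<Sum>i\<in>V. \<Sum>k\<in>{1..2 * N}. single (apath d i k) (c * of_bool (i = j \<and> n = k))) =
    single (apath d j n) c"
proof -
  have "(\<Sum>i\<in>V. \<Sum>k\<in>{1..2 * N}. single (apath d i k) (c * of_bool (i = j \<and> n = k))) =
    (\<Sum>i\<in>V. if i = j then single (apath d j n) c else 0)"
  proof (rule sum.cong)
    fix i
    have "(\<Sum>k\<in>{1..2 * N}. single (apath d i k) (c * of_bool (i = j \<and> n = k))) =
      (\<Sum>k\<in>{1..2 * N}. if k = n then (if i = j then single (apath d j n) c else 0) else 0)"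
      by (rule sum.cong) auto
    also have "\<dots> = (if i = j then single (apath d j n) c else 0)" using n by simp
    finally show "(\<Sum>k\<in>{1..2 * N}. single (apath d i k) (c * of_bool (i = j \<and> n = k))) =
      (if i = j then single (apath d j n) c else 0)" .
  qed simp
  then show ?thesis using j by simp
qed

lemma Lred_alt:
  assumes n: "n \<ge> 1"
  shows "Lred (hm (single (apath d j n) c)) = (if n \<le> 2 * N then single (apath d j n) c else 0)"
proof -
  have "Lred (hm (single (apath d j n) c)) =
    (\<Sum>i\<in>V. \<Sum>k\<in>{1..2 * N}. single (apath d i k) (c * of_bool (i = j mod int m \<and> n = k)))"
    unfolding Lred_def using n by (cases d) (auto simp: cf_hm_single cf_apath intro!: sum.cong)
  also have "\<dots> = (if n \<le> 2 * N then single (apath d j n) c else 0)"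
  proof (cases "n \<le> 2 * N")
    case True
    then show ?thesis
      using n by (subst Lred_single_aux) (auto simp: apath_cong[of "j mod int m" j])
  qed (auto intro!: sum.neutral)
  finally show ?thesis .
qed

text \<open>\<open>Lred\<close> fixes trivial paths and alternating paths up to length
  \<open>2 * N\<close>. Longer ones and those with a bad pair go to zero, and these lie in the
  ideal.\<close>

lemma Lred_I: "f \<in> carrier R \<Longrightarrow> f - Lred (hm f) \<in> I"
proof -
  assume "f \<in> carrier R"
  then have "keys f \<subseteq> paths (quiver m)" by simp
  then show ?thesis
  proof (induction f rule: poly_mapping_span_induct)
    case (single p c)
    from \<open>p \<in> paths (quiver m)\<close> show ?case
    proof (cases rule: path_cases)
      case (triv u)
      have "Lred (hm (single p c)) = (\<Sum>j\<in>V. if j = u then single p c else 0)"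
        unfolding Lred_def using triv by (intro sum.cong refl) (auto simp: cf_hm_single cf_vert[simplified])
      then show ?thesis using triv by simp
    next
      case (alt d j n)
      then show ?thesis by (auto simp: Lred_alt long_path_I)
    next
      case bad
      then show ?thesis by (simp add: hm_single Lred_def cf_def)
    qed
  next
    case (add f g)
    then show ?case using I_add[OF add] by (simp add: Lred_add algebra_simps)
  qed simp
qed

text \<open>\<open>Lam\<close> is the image of the path algebra (up to completion) and \<open>J\<close>
  singles out the image of the relation ideal in it.\<close>

definition J :: "(int \<Rightarrow> 'k fps mat2) \<Rightarrow> bool" where
  "J M \<longleftrightarrow> (\<forall>j. vo N (m11 (M j)) \<and> vo N (m12 (M j)) \<and> vo (Suc N) (m21 (M j)) \<and> vo N (m22 (M j)) \<and>
     m11 (M j) $ N + m22 (M (j - 1)) $ N = 0)"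

definition Lam :: "(int \<Rightarrow> 'k fps mat2) \<Rightarrow> bool" where
  "Lam M \<longleftrightarrow> (\<forall>j. m21 (M j) $ 0 = 0 \<and> m11 (M j) $ 0 = m22 (M (j - 1)) $ 0 \<and> M (j mod int m) = M j)"

lemma hm_Lam: "f \<in> carrier R \<Longrightarrow> Lam (hm f)"
proof -
  assume "f \<in> carrier R"
  then have "keys f \<subseteq> paths (quiver m)" by simp
  then show ?thesis
  proof (induction f rule: poly_mapping_span_induct)
    case (single p c)
    from \<open>p \<in> paths (quiver m)\<close>
    have "m21 (prep j p) $ 0 = 0 \<and> m11 (prep j p) $ 0 = m22 (prep (j - 1) p) $ 0" for j
    proof (cases rule: path_cases)
      case (triv u)
      then show ?thesis by (auto simp: vrep_def)
    next
      case (alt d i n)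
      then show ?thesis
        by (auto simp: prep_apath munit_def elim!: evenE)
    qed auto
    then have "m21 (hm (single p c) j) $ 0 = 0 \<and>
        m11 (hm (single p c) j) $ 0 = m22 (hm (single p c) (j - 1)) $ 0" for j
      by (simp add: hm_single)
    then show ?case by (simp add: Lam_def hm_mod)
  qed (auto simp: Lam_def hm_add)
qed

section \<open>The relation ideal in terms of matrices\<close>

lemma J_add: "\<lbrakk>J M; J M'\<rbrakk> \<Longrightarrow> J (\<lambda>j. M j + M' j)"
proof -
  assume "J M" "J M'"
  moreover from this have "m11 (M j) $ N + m22 (M (j - 1)) $ N = 0" "m11 (M' j) $ N + m22 (M' (j - 1)) $ N = 0" for j
    by (auto simp: J_def)
  then have "m11 (M j) $ N + m11 (M' j) $ N + (m22 (M (j - 1)) $ N + m22 (M' (j - 1)) $ N) = 0" for j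
    by (metis add.assoc add.commute add.right_neutral)
  ultimately show ?thesis by (auto simp: J_def intro!: vo_add)
qed

lemma J_zero [simp]: "J (\<lambda>j. 0)"
  by (simp add: J_def)

lemma J_scale: "J M \<Longrightarrow> J (\<lambda>j. mscale c (M j))"
  unfolding J_def by (auto intro!: vo_mult_left simp flip: distrib_left)

lemma mscale_minus_one [simp]: "mscale (- 1) A = - A"
  by (rule mat2.expand) (simp flip: fps_const_neg)

lemma J_uminus: "J M \<Longrightarrow> J (\<lambda>j. - M j)"
  using J_scale[of M "-1"] by simp

lemma J_diff: "\<lbrakk>J M; J M'\<rbrakk> \<Longrightarrow> J (\<lambda>j. M j - M' j)"
  using J_add[of M "\<lambda>j. - M' j"] J_uminus[of M'] by simp

text \<open>The lower left entry gains its extra order from the missing constant term of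
  \<open>m21 (M j)\<close>. The coefficients of t^N on the diagonals are multiplied by
  \<open>m11 (M j) $ 0\<close> and \<open>m22 (M (j - 1)) $ 0\<close>, which \<open>Lam\<close>
  makes equal, so their sum remains zero.\<close>

lemma J_mult_left:
  assumes M: "Lam M" and J: "J M'" shows "J (\<lambda>j. M j * M' j)"
proof -
  have v: "vo N (m11 (M' j))" "vo N (m12 (M' j))" "vo (Suc N) (m21 (M' j))" "vo N (m22 (M' j))" "vo N (m21 (M' j))"
    and s: "m22 (M' (j - 1)) $ N = - m11 (M' j) $ N" for j
    using J by (auto simp: J_def vo_mono[of "Suc N" _ N] eq_neg_iff_add_eq_0 add.commute)
  have w: "vo (Suc 0) (m21 (M j))" "m21 (M j) $ 0 = 0" "m22 (M (j - 1)) $ 0 = m11 (M j) $ 0" for j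
    using M by (auto simp: Lam_def vo_1_iff)
  have "vo (Suc N) (m21 (M j) * m11 (M' j))" "m21 (M' j) $ N = 0" for j
    using vo_mult[OF w(1) v(1)] vo_nth[OF v(3)] by auto
  with v(3) show ?thesis
    by (auto simp: J_def v w s intro!: vo_add intro: vo_mult_left simp: vo_mult_nth_left)
qed

lemma J_mult_right:
  assumes J: "J M" and M': "Lam M'" shows "J (\<lambda>j. M j * M' j)"
proof -
  have v: "vo N (m11 (M j))" "vo N (m12 (M j))" "vo (Suc N) (m21 (M j))" "vo N (m22 (M j))" "vo N (m21 (M j))"
    and s: "m22 (M (j - 1)) $ N = - m11 (M j) $ N" for j
    using J by (auto simp: J_def vo_mono[of "Suc N" _ N] eq_neg_iff_add_eq_0 add.commute)
  have w: "vo (Suc 0) (m21 (M' j))" "m21 (M' j) $ 0 = 0" "m22 (M' (j - 1)) $ 0 = m11 (M' j) $ 0" for j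
    using M' by (auto simp: Lam_def vo_1_iff)
  have "vo (Suc N) (m22 (M j) * m21 (M' j))" "m21 (M j) $ N = 0" for j
    using vo_mult[OF v(4) w(1)] vo_nth[OF v(3)] by auto
  then show ?thesis
    by (auto simp: J_def v w s intro!: vo_add intro: vo_mult_right simp: vo_mult_nth_right)
qed

lemma J_hm_ideal: "ideal {f \<in> carrier R. J (hm f)} R"
proof (rule idealI[OF ring_R])
  have "submodule {f \<in> carrier R. J (hm f)} (ring_of_type_algebra :: 'k ring) R"
  proof (rule R.submoduleI')
    show "f \<oplus>\<^bsub>R\<^esub> g \<in> {f \<in> carrier R. J (hm f)}" if "f \<in> {f \<in> carrier R. J (hm f)}" "g \<in> {f \<in> carrier R. J (hm f)}" for f g
      using that R.a_closed[of f g] J_add[of "hm f" "hm g"] by (simp add: hm_add[abs_def])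
    show "a \<odot>\<^bsub>R\<^esub> f \<in> {f \<in> carrier R. J (hm f)}" if "f \<in> {f \<in> carrier R. J (hm f)}" for a f
      using that R.nalg_smult_closed[of f a] J_scale[of "hm f" a] by (simp add: hm_scale[abs_def])
  qed (auto simp: hm_zero[abs_def])
  then show "subgroup {f \<in> carrier R. J (hm f)} (add_monoid R)" by (simp add: submodule_def)
next
  fix f g assume f: "f \<in> {f \<in> carrier R. J (hm f)}" and g: "g \<in> carrier R"
  have "hm (f \<otimes>\<^bsub>R\<^esub> g) = (\<lambda>j. hm f j * hm g j)" "hm (g \<otimes>\<^bsub>R\<^esub> f) = (\<lambda>j. hm g j * hm f j)"
    using f g hm_mult by (auto intro!: ext simp del: path_algebra_simps)
  then show "g \<otimes>\<^bsub>R\<^esub> f \<in> {f \<in> carrier R. J (hm f)}" "f \<otimes>\<^bsub>R\<^esub> g \<in> {f \<in> carrier R. J (hm f)}"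
    using f g R.mult_closed[of f g] R.mult_closed[of g f] hm_Lam[of g] J_mult_left[of "hm g" "hm f"] J_mult_right[of "hm f" "hm g"]
    by (simp_all del: path_algebra_simps)
qed

lemma Q_carrier [simp]: "Q_arr m i \<in> carrier R" "Q_bar m i \<in> carrier R"
  unfolding Q_arr_apath Q_bar_apath by (rule single_carrier, simp)+

lemma hm_Q: "hm (Q_arr m i) j = (if j mod int m = i mod int m then M2 0 1 0 0 else 0)"
  "hm (Q_bar m i) j = (if j mod int m = i mod int m then M2 0 0 fps_X 0 else 0)"
  unfolding Q_arr_apath Q_bar_apath by (simp_all add: hm_single prep_apath munit_def)

lemma relations_J: "f \<in> relations m N \<Longrightarrow> J (hm f)"
  unfolding relations_eq
proof (elim UnE CollectE exE conjE)
  fix i assume f: "f = Q_arr m i \<otimes>\<^bsub>R\<^esub> Q_arr m (i + 1)"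
  have "hm f = (\<lambda>j. 0)"
    unfolding f by (rule ext, subst hm_mult) (auto simp: hm_Q mod_succ_neq intro!: mat2.expand simp del: path_algebra_simps)
  then show ?thesis by simp
next
  fix i assume f: "f = Q_bar m (i + 1) \<otimes>\<^bsub>R\<^esub> Q_bar m i"
  have "hm f = (\<lambda>j. 0)"
    unfolding f by (rule ext, subst hm_mult) (auto simp: hm_Q mod_succ_neq intro!: mat2.expand simp del: path_algebra_simps)
  then show ?thesis by simp
next
  fix i assume f: "f = single (apath True i (2 * N)) 1 - single (apath False (i - 1) (2 * N)) 1"
  have "hm f j = (if j mod int m = i mod int m then M2 (fps_X ^ N) 0 0 0 else 0) -
      (if j mod int m = (i - 1) mod int m then M2 0 0 0 (fps_X ^ N) else 0)" for j
    unfolding f hm_diff using N1 by (simp add: hm_single prep_apath munit_def)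
  moreover have "(j - 1) mod int m = (i - 1) mod int m \<longleftrightarrow> j mod int m = i mod int m" for j
    using mod_add1_eq_iff[of "j - 1" "i - 1"] by simp
  ultimately show ?thesis by (auto simp: J_def vo_diff vo_uminus)
qed

text \<open>One inclusion is the minimality of the generated ideal. For the other, \<open>f\<close>
  is congruent to \<open>Lred (hm f)\<close>, of which \<open>J\<close> leaves the coefficients at
  length \<open>2 * N\<close>. These come in opposite pairs at each vertex and combine into
  multiples of the relations between closed paths.\<close>

lemma I_eq: "I = {f \<in> carrier R. J (hm f)}"
proof (intro equalityI subsetI)
  interpret r: ring R by (rule ring_R)
  fix f assume "f \<in> I"
  have "I \<subseteq> {f \<in> carrier R. J (hm f)}"
    unfolding rel_ideal_def by (rule r.genideal_minimal[OF J_hm_ideal]) (use relations_J relations_I I_carrier in blast)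
  then show "f \<in> {f \<in> carrier R. J (hm f)}" using \<open>f \<in> I\<close> by blast
next
  fix f assume f: "f \<in> {f \<in> carrier R. J (hm f)}"
  then have cf0: "cf (hm f) d j n = 0" if "n < 2 * N" for d j n
    using that by (auto simp: J_def cf_def vo_def)
  have cf1: "cf (hm f) False (j - 1) (2 * N) = - cf (hm f) True j (2 * N)" for j
    using f by (auto simp: J_def cf_def eq_neg_iff_add_eq_0 add.commute)
  let ?s = "\<lambda>d j. single (apath d j (2 * N)) (cf (hm f) d j (2 * N))"
  have "Lred (hm f) = (\<Sum>j\<in>V. \<Sum>n\<in>{1..2 * N}. if n = 2 * N then ?s True j + ?s False j else 0)"
    unfolding Lred_def using N1 by (intro sum.cong) (auto simp: cf0 simp del: sum.delta intro!: sum.cong)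
  also have "\<dots> = (\<Sum>j\<in>V. ?s True j) + (\<Sum>j\<in>V. ?s False j)"
    using N1 by (simp add: sum.distrib)
  \<comment> \<open>The closed paths are sorted by their common base point:
    \<open>apath False (j - 1)\<close> of even length starts and ends at \<open>j\<close>.\<close>
  also have "(\<Sum>j\<in>V. ?s False j) = (\<Sum>j\<in>V. ?s False (j - 1))"
  proof (rule sum.reindex_bij_witness[where i = "\<lambda>j. (j - 1) mod int m" and j = "\<lambda>j. (j + 1) mod int m"])
    fix j
    have "hm f ((j + 1) mod int m - 1) = hm f j" using hm_mod[of f "(j + 1) mod int m - 1"] hm_mod[of f j]
      by (simp add: mod_simps)
    then show "?s False ((j + 1) mod int m - 1) = ?s False j"
      using apath_cong[of "(j + 1) mod int m - 1" j False "2 * N"] by (simp add: cf_def mod_simps)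
  qed (auto simp: mod_simps)
  also have "(\<Sum>j\<in>V. ?s True j) + (\<Sum>j\<in>V. ?s False (j - 1)) =
     (\<Sum>j\<in>V. scale (cf (hm f) True j (2 * N))
        (single (apath True j (2 * N)) 1 - single (apath False (j - 1) (2 * N)) 1))"
    unfolding sum.distrib[symmetric] diff_conv_add_uminus scale_distribs
    by (simp add: cf1 single_uminus)
  also have "\<dots> \<in> I" by (intro I_sum I_scale top_rel)
  finally show "f \<in> I"
    using I_add[OF Lred_I[of f], of "Lred (hm f)"] f by simp
qed

section \<open>The algebra A as the quotient of \<open>Lam\<close> by \<open>J\<close>\<close>

abbreviation A :: "('k, 'k kQ set) module" where "A \<equiv> alg_A m N"
abbreviation A_mult (infixl "\<cdot>" 70) where "x \<cdot> y \<equiv> x \<otimes>\<^bsub>A\<^esub> y"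
abbreviation q :: "'k kQ \<Rightarrow> 'k kQ set" where "q \<equiv> A_class m N"

lemma nalg_ideal_I: "nalg_ideal R I"
proof -
  have "submodule I (ring_of_type_algebra :: 'k ring) R"
    by (rule R.submoduleI') (use I_carrier in \<open>auto intro: I_add I_scale\<close>)
  then show ?thesis
    by (intro nalg_ideal.intro R.nalg_axioms nalg_ideal_axioms.intro) (auto intro: I_left I_right)
qed

lemma A_carrier: "carrier A = q ` carrier R"
  and q_zero: "\<zero>\<^bsub>A\<^esub> = q 0" and q_one: "\<one>\<^bsub>A\<^esub> = q \<one>\<^bsub>R\<^esub>"
  and q_add: "\<lbrakk>f \<in> carrier R; g \<in> carrier R\<rbrakk> \<Longrightarrow> q f \<oplus>\<^bsub>A\<^esub> q g = q (f + g)"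
  and q_mult: "\<lbrakk>f \<in> carrier R; g \<in> carrier R\<rbrakk> \<Longrightarrow> q f \<cdot> q g = q (f \<otimes>\<^bsub>R\<^esub> g)"
  and q_smult: "f \<in> carrier R \<Longrightarrow> a \<odot>\<^bsub>A\<^esub> q f = q (scale a f)"
  unfolding alg_A_def A_class_def
  using nalg_ideal.quot_simps[OF nalg_ideal_I] by (simp_all del: path_algebra_simps(1,3))

sublocale A: nalg A
  unfolding alg_A_def by (rule nalg_ideal.nalg_quot[OF nalg_ideal_I])

lemma ring_A: "ring A"
  unfolding alg_A_def by (rule nalg_ideal.ring_quot[OF nalg_ideal_I ring_R])

lemma R_diff_closed: "\<lbrakk>f \<in> carrier R; g \<in> carrier R\<rbrakk> \<Longrightarrow> f - g \<in> carrier R"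
  using R.minus_closed[of f g] R_minus[of f g] by simp

lemma q_eq: "\<lbrakk>f \<in> carrier R; g \<in> carrier R\<rbrakk> \<Longrightarrow> q f = q g \<longleftrightarrow> J (\<lambda>j. hm f j - hm g j)"
  unfolding A_class_def nalg_ideal.coset_eq_iff[OF nalg_ideal_I] R_minus
  using R_diff_closed[of f g] by (simp add: I_eq hm_diff[abs_def] del: path_algebra_simps(1))

lemma Lam_add: "Lam M \<Longrightarrow> Lam M' \<Longrightarrow> Lam (\<lambda>j. M j + M' j)"
  and Lam_diff: "Lam M \<Longrightarrow> Lam M' \<Longrightarrow> Lam (\<lambda>j. M j - M' j)"
  and Lam_scale: "Lam M \<Longrightarrow> Lam (\<lambda>j. mscale c (M j))"
  and Lam_mult: "Lam M \<Longrightarrow> Lam M' \<Longrightarrow> Lam (\<lambda>j. M j * M' j)"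
  and Lam_zero [simp]: "Lam (\<lambda>j. 0)" and Lam_one [simp]: "Lam (\<lambda>j. 1)"
  by (simp_all add: Lam_def)

lemma Lred_carrier: "Lred M \<in> carrier R"
proof -
  have s: "(\<And>x. x \<in> S \<Longrightarrow> f x \<in> carrier R) \<Longrightarrow> sum f S \<in> carrier R" for f :: "'b \<Rightarrow> 'k kQ" and S
    by (induction S rule: infinite_finite_induct) (use R.a_closed R.zero_closed in \<open>auto simp del: path_algebra_simps(1) simp: path_algebra_simps(2,4)[symmetric]\<close>)
  have triv: "(j, [], j) \<in> paths (quiver m)" if "j \<in> V" for j
    using that by (auto simp: paths_simps)
  have add: "f + g \<in> carrier R" if "f \<in> carrier R" "g \<in> carrier R" for f g :: "'k kQ"
    using R.a_closed[OF that] by simp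
  show ?thesis unfolding Lred_def by (intro s add single_carrier triv apath_in_paths)
qed

lemma cf_hm_sum: "cf (hm (sum f S)) d j n = (\<Sum>x\<in>S. cf (hm (f x)) d j n)"
  by (induction S rule: infinite_finite_induct) (auto simp: cf_hm_add)

text \<open>Distinct alternating paths of positive length contribute to distinct coefficients. A
  trivial path contributes to two, which agree by the gluing condition in
  \<open>Lam\<close>.\<close>

lemma cf_Lred:
  assumes M: "Lam M" and n: "n \<le> 2 * N"
  shows "cf (hm (Lred M)) d i n = cf M d i n"
proof -
  have per: "M (j mod int m) = M j" and s: "m22 (M (j - 1)) $ 0 = m11 (M j) $ 0" for j
    using M by (auto simp: Lam_def)
  let ?u = "if d then i mod int m else (i + 1) mod int m"
  have "cf (hm (Lred M)) d i n =
     (\<Sum>j\<in>V. (if j = ?u then (if n = 0 then cf M True j 0 else 0) else 0) +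
       (if j = i mod int m then (if n = 0 then 0 else cf M d j n) else 0))"
  proof -
    have "(\<Sum>k\<in>{1..2 * N}. cf M True j k * of_bool (d \<and> i mod int m = j mod int m \<and> k = n) +
         cf M False j k * of_bool (\<not> d \<and> i mod int m = j mod int m \<and> k = n)) =
       (if j = i mod int m then (if n = 0 then 0 else cf M d j n) else 0)" if "j \<in> V" for j
    proof -
      have "(\<Sum>k\<in>{1..2 * N}. cf M True j k * of_bool (d \<and> i mod int m = j mod int m \<and> k = n) +
         cf M False j k * of_bool (\<not> d \<and> i mod int m = j mod int m \<and> k = n)) =
         (\<Sum>k\<in>{1..2 * N}. if k = n then (if j = i mod int m then cf M d j n else 0) else 0)"
        using that by (intro sum.cong) auto
      then show ?thesis using n by auto
    qed
    then show ?thesis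
      unfolding Lred_def cf_hm_sum cf_hm_add
      by (intro sum.cong refl arg_cong2[where f = "(+)"])
        (auto simp: cf_hm_single cf_vert[simplified] cf_hm_sum cf_hm_add cf_apath)
  qed
  also have "\<dots> = (if n = 0 then cf M True ?u 0 else cf M d (i mod int m) n)"
    by (auto simp: sum.distrib)
  also have "\<dots> = cf M d i n"
    using s[of "i + 1"] by (auto simp: cf_def per)
  finally show ?thesis .
qed

text \<open>The constant term of the lower left entry is not among the coefficients
  \<open>cf\<close>; its vanishing comes from \<open>Lam\<close>.\<close>

lemma J_of_cf:
  assumes M: "Lam M" and c: "\<And>d j n. n \<le> 2 * N \<Longrightarrow> cf M d j n = 0"
  shows "J M"
proof -
  have 1: "m11 (M j) $ k = 0" "m22 (M j) $ k = 0" if "k \<le> N" for j k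
    using c[of "2 * k" True j] c[of "2 * k" False j] that by (auto simp: cf_def)
  have 2: "m12 (M j) $ k = 0" "m21 (M j) $ (Suc k) = 0" if "k < N" for j k
    using c[of "2 * k + 1" True j] c[of "2 * k + 1" False j] that by (auto simp: cf_def)
  have 3: "m21 (M j) $ 0 = 0" for j using M by (auto simp: Lam_def)
  show ?thesis
    unfolding J_def vo_def
  proof (intro allI conjI impI)
    show "m21 (M j) $ k = 0" if "k < Suc N" for j k
      using that 2(2)[of "k - 1" j] 3[of j] by (cases k) auto
  qed (simp_all add: 1 2)
qed

text \<open>Coefficients beyond length \<open>2 * N\<close> are swallowed by \<open>J\<close>. Every
  member of \<open>Lam\<close>, with infinite series included, is thus congruent to the image of a
  finite combination of paths.\<close>

lemma J_Lred: "Lam M \<Longrightarrow> J (\<lambda>j. hm (Lred M) j - M j)"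
proof (rule J_of_cf)
  assume M: "Lam M"
  show "Lam (\<lambda>j. hm (Lred M) j - M j)" by (intro Lam_diff hm_Lam Lred_carrier M)
  show "cf (\<lambda>j. hm (Lred M) j - M j) d j n = 0" if "n \<le> 2 * N" for d j n
    using cf_Lred[OF M that, of d j] by (auto simp: cf_def split: if_splits)
qed

text \<open>The isomorphism from \<open>Lam\<close> modulo \<open>J\<close> onto \<open>A\<close>.\<close>

definition cls :: "(int \<Rightarrow> 'k fps mat2) \<Rightarrow> 'k kQ set" where
  "cls M = q (Lred M)"

lemma cls_carrier [simp]: "cls M \<in> carrier A"
  using Lred_carrier[of M] by (auto simp: cls_def A_carrier simp del: path_algebra_simps(1))

lemma cls_eq:
  assumes M: "Lam M" and M': "Lam M'"
  shows "cls M = cls M' \<longleftrightarrow> J (\<lambda>j. M j - M' j)"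
proof -
  let ?H = "\<lambda>j. hm (Lred M) j - hm (Lred M') j"
  have "J ?H \<longleftrightarrow> J (\<lambda>j. M j - M' j)"
    using J_add[OF J_diff[OF _ J_Lred[OF M]] J_Lred[OF M'], of ?H]
      J_diff[OF J_add[OF _ J_Lred[OF M]] J_Lred[OF M'], of "\<lambda>j. M j - M' j"]
    by (auto simp: algebra_simps)
  then show ?thesis unfolding cls_def by (simp only: q_eq[OF Lred_carrier Lred_carrier])
qed

lemma cls_hm: "f \<in> carrier R \<Longrightarrow> cls (hm f) = q f"
  unfolding cls_def using J_Lred[OF hm_Lam[of f]] by (subst q_eq[OF Lred_carrier]) auto

lemma cls_surj:
  assumes "x \<in> carrier A" obtains M where "Lam M" "x = cls M"
  using assms cls_hm hm_Lam unfolding A_carrier by (metis imageE)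

lemma cls_add: "\<lbrakk>Lam M; Lam M'\<rbrakk> \<Longrightarrow> cls M \<oplus>\<^bsub>A\<^esub> cls M' = cls (\<lambda>j. M j + M' j)"
proof -
  assume M: "Lam M" "Lam M'"
  have c: "Lred M + Lred M' \<in> carrier R" using R.a_closed[OF Lred_carrier Lred_carrier, of M M'] by simp
  have "cls M \<oplus>\<^bsub>A\<^esub> cls M' = cls (hm (Lred M + Lred M'))"
    unfolding cls_hm[OF c] unfolding cls_def by (rule q_add[OF Lred_carrier Lred_carrier])
  also have "\<dots> = cls (\<lambda>j. M j + M' j)"
    using J_add[OF J_Lred J_Lred, OF M] by (subst cls_eq) (auto simp: hm_add algebra_simps intro: hm_Lam c Lam_add M)
  finally show ?thesis .
qed

lemma cls_mult: "\<lbrakk>Lam M; Lam M'\<rbrakk> \<Longrightarrow> cls M \<cdot> cls M' = cls (\<lambda>j. M j * M' j)"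
proof -
  assume M: "Lam M" "Lam M'"
  have c: "Lred M \<otimes>\<^bsub>R\<^esub> Lred M' \<in> carrier R" using R.mult_closed[OF Lred_carrier Lred_carrier, of M M'] .
  have "cls M \<cdot> cls M' = cls (hm (Lred M \<otimes>\<^bsub>R\<^esub> Lred M'))"
    unfolding cls_hm[OF c] unfolding cls_def by (rule q_mult[OF Lred_carrier Lred_carrier])
  also have "hm (Lred M \<otimes>\<^bsub>R\<^esub> Lred M') = (\<lambda>j. hm (Lred M) j * hm (Lred M') j)"
    using hm_mult[OF Lred_carrier Lred_carrier] by blast
  also have "cls \<dots> = cls (\<lambda>j. M j * M' j)"
    using J_add[OF J_mult_right[OF J_Lred[OF M(1)] hm_Lam[OF Lred_carrier[of M']]] J_mult_left[OF M(1) J_Lred[OF M(2)]]]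
    by (subst cls_eq) (auto simp: algebra_simps intro: hm_Lam Lred_carrier Lam_mult M)
  finally show ?thesis .
qed

lemma cls_smult: "Lam M \<Longrightarrow> a \<odot>\<^bsub>A\<^esub> cls M = cls (\<lambda>j. mscale a (M j))"
proof -
  assume M: "Lam M"
  have c: "scale a (Lred M) \<in> carrier R" using R.nalg_smult_closed[OF Lred_carrier, of a M] by simp
  have "a \<odot>\<^bsub>A\<^esub> cls M = cls (hm (scale a (Lred M)))"
    unfolding cls_hm[OF c] unfolding cls_def by (rule q_smult[OF Lred_carrier])
  also have "hm (scale a (Lred M)) = (\<lambda>j. mscale a (hm (Lred M) j))"
    by (rule ext) (rule hm_scale)
  also have "cls \<dots> = cls (\<lambda>j. mscale a (M j))"
  proof -
    have "mscale a (hm (Lred M) j) - mscale a (M j) = mscale a (hm (Lred M) j - M j)" for j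
      by (rule mat2.expand) (simp add: algebra_simps)
    then show ?thesis using J_scale[OF J_Lred[OF M], of a]
      by (subst cls_eq) (auto intro: hm_Lam Lred_carrier Lam_scale M)
  qed
  finally show ?thesis .
qed

lemma cls_zero: "\<zero>\<^bsub>A\<^esub> = cls (\<lambda>j. 0)"
  unfolding q_zero using cls_hm[of 0] by (simp add: hm_zero[abs_def])

lemma cls_one: "\<one>\<^bsub>A\<^esub> = cls (\<lambda>j. 1)"
proof -
  interpret r: ring R by (rule ring_R)
  show ?thesis unfolding q_one using cls_hm[OF r.one_closed] by (simp add: hm_one[abs_def] del: path_algebra_simps)
qed

lemma cls_uminus: "Lam M \<Longrightarrow> \<ominus>\<^bsub>A\<^esub> cls M = cls (\<lambda>j. - M j)"
  using cls_smult[of M "-1"] A.nalg_smult_minus[of "cls M" 1] by simp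

lemma cls_minus: "\<lbrakk>Lam M; Lam M'\<rbrakk> \<Longrightarrow> cls M \<ominus>\<^bsub>A\<^esub> cls M' = cls (\<lambda>j. M j - M' j)"
  unfolding a_minus_def using Lam_diff[OF Lam_zero, of M'] by (subst cls_uminus) (auto simp: cls_add)

lemma R_gen:
  assumes add: "\<And>f g. \<lbrakk>f \<in> S; g \<in> S\<rbrakk> \<Longrightarrow> f + g \<in> S" and scale: "\<And>c f. f \<in> S \<Longrightarrow> scale c f \<in> S"
    and mult: "\<And>f g. \<lbrakk>f \<in> S; g \<in> S\<rbrakk> \<Longrightarrow> f \<otimes>\<^bsub>R\<^esub> g \<in> S"
    and gens: "\<And>i. i \<in> V \<Longrightarrow> Q_vert m i \<in> S \<and> Q_arr m i \<in> S \<and> Q_bar m i \<in> S"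
    and f: "f \<in> carrier R"
  shows "f \<in> S"
proof -
  have v: "single (u, [], u) 1 \<in> S" if "u \<in> V" for u
    using gens[OF that] that by (simp add: Q_vert_def)
  have p: "single (u, p, v) 1 \<in> S" if "(u, p, v) \<in> paths (quiver m)" for u p v
    using that
  proof (induction p arbitrary: u)
    case Nil
    then show ?case using v by (auto simp: paths_simps)
  next
    case (Cons e p)
    then have e: "e \<in> arcs (quiver m)" "u = tail (quiver m) e" and "(head (quiver m) e, p, v) \<in> paths (quiver m)"
      using quiver_head by (auto simp: paths_simps)
    then have "single (head (quiver m) e, p, v) 1 \<in> S" using Cons.IH by blast
    moreover have "single (u, [e], head (quiver m) e) 1 \<in> S"
    proof (cases e)
      case (Arr i)
      then show ?thesis using gens[of i] e by (auto simp: Q_arr_def)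
    next
      case (Bar i)
      then show ?thesis using gens[of i] e by (auto simp: Q_bar_def)
    qed
    ultimately show ?case using mult by fastforce
  qed
  have "0 \<in> S" using scale[of _ 0] v[of 0] m3 by simp
  moreover from f have "keys f \<subseteq> paths (quiver m)" by simp
  then show ?thesis
  proof (induction f rule: poly_mapping_span_induct)
    case (single x c)
    then show ?case using scale[OF p, of _ _ _ c] by (cases x) auto
  qed (auto simp: \<open>0 \<in> S\<close> add)
qed

section \<open>Derivations of the quiver algebra\<close>

text \<open>The condition on the constant terms is what makes \<open>dfun\<close> preserve \<open>J\<close>:
  on the socle it multiplies by \<open>N P\<^sub>j(0)\<close>.\<close>

definition dparam :: "(int \<Rightarrow> 'k fps) \<Rightarrow> (int \<Rightarrow> 'k fps) \<Rightarrow> bool" where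
  "dparam \<mu> P \<longleftrightarrow> (\<forall>j. \<mu> (j mod int m) = \<mu> j \<and> P (j mod int m) = P j \<and> P j $ 0 = P (j - 1) $ 0)"

definition dfun :: "(int \<Rightarrow> 'k fps) \<Rightarrow> (int \<Rightarrow> 'k fps) \<Rightarrow> (int \<Rightarrow> 'k fps mat2) \<Rightarrow> int \<Rightarrow> 'k fps mat2" where
  "dfun \<mu> P M j = dd (\<mu> j) (P j) (M j)"

definition der :: "(int \<Rightarrow> 'k fps) \<Rightarrow> (int \<Rightarrow> 'k fps) \<Rightarrow> 'k kQ set \<Rightarrow> 'k kQ set" where
  "der \<mu> P = (\<lambda>x\<in>carrier A. cls (dfun \<mu> P (SOME M. Lam M \<and> x = cls M)))"

text \<open>Stated for periodic parameters rather than under \<open>dparam\<close>, because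
  \<open>derivation_eq_der\<close> applies it while the constant terms of \<open>P\<close> have yet
  to be compared.\<close>

lemma Lam_dfun:
  assumes "\<And>j. \<mu> (j mod int m) = \<mu> j" "\<And>j. P (j mod int m) = P j" "Lam M"
  shows "Lam (dfun \<mu> P M)"
  using assms by (simp add: Lam_def dfun_def dd_def)

lemma J_dfun:
  assumes "dparam \<mu> P" "J M"
  shows "J (dfun \<mu> P M)"
proof -
  have v: "vo N (m11 (M j))" "vo N (m12 (M j))" "vo (Suc N) (m21 (M j))" "vo N (m22 (M j))"
    and s: "m22 (M (j - 1)) $ N = - m11 (M j) $ N" and P: "P (j - 1) $ 0 = P j $ 0" for j
    using assms by (auto simp: J_def dparam_def eq_neg_iff_add_eq_0 add.commute)
  show ?thesis
    by (auto simp: J_def dfun_def dd_def v intro!: vo_add vo_diff vo_mult_left vo_X_deriv)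
      (simp add: vo_mult_nth_left vo_X_deriv v s P)
qed

lemma dfun_diff: "dfun \<mu> P M j - dfun \<mu> P M' j = dfun \<mu> P (\<lambda>j. M j - M' j) j"
  by (simp add: dfun_def dd_diff)

lemma dparam_Lam: "\<lbrakk>dparam \<mu> P; Lam M\<rbrakk> \<Longrightarrow> Lam (dfun \<mu> P M)"
  by (rule Lam_dfun) (auto simp: dparam_def)

text \<open>Independence of the representative chosen in \<open>der\<close>; the reason is the
  invariance of \<open>J\<close> under \<open>dfun\<close>.\<close>

lemma der_cls:
  assumes d: "dparam \<mu> P" and M: "Lam M"
  shows "der \<mu> P (cls M) = cls (dfun \<mu> P M)"
proof -
  let ?M = "SOME M'. Lam M' \<and> cls M = cls M'"
  have M': "Lam ?M \<and> cls M = cls ?M" by (rule someI[of _ M]) (simp add: M)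
  then have "J (\<lambda>j. M j - ?M j)" using cls_eq M by blast
  then have "J (\<lambda>j. dfun \<mu> P M j - dfun \<mu> P ?M j)"
    unfolding dfun_diff by (rule J_dfun[OF d])
  then have "cls (dfun \<mu> P M) = cls (dfun \<mu> P ?M)"
    using M' M by (subst cls_eq) (auto intro: dparam_Lam d)
  then show ?thesis by (simp add: der_def)
qed

lemma der_derivation:
  assumes d: "dparam \<mu> P" shows "der \<mu> P \<in> derivations A"
proof (rule A.derivationsI)
  fix x y a assume "x \<in> carrier A" "y \<in> carrier A"
  then obtain M M' where M: "Lam M" "x = cls M" "Lam M'" "y = cls M'" by (metis cls_surj)
  note L = dparam_Lam[OF d M(1)] dparam_Lam[OF d M(3)]
  show "der \<mu> P (x \<oplus>\<^bsub>A\<^esub> y) = der \<mu> P x \<oplus>\<^bsub>A\<^esub> der \<mu> P y"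
    using M L by (simp add: cls_add der_cls d Lam_add) (simp add: dfun_def[abs_def] dd_add)
  show "der \<mu> P (x \<cdot> y) = der \<mu> P x \<cdot> y \<oplus>\<^bsub>A\<^esub> x \<cdot> der \<mu> P y"
    using M L by (simp add: cls_add cls_mult der_cls d Lam_mult) (simp add: dfun_def[abs_def] dd_mult)
next
  fix x a assume "x \<in> carrier A"
  then obtain M where M: "Lam M" "x = cls M" by (metis cls_surj)
  show "der \<mu> P (a \<odot>\<^bsub>A\<^esub> x) = a \<odot>\<^bsub>A\<^esub> der \<mu> P x"
    using M dparam_Lam[OF d M(1)] by (simp add: cls_smult der_cls d Lam_scale) (simp add: dfun_def[abs_def] dd_mscale)
next
  show "der \<mu> P x \<in> carrier A" if "x \<in> carrier A" for x
    using that by (simp add: der_def)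
qed (simp add: der_def)

lemma fun_eq_cls:
  assumes "\<And>M. Lam M \<Longrightarrow> F (cls M) = G (cls M)" "\<And>x. x \<notin> carrier A \<Longrightarrow> F x = G x"
  shows "F = G"
  using assms cls_surj by (metis ext)

lemma der_undefined: "x \<notin> carrier A \<Longrightarrow> der \<mu> P x = undefined"
  by (simp add: der_def)

definition Mv :: "int \<Rightarrow> int \<Rightarrow> 'k fps mat2" where "Mv i j = vrep j (i mod int m)"
text \<open>\<open>Ma g i\<close> and \<open>Mb g i\<close> are the images of a_i and of its reverse
  with the entry multiplied by \<open>g\<close>. A lower left entry has to be divisible by t; the
  factor \<open>fps_X\<close> in \<open>Mb\<close> leaves \<open>g\<close> arbitrary.\<close>

definition Ma :: "'k fps \<Rightarrow> int \<Rightarrow> int \<Rightarrow> 'k fps mat2" where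
  "Ma g i j = (if j mod int m = i mod int m then M2 0 g 0 0 else 0)"
definition Mb :: "'k fps \<Rightarrow> int \<Rightarrow> int \<Rightarrow> 'k fps mat2" where
  "Mb g i j = (if j mod int m = i mod int m then M2 0 0 (fps_X * g) 0 else 0)"

lemma Q_vert_carrier [simp]: "Q_vert m i \<in> carrier R"
  by (simp add: Q_vert_def paths_simps)

lemma hm_gens: "hm (Q_vert m i) = Mv i" "hm (Q_arr m i) = Ma 1 i" "hm (Q_bar m i) = Mb 1 i"
  by (rule ext; simp add: hm_Q Mv_def Ma_def Mb_def Q_vert_def hm_single)+

lemma Lam_gens [simp]: "Lam (Mv i)" "Lam (Ma g i)" "Lam (Mb g i)"
  using hm_Lam[of "Q_vert m i"] by (simp_all add: hm_gens Lam_def Ma_def Mb_def del: path_algebra_simps(1))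

lemma A_gens: "A_vert m N i = cls (Mv i)" "A_arr m N i = cls (Ma 1 i)" "A_bar m N i = cls (Mb 1 i)"
  unfolding hm_gens[symmetric] by (rule cls_hm[symmetric], simp del: path_algebra_simps)+

text \<open>The entry 1 of a_i is constant, so the vector field does not see it, while the entry t
  of the reverse is multiplied by \<open>P\<close>. The two arrows are thus multiplied by
  \<open>\<mu>\<close> and \<open>P - \<mu>\<close>, and \<open>P\<close> is the sum of these
  factors.\<close>

lemma dfun_gens:
  assumes per: "\<And>j. \<mu> (j mod int m) = \<mu> j" "\<And>j. P (j mod int m) = P j"
  shows "dfun \<mu> P (Mv i) = (\<lambda>j. 0)" "dfun \<mu> P (Ma 1 i) = Ma (\<mu> i) i" "dfun \<mu> P (Mb 1 i) = Mb (P i - \<mu> i) i"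
proof -
  show "dfun \<mu> P (Mv i) = (\<lambda>j. 0)"
    by (rule ext, rule mat2.expand) (auto simp: dfun_def dd_def Mv_def vrep_def)
  have per': "\<mu> j = \<mu> i" "P j = P i" if "j mod int m = i mod int m" for j
    using per[of j] per[of i] that by auto
  have "dfun \<mu> P (Ma 1 i) j = Ma (\<mu> i) i j" "dfun \<mu> P (Mb 1 i) j = Mb (P i - \<mu> i) i j" for j
    by (cases "j mod int m = i mod int m";
      simp add: dfun_def dd_def Ma_def Mb_def per'[of j] zero_mat2_def algebra_simps)+
  then show "dfun \<mu> P (Ma 1 i) = Ma (\<mu> i) i" "dfun \<mu> P (Mb 1 i) = Mb (P i - \<mu> i) i"
    by (auto intro!: ext)
qed

lemma der_gens:
  assumes d: "dparam \<mu> P"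
  shows "der \<mu> P (A_vert m N i) = \<zero>\<^bsub>A\<^esub>"
    and "der \<mu> P (A_arr m N i) = cls (Ma (\<mu> i) i)"
    and "der \<mu> P (A_bar m N i) = cls (Mb (P i - \<mu> i) i)"
  using d by (simp_all add: A_gens der_cls dfun_gens cls_zero dparam_def)

text \<open>Derivations along the projection \<open>q\<close> from the path algebra to \<open>A\<close>.\<close>

definition qder :: "('k kQ \<Rightarrow> 'k kQ set) \<Rightarrow> bool" where
  "qder \<delta> \<longleftrightarrow> (\<forall>f\<in>carrier R. \<forall>g\<in>carrier R. \<delta> (f + g) = \<delta> f \<oplus>\<^bsub>A\<^esub> \<delta> g \<and>
     \<delta> (f \<otimes>\<^bsub>R\<^esub> g) = \<delta> f \<cdot> q g \<oplus>\<^bsub>A\<^esub> q f \<cdot> \<delta> g \<and> (\<forall>c. \<delta> (scale c f) = c \<odot>\<^bsub>A\<^esub> \<delta> f))"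

lemma qder_derivation: "D \<in> derivations A \<Longrightarrow> qder (\<lambda>f. D (q f))"
proof -
  assume D: "D \<in> derivations A"
  have "q f \<in> carrier A" if "f \<in> carrier R" for f using that by (auto simp: A_carrier simp del: path_algebra_simps)
  then show ?thesis
    using A.derivationsD(3-5)[OF D] by (simp add: qder_def q_add[symmetric] q_mult[symmetric] q_smult[symmetric] del: path_algebra_simps)
qed

text \<open>For these parameters \<open>dfun\<close> may fail to preserve \<open>J\<close> and then
  induces no map on A. As a map from the path algebra to A it is a derivation nonetheless.\<close>

lemma qder_dfun:
  assumes per: "\<And>j. \<mu> (j mod int m) = \<mu> j" "\<And>j. P (j mod int m) = P j"
  shows "qder (\<lambda>f. cls (dfun \<mu> P (hm f)))"
  unfolding qder_def
proof (intro ballI conjI allI)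
  have L: "Lam (dfun \<mu> P (hm f))" if "f \<in> carrier R" for f by (intro Lam_dfun per hm_Lam that)
  fix f g c assume f: "f \<in> carrier R" and g: "g \<in> carrier R"
  show "cls (dfun \<mu> P (hm (f + g))) = cls (dfun \<mu> P (hm f)) \<oplus>\<^bsub>A\<^esub> cls (dfun \<mu> P (hm g))"
    using L[OF f] L[OF g] by (simp add: cls_add) (simp add: dfun_def[abs_def] hm_add dd_add)
  have "dfun \<mu> P (hm (f \<otimes>\<^bsub>R\<^esub> g)) = (\<lambda>j. dfun \<mu> P (hm f) j * hm g j + hm f j * dfun \<mu> P (hm g) j)"
    by (rule ext) (simp only: dfun_def hm_mult[OF f g] dd_mult)
  then show "cls (dfun \<mu> P (hm (f \<otimes>\<^bsub>R\<^esub> g))) = cls (dfun \<mu> P (hm f)) \<cdot> q g \<oplus>\<^bsub>A\<^esub> q f \<cdot> cls (dfun \<mu> P (hm g))"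
    using L[OF f] L[OF g] hm_Lam[OF f] hm_Lam[OF g]
    by (simp only: cls_hm[OF f, symmetric] cls_hm[OF g, symmetric] cls_mult cls_add Lam_mult)
  show "cls (dfun \<mu> P (hm (scale c f))) = c \<odot>\<^bsub>A\<^esub> cls (dfun \<mu> P (hm f))"
    using L[OF f] by (simp add: cls_smult) (simp add: dfun_def[abs_def] hm_scale dd_mscale)
qed

text \<open>The elements on which the two maps agree form a subalgebra, to which
  \<open>R_gen\<close> applies.\<close>

lemma qder_eqI:
  assumes \<delta>: "qder \<delta>" "qder \<delta>'"
    and eq: "\<And>i. i \<in> V \<Longrightarrow> \<delta> (Q_vert m i) = \<delta>' (Q_vert m i) \<and> \<delta> (Q_arr m i) = \<delta>' (Q_arr m i) \<and>
      \<delta> (Q_bar m i) = \<delta>' (Q_bar m i)"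
    and f: "f \<in> carrier R"
  shows "\<delta> f = \<delta>' f"
proof -
  have "f \<in> {f \<in> carrier R. \<delta> f = \<delta>' f}"
  proof (rule R_gen[OF _ _ _ _ f])
    fix f g c assume f: "f \<in> {f \<in> carrier R. \<delta> f = \<delta>' f}" and g: "g \<in> {f \<in> carrier R. \<delta> f = \<delta>' f}"
    show "f + g \<in> {f \<in> carrier R. \<delta> f = \<delta>' f}"
      using R.a_closed[of f g] f g \<delta> by (simp add: qder_def del: path_algebra_simps(1))
    show "f \<otimes>\<^bsub>R\<^esub> g \<in> {f \<in> carrier R. \<delta> f = \<delta>' f}"
      using f g \<delta> by (simp add: qder_def del: path_algebra_simps)
  next
    fix f c assume f: "f \<in> {f \<in> carrier R. \<delta> f = \<delta>' f}"
    then show "scale c f \<in> {f \<in> carrier R. \<delta> f = \<delta>' f}"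
      using R.nalg_smult_closed[of f c] \<delta> by (simp add: qder_def del: path_algebra_simps(1))
  qed (use eq in \<open>auto simp del: path_algebra_simps\<close>)
  then show ?thesis by blast
qed

lemma derivation_eqI:
  assumes D: "D \<in> derivations A" and D': "D' \<in> derivations A"
    and eq: "\<And>i. i \<in> V \<Longrightarrow> D (A_vert m N i) = D' (A_vert m N i) \<and> D (A_arr m N i) = D' (A_arr m N i) \<and>
      D (A_bar m N i) = D' (A_bar m N i)"
  shows "D = D'"
proof
  show "D x = D' x" for x
    using qder_eqI[OF qder_derivation[OF D] qder_derivation[OF D'] eq] A.derivationsD(2)[OF D, of x] A.derivationsD(2)[OF D', of x]
    by (cases "x \<in> carrier A") (auto simp: A_carrier simp del: path_algebra_simps)
qed

lemma arrow_derivation_eq: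
  assumes d: "dparam \<mu> P" and u: "\<And>i. i \<in> V \<Longrightarrow> u i = cls (Ma (\<mu> i) i)"
    and v: "\<And>i. i \<in> V \<Longrightarrow> v i = cls (Mb (P i - \<mu> i) i)"
  shows "arrow_derivation m N u v = der \<mu> P"
  unfolding arrow_derivation_def
proof (rule the_equality)
  show "der \<mu> P \<in> derivations A \<and> (\<forall>i\<in>V. der \<mu> P (A_vert m N i) = \<zero>\<^bsub>A\<^esub> \<and>
    der \<mu> P (A_arr m N i) = u i \<and> der \<mu> P (A_bar m N i) = v i)"
    using der_derivation[OF d] der_gens[OF d] u v by simp
  fix D assume "D \<in> derivations A \<and> (\<forall>i\<in>V. D (A_vert m N i) = \<zero>\<^bsub>A\<^esub> \<and>
    D (A_arr m N i) = u i \<and> D (A_bar m N i) = v i)"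
  then show "D = der \<mu> P" using der_derivation[OF d] der_gens[OF d] u v by (intro derivation_eqI) auto
qed

lemma cyclic_const:
  assumes "\<And>j. f (j mod int m) = f (j :: int)" "\<And>j. f j = f (j - 1)"
  shows "f i = f j"
proof -
  have "f (int n) = f 0" for n
    by (induction n) (use assms(2)[of "1 + int _"] in auto)
  then have "f (i mod int m) = f 0" for i using nonneg_int_cases[OF mod_verts(1)[of i]] by metis
  then show ?thesis by (metis assms(1))
qed

lemma cyclic_sum:
  assumes "\<And>j. f (j mod int m) = f (j :: int)"
  shows "(\<Sum>i\<in>V. f (i + 1)) = (\<Sum>i\<in>V. f i :: 'b::comm_monoid_add)"
proof (rule sum.reindex_bij_witness[where i = "\<lambda>j. (j - 1) mod int m" and j = "\<lambda>j. (j + 1) mod int m"])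
qed (use assms in \<open>auto simp: mod_simps\<close>)

text \<open>Evaluation at a_i and at its reverse shows that, modulo t^N, \<open>\<mu> i\<close> and
  \<open>P i - \<mu> i\<close> are opposite differences of the diagonal entries of a matrix
  representing \<open>b\<close>; adding them kills \<open>P i\<close>. As \<open>Lam\<close> glues
  the constant term of the lower right entry in copy \<open>i\<close> to that of the upper left
  entry in copy \<open>i + 1\<close>, the constant terms of \<open>\<mu>\<close> telescope around
  the cycle.\<close>

lemma der_inner_conv:
  assumes d: "dparam \<mu> P" and b: "b \<in> carrier A" and eq: "der \<mu> P = inner_der A b"
  shows "vo N (P j)" and "(\<Sum>i\<in>V. 2 * \<mu> i $ 0 - P i $ 0) = 0"
proof -
  obtain B where B: "Lam B" "b = cls B" using b by (rule cls_surj)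
  have *: "Lam M \<Longrightarrow> inner_der A b (cls M) = cls (\<lambda>j. B j * M j - M j * B j)" for M
    using B by (simp add: inner_der_def cls_mult cls_minus Lam_mult)
  have 1: "vo N (\<mu> i - (m11 (B i) - m22 (B i)))" for i
  proof -
    have "cls (Ma (\<mu> i) i) = cls (\<lambda>j. B j * Ma 1 i j - Ma 1 i j * B j)"
      using der_gens(2)[OF d, of i] by (simp add: eq A_gens *)
    then have "J (\<lambda>j. Ma (\<mu> i) i j - (B j * Ma 1 i j - Ma 1 i j * B j))"
      using B(1) by (subst (asm) cls_eq) (intro Lam_diff Lam_mult Lam_gens | assumption)+
    then have "vo N (m12 (Ma (\<mu> i) i i - (B i * Ma 1 i i - Ma 1 i i * B i)))" by (simp only: J_def)
    then show ?thesis by (simp add: Ma_def)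
  qed
  have 2: "vo N (P i - \<mu> i - (m22 (B i) - m11 (B i)))" for i
  proof -
    have "cls (Mb (P i - \<mu> i) i) = cls (\<lambda>j. B j * Mb 1 i j - Mb 1 i j * B j)"
      using der_gens(3)[OF d, of i] by (simp add: eq A_gens *)
    then have "J (\<lambda>j. Mb (P i - \<mu> i) i j - (B j * Mb 1 i j - Mb 1 i j * B j))"
      using B(1) by (subst (asm) cls_eq) (intro Lam_diff Lam_mult Lam_gens | assumption)+
    then have "vo (Suc N) (m21 (Mb (P i - \<mu> i) i i - (B i * Mb 1 i i - Mb 1 i i * B i)))" by (simp only: J_def)
    \<comment> \<open>\<open>J\<close> controls the lower left entry modulo t^(N+1), which
      compensates for its factor t.\<close>
    then have "vo (Suc N) (fps_X * (P i - \<mu> i - (m22 (B i) - m11 (B i))))"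
      by (simp add: Mb_def algebra_simps)
    then show ?thesis by (auto simp: vo_def dest: spec[of _ "Suc _"])
  qed
  show P: "vo N (P j)" for j using vo_add[OF 1[of j] 2[of j]] by (simp add: algebra_simps)
  have \<mu>: "\<mu> i $ 0 = m11 (B i) $ 0 - m11 (B (i + 1)) $ 0" "P i $ 0 = 0" for i
  proof -
    have "m11 (B (i + 1)) $ 0 = m22 (B (i + 1 - 1)) $ 0" using B(1) unfolding Lam_def by blast
    then show "\<mu> i $ 0 = m11 (B i) $ 0 - m11 (B (i + 1)) $ 0" using vo_nth[OF 1, of 0 i] N1 by (simp add: algebra_simps)
    show "P i $ 0 = 0" using vo_nth[OF P, of 0 i] N1 by simp
  qed
  have "(\<Sum>i\<in>V. m11 (B (i + 1)) $ 0) = (\<Sum>i\<in>V. m11 (B i) $ 0)"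
    by (rule cyclic_sum[of "\<lambda>i. m11 (B i) $ 0"]) (use B in \<open>simp add: Lam_def\<close>)
  then show "(\<Sum>i\<in>V. 2 * \<mu> i $ 0 - P i $ 0) = 0"
    by (simp add: \<mu> sum_subtractf sum_distrib_left[symmetric])
qed

text \<open>The factor t in t d/dt and in the lower left entries supplies the order beyond N that
  \<open>J\<close> demands in these entries and that makes the socle condition trivial.\<close>

lemma der_zero:
  assumes d: "dparam \<mu> P" and v: "\<And>j. vo N (\<mu> j)" "\<And>j. vo N (P j)"
  shows "der \<mu> P = (\<lambda>x\<in>carrier A. \<zero>\<^bsub>A\<^esub>)"
proof (rule fun_eq_cls)
  fix M assume M: "Lam M"
  have 1: "vo (Suc N) (P j * (fps_X * a))" for j a
    using vo_mult[OF v(2), of "Suc 0" "fps_X * a"] by (simp add: vo_1_iff)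
  have 2: "vo (Suc N) (\<mu> j * m21 (M j))" for j
    using vo_mult[OF v(1), of "Suc 0" "m21 (M j)"] M by (simp add: vo_1_iff Lam_def)
  have "J (\<lambda>j. dfun \<mu> P M j - 0)"
    using vo_nth[OF 1, of N]
    by (auto simp: J_def dfun_def dd_def vo_mono[OF 1] intro!: 1 2 vo_add vo_diff vo_mult_right v)
  then have "cls (dfun \<mu> P M) = cls (\<lambda>j. 0)"
    using M d by (subst cls_eq) (auto intro: dparam_Lam)
  then show "der \<mu> P (cls M) = (\<lambda>x\<in>carrier A. \<zero>\<^bsub>A\<^esub>) (cls M)" using M by (simp add: der_cls d cls_zero)
qed (simp add: der_undefined)

text \<open>Up to a power series without constant term, the diagonal matrix sought has entries \<open>z\<^sub>j\<close> and \<open>z\<^sub>j\<^sub>+\<^sub>1\<close> with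
  \<open>z\<^sub>j - z\<^sub>j\<^sub>+\<^sub>1 = g\<^sub>j(0)\<close>; this is solvable on the cycle as the sum of the right-hand sides is zero.\<close>

lemma der_inner:
  assumes g: "\<And>j. g (j mod int m) = g j" and s: "(\<Sum>i\<in>V. g i $ 0) = 0"
  obtains b where "b \<in> carrier A" "der g (\<lambda>_. 0) = inner_der A b"
proof -
  have d: "dparam g (\<lambda>_. 0)" using g by (simp add: dparam_def)
  define z where "z j = fps_const (- (\<Sum>i\<in>{0..<j mod int m}. g i $ 0))" for j
  \<comment> \<open>\<open>z\<close> is minus the partial sum, so the recursion holds by
    construction except when \<open>j\<close> wraps around from \<open>m - 1\<close> to 0; there it
    is the hypothesis that the total sum vanishes.\<close>
  have z1: "z j - z (j + 1) = fps_const (g j $ 0)" for j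
  proof (cases "j mod int m = int m - 1")
    case True
    have "V = insert (int m - 1) {0..<int m - 1}" using m3 by auto
    then have "g (int m - 1) $ 0 = - (\<Sum>i\<in>{0..<int m - 1}. g i $ 0)"
      using s by (simp add: eq_neg_iff_add_eq_0)
    moreover have "(j + 1) mod int m = 0"
      using True by (metis add_diff_cancel_right' diff_add_cancel mod_add_left_eq mod_self)
    ultimately show ?thesis using g[of j] True by (simp add: z_def)
  next
    case False
    then have "j mod int m + 1 < int m" using mod_verts(2)[of j] by linarith
    then have "(j + 1) mod int m = j mod int m + 1"
      by (metis mod_add_left_eq mod_pos_pos_trivial mod_verts(1) add_nonneg_nonneg zero_le_one)
    moreover have "{0..<j mod int m + 1} = insert (j mod int m) {0..<j mod int m}" by auto
    ultimately show ?thesis using g[of j] by (simp add: z_def)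
  qed
  define B where "B j = M2 (z j + (g j - fps_const (g j $ 0))) 0 0 (z (j + 1))" for j
  have "z (j mod int m) = z j" "z (j mod int m + 1) = z (j + 1)" for j by (simp_all add: z_def mod_simps)
  then have B: "Lam B" by (simp add: Lam_def B_def g)
  have "der g (\<lambda>_. 0) = inner_der A (cls B)"
  proof (rule fun_eq_cls)
    fix M assume M: "Lam M"
    have "dfun g (\<lambda>_. 0) M = (\<lambda>j. B j * M j - M j * B j)"
    proof
      show "dfun g (\<lambda>_. 0) M j = B j * M j - M j * B j" for j
        using z1[of j] by (intro mat2.expand) (simp add: dfun_def dd_def B_def algebra_simps flip: z1)
    qed
    then show "der g (\<lambda>_. 0) (cls M) = inner_der A (cls B) (cls M)" using M B
      by (simp add: der_cls d inner_der_def cls_mult cls_minus Lam_mult)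
  qed (simp add: der_undefined inner_der_def)
  then show ?thesis using that[of "cls B"] by simp
qed

lemma A_vert_mult: "A_vert m N i \<cdot> A_vert m N j = (if i mod int m = j mod int m then A_vert m N i else \<zero>\<^bsub>A\<^esub>)"
  by (simp add: A_gens cls_mult cls_zero) (simp add: Mv_def[abs_def] vrep_mult)

lemma A_gens_carrier [simp]: "A_vert m N i \<in> carrier A" "A_arr m N i \<in> carrier A" "A_bar m N i \<in> carrier A"
  by (simp_all add: A_gens)

lemma finsum_A_vert: "(\<Oplus>\<^bsub>A\<^esub>i\<in>V. A_vert m N i) = \<one>\<^bsub>A\<^esub>"
proof -
  interpret r: ring A by (rule ring_A)
  have *: "(\<Oplus>\<^bsub>A\<^esub>i\<in>S. A_vert m N i) = cls (\<lambda>j. \<Sum>i\<in>S. Mv i j) \<and> Lam (\<lambda>j. \<Sum>i\<in>S. Mv i j)"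
    if "finite S" for S
    using that
  proof (induction S)
    case (insert x S)
    then have "(\<Oplus>\<^bsub>A\<^esub>i\<in>insert x S. A_vert m N i) = A_vert m N x \<oplus>\<^bsub>A\<^esub> (\<Oplus>\<^bsub>A\<^esub>i\<in>S. A_vert m N i)"
      by (intro A.finsum_insert) auto
    then show ?case using insert by (simp add: A_gens cls_add Lam_add)
  qed (simp add: cls_zero)
  have "(\<Sum>i\<in>V. Mv i j) = hm \<one>\<^bsub>R\<^esub> j" for j
  proof -
    have "(\<Sum>i\<in>S. Mv i j) = hm (\<Sum>i\<in>S. single (i, [], i) 1) j" if "S \<subseteq> V" for S
      using that by (induction S rule: infinite_finite_induct) (auto simp: hm_add hm_single Mv_def)
    then show ?thesis by (simp add: path_algebra_def)
  qed
  then show ?thesis using *[of "V"] by (simp add: hm_one cls_one)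
qed

text \<open>The element \<open>\<Sum>\<^sub>i D(e\<^sub>i) e\<^sub>i\<close> does it.\<close>

lemma derivation_vert_inner:
  assumes D: "D \<in> derivations A"
  obtains b where "b \<in> carrier A" "\<And>i. i \<in> V \<Longrightarrow> D (A_vert m N i) = inner_der A b (A_vert m N i)"
proof -
  interpret r: ring A by (rule ring_A)
  define e where "e = (A_vert m N :: int \<Rightarrow> 'k kQ set)"
  have e: "e i \<in> carrier A" and De: "D (e i) \<in> carrier A" for i
    using A.derivationsD(1)[OF D] by (auto simp: e_def)
  have ee: "e i \<cdot> e j = (if i = j then e i else \<zero>\<^bsub>A\<^esub>)" if "i \<in> V" "j \<in> V" for i j
    using that by (simp add: e_def A_vert_mult)
  define b where "b = (\<Oplus>\<^bsub>A\<^esub>i\<in>V. D (e i) \<cdot> e i)"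
  have b: "b \<in> carrier A" unfolding b_def by (rule A.finsum_closed) (use e De in auto)
  have "D (e j) = inner_der A b (e j)" if j: "j \<in> V" for j
  proof -
    let ?t = "\<lambda>i. if j = i then \<zero>\<^bsub>A\<^esub> else \<ominus>\<^bsub>A\<^esub> (D (e j) \<cdot> e i)"
    have t: "?t i \<in> carrier A" for i using e De by simp
    have "b \<cdot> e j = (\<Oplus>\<^bsub>A\<^esub>i\<in>V. (D (e i) \<cdot> e i) \<cdot> e j)"
      unfolding b_def by (rule r.finsum_ldistr) (use e De in auto)
    also have "\<dots> = (\<Oplus>\<^bsub>A\<^esub>i\<in>V. if j = i then D (e i) \<cdot> e i else \<zero>\<^bsub>A\<^esub>)"
      by (rule A.finsum_cong') (use e De j ee in \<open>auto simp: r.m_assoc\<close>)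
    also have "\<dots> = D (e j) \<cdot> e j"
      by (rule A.finsum_singleton) (use e De j in auto)
    finally have be: "b \<cdot> e j = D (e j) \<cdot> e j" .
    \<comment> \<open>Apply \<open>D\<close> to \<open>e j \<cdot> e i\<close> and multiply by
      \<open>e i\<close> from the right. For \<open>i = j\<close> this forces
      \<open>e j \<cdot> (D (e j) \<cdot> e j)\<close> to be zero; for \<open>i \<noteq> j\<close>
      the product of the idempotents is zero, so the two Leibniz terms are opposite.\<close>
    have summand: "e j \<cdot> (D (e i) \<cdot> e i) = ?t i" if i: "i \<in> V" for i
    proof -
      have L: "D (e j \<cdot> e i) \<cdot> e i = (D (e j) \<cdot> e i \<oplus>\<^bsub>A\<^esub> e j \<cdot> D (e i)) \<cdot> e i"
        using A.derivationsD(5)[OF D e e, of j i] by simp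
      also have "\<dots> = D (e j) \<cdot> e i \<oplus>\<^bsub>A\<^esub> e j \<cdot> (D (e i) \<cdot> e i)"
        using e De ee[OF i i] by (simp add: r.l_distr r.m_assoc)
      finally have L: "D (e j \<cdot> e i) \<cdot> e i = D (e j) \<cdot> e i \<oplus>\<^bsub>A\<^esub> e j \<cdot> (D (e i) \<cdot> e i)" .
      show ?thesis
      proof (cases "i = j")
        case True
        then have "D (e j) \<cdot> e j = D (e j) \<cdot> e j \<oplus>\<^bsub>A\<^esub> e j \<cdot> (D (e j) \<cdot> e j)"
          using L ee[OF j j] by simp
        then show ?thesis using True e De by simp
      next
        case False
        then have "D (e j) \<cdot> e i \<oplus>\<^bsub>A\<^esub> e j \<cdot> (D (e i) \<cdot> e i) = \<zero>\<^bsub>A\<^esub>"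
          using L ee[OF j i] A.derivation_zero[OF D] e by simp
        then have "e j \<cdot> (D (e i) \<cdot> e i) = \<ominus>\<^bsub>A\<^esub> (D (e j) \<cdot> e i)"
          using e De by (intro A.minus_equality[symmetric]) (auto simp: A.a_comm)
        then show ?thesis using False by simp
      qed
    qed
    have "e j \<cdot> b = (\<Oplus>\<^bsub>A\<^esub>i\<in>V. e j \<cdot> (D (e i) \<cdot> e i))"
      unfolding b_def by (rule r.finsum_rdistr) (use e De in auto)
    also have "\<dots> = (\<Oplus>\<^bsub>A\<^esub>i\<in>V. ?t i)"
      by (rule A.finsum_cong') (use summand t in auto)
    finally have eb: "e j \<cdot> b = (\<Oplus>\<^bsub>A\<^esub>i\<in>V. ?t i)" .
    \<comment> \<open>The expansion of \<open>D (e j)\<close> along the decomposition of the unit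
      cancels against \<open>e j \<cdot> b\<close> except for the term \<open>i = j\<close>, which
      is \<open>b \<cdot> e j\<close>.\<close>
    have "D (e j) = D (e j) \<cdot> (\<Oplus>\<^bsub>A\<^esub>i\<in>V. e i)"
      using De finsum_A_vert by (simp add: e_def)
    also have "\<dots> = (\<Oplus>\<^bsub>A\<^esub>i\<in>V. D (e j) \<cdot> e i)"
      by (rule r.finsum_rdistr) (use e De in auto)
    finally have "e j \<cdot> b \<oplus>\<^bsub>A\<^esub> D (e j) = (\<Oplus>\<^bsub>A\<^esub>i\<in>V. ?t i) \<oplus>\<^bsub>A\<^esub> (\<Oplus>\<^bsub>A\<^esub>i\<in>V. D (e j) \<cdot> e i)"
      using eb by simp
    also have "\<dots> = (\<Oplus>\<^bsub>A\<^esub>i\<in>V. ?t i \<oplus>\<^bsub>A\<^esub> D (e j) \<cdot> e i)"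
      by (rule A.finsum_addf[symmetric]) (use t e De in auto)
    also have "\<dots> = (\<Oplus>\<^bsub>A\<^esub>i\<in>V. if j = i then D (e i) \<cdot> e i else \<zero>\<^bsub>A\<^esub>)"
      by (rule A.finsum_cong') (use e De in \<open>auto simp: A.l_neg\<close>)
    also have "\<dots> = b \<cdot> e j"
      unfolding be by (rule A.finsum_singleton) (use e De j in auto)
    finally have "b \<cdot> e j = e j \<cdot> b \<oplus>\<^bsub>A\<^esub> D (e j)" by simp
    then show ?thesis
      using e b De by (simp add: inner_der_def a_minus_def A.a_ac A.r_neg A.r_neg1)
  qed
  then show ?thesis using that[OF b] by (simp add: e_def)
qed

lemma A_arr_corner: "A_vert m N i \<cdot> A_arr m N i \<cdot> A_vert m N (i + 1) = A_arr m N i"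
  and A_bar_corner: "A_vert m N (i + 1) \<cdot> A_bar m N i \<cdot> A_vert m N i = A_bar m N i"
proof -
  have *: "(i + 1) mod int m = (j + 1) mod int m \<longleftrightarrow> j mod int m = i mod int m" for j
    using mod_add1_eq_iff by metis
  have "Mv i j * Ma 1 i j * Mv (i + 1) j = Ma 1 i j" "Mv (i + 1) j * Mb 1 i j * Mv i j = Mb 1 i j" for j
    by (rule mat2.expand; simp add: Mv_def Ma_def Mb_def vrep_def *)+
  then show "A_vert m N i \<cdot> A_arr m N i \<cdot> A_vert m N (i + 1) = A_arr m N i"
    "A_vert m N (i + 1) \<cdot> A_bar m N i \<cdot> A_vert m N i = A_bar m N i"
    by (simp_all add: A_gens cls_mult Lam_mult)
qed

text \<open>What runs between \<open>i\<close> and \<open>i + 1\<close> lives in copy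
  \<open>i\<close> alone: another copy would have to contain the two vertices in exchanged roles, so
  that \<open>i\<close> and \<open>i + 2\<close> would agree modulo \<open>m\<close>, against m >=
  3.\<close>

lemma vrep_corner:
  assumes F: "Lam F"
  shows "Mv i j * F j * Mv (i + 1) j = Ma (m12 (F i)) i j"
    and "Mv (i + 1) j * F j * Mv i j = (if j mod int m = i mod int m then M2 0 0 (m21 (F i)) 0 else 0)"
proof -
  have *: "(i + 1) mod int m = (j + 1) mod int m \<longleftrightarrow> i mod int m = j mod int m" by (rule mod_add1_eq_iff)
  have 1: "\<not> (i mod int m = (j + 1) mod int m \<and> (i + 1) mod int m = j mod int m)"
  proof
    assume a: "i mod int m = (j + 1) mod int m \<and> (i + 1) mod int m = j mod int m"
    then have "(j + 1) mod int m = (i + 1 + 1) mod int m" by (metis mod_add_left_eq)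
    then have "i mod int m = (i + 2) mod int m" using a by (simp add: add.assoc)
    then show False using mod_succ_neq(3)[of "i + 1"] by (simp add: add.assoc)
  qed
  have 2: "i mod int m = j mod int m \<Longrightarrow> i mod int m \<noteq> (j + 1) mod int m" using mod_succ_neq by metis
  have 3: "i mod int m = j mod int m \<Longrightarrow> (i + 1) mod int m \<noteq> j mod int m" using mod_succ_neq by metis
  have 4: "i mod int m = j mod int m \<Longrightarrow> F j = F i" using F unfolding Lam_def by metis
  show "Mv i j * F j * Mv (i + 1) j = Ma (m12 (F i)) i j"
    "Mv (i + 1) j * F j * Mv i j = (if j mod int m = i mod int m then M2 0 0 (m21 (F i)) 0 else 0)"
    using 1 2 3 4 by (auto simp: Mv_def Ma_def vrep_def * intro!: mat2.expand)
qed

text \<open>Since \<open>D\<close> kills the trivial paths, it preserves the corners that they cut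
  out. By \<open>vrep_corner\<close> the value on an arrow is then a power series times that arrow,
  which defines \<open>\<mu>\<close> and \<open>\<omega>\<close>. That the constant terms of
  \<open>P\<close> agree is a consequence, obtained by testing \<open>D\<close> on a relation after
  the comparison on the path algebra.\<close>

lemma derivation_eq_der:
  assumes D: "D \<in> derivations A" and D0: "\<And>i. i \<in> V \<Longrightarrow> D (A_vert m N i) = \<zero>\<^bsub>A\<^esub>"
  obtains \<mu> P where "dparam \<mu> P" "D = der \<mu> P"
proof -
  note DD = A.derivationsD[OF D]
  have D0: "D (A_vert m N i) = \<zero>\<^bsub>A\<^esub>" for i
    using D0[of "i mod int m"] by (simp add: Q_vert_def)
  have "\<forall>i. \<exists>F. Lam F \<and> D (A_arr m N i) = cls F" "\<forall>i. \<exists>F. Lam F \<and> D (A_bar m N i) = cls F"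
    using DD(1) cls_surj A_gens_carrier by metis+
  then obtain Fa Fb where Fa: "\<And>i. Lam (Fa i)" "\<And>i. D (A_arr m N i) = cls (Fa i)"
    and Fb: "\<And>i. Lam (Fb i)" "\<And>i. D (A_bar m N i) = cls (Fb i)" by metis
  define \<mu> where "\<mu> j = m12 (Fa (j mod int m) (j mod int m))" for j
  \<comment> \<open>Division by t; the constant term of a lower left entry is zero in
    \<open>Lam\<close>.\<close>
  define \<omega> where "\<omega> j = fps_shift 1 (m21 (Fb (j mod int m) (j mod int m)))" for j
  define P where "P j = \<mu> j + \<omega> j" for j
  have a: "D (A_arr m N i) = cls (Ma (\<mu> i) i)" if "i \<in> V" for i
  proof -
    have "D (A_arr m N i) = A_vert m N i \<cdot> D (A_arr m N i) \<cdot> A_vert m N (i + 1)"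
      using DD(5)[of "A_vert m N i \<cdot> A_arr m N i" "A_vert m N (i + 1)"] DD(5)[of "A_vert m N i" "A_arr m N i"] DD(1)
      by (simp add: A_arr_corner D0)
    also have "\<dots> = cls (\<lambda>j. Mv i j * Fa i j * Mv (i + 1) j)"
      using Fa by (simp add: A_gens cls_mult Lam_mult)
    also have "\<dots> = cls (Ma (\<mu> i) i)"
      using that by (simp add: vrep_corner(1)[OF Fa(1)] \<mu>_def)
    finally show ?thesis .
  qed
  have b: "D (A_bar m N i) = cls (Mb (\<omega> i) i)" if "i \<in> V" for i
  proof -
    have z: "m21 (Fb i i) $ 0 = 0" using Fb(1) by (simp add: Lam_def)
    have "fps_X * fps_shift 1 (m21 (Fb i i)) = m21 (Fb i i)"
      using z by (intro fps_ext) (auto simp: fps_X_mult_nth)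
    then have s: "fps_X * \<omega> i = m21 (Fb i i)" using that by (simp add: \<omega>_def)
    have "D (A_bar m N i) = A_vert m N (i + 1) \<cdot> D (A_bar m N i) \<cdot> A_vert m N i"
      using DD(5)[of "A_vert m N (i + 1) \<cdot> A_bar m N i" "A_vert m N i"] DD(5)[of "A_vert m N (i + 1)" "A_bar m N i"] DD(1)
      by (simp add: A_bar_corner D0)
    also have "\<dots> = cls (\<lambda>j. Mv (i + 1) j * Fb i j * Mv i j)"
      using Fb by (simp add: A_gens cls_mult Lam_mult)
    also have "\<dots> = cls (Mb (\<omega> i) i)"
    proof -
      have "(\<lambda>j. Mv (i + 1) j * Fb i j * Mv i j) = Mb (\<omega> i) i"
        by (rule ext) (simp add: vrep_corner(2)[OF Fb(1)] Mb_def s)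
      then show ?thesis by simp
    qed
    finally show ?thesis .
  qed
  have per: "\<mu> (j mod int m) = \<mu> j" "P (j mod int m) = P j" for j by (simp_all add: \<mu>_def \<omega>_def P_def)
  let ?T = "dfun \<mu> P"
  have LT: "Lam M \<Longrightarrow> Lam (?T M)" for M by (intro Lam_dfun per)
  have qT: "qder (\<lambda>f. cls (?T (hm f)))" by (rule qder_dfun) (rule per)+
  have gens: "D (A_vert m N i) = cls (?T (hm (Q_vert m i))) \<and> D (A_arr m N i) = cls (?T (hm (Q_arr m i))) \<and>
      D (A_bar m N i) = cls (?T (hm (Q_bar m i)))" if "i \<in> V" for i
    using a[OF that] b[OF that] D0[of i] dfun_gens[of \<mu> P i] per by (simp add: hm_gens P_def cls_zero)
  have DT: "D (q f) = cls (?T (hm f))" if f: "f \<in> carrier R" for f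
    by (rule qder_eqI[OF qder_derivation[OF D] qT gens f])
  have "P i $ 0 = P (i - 1) $ 0" for i
  proof -
    define r :: "'k kQ" where "r = single (apath True i (2 * N)) 1 - single (apath False (i - 1) (2 * N)) 1"
    have r: "r \<in> I" unfolding r_def by (rule top_rel)
    have rR: "r \<in> carrier R" by (rule I_carrier[OF r])
    have "q r = q 0" using r q_eq[of r 0] by (simp add: I_eq)
    then have "D (q r) = \<zero>\<^bsub>A\<^esub>" using A.derivation_zero[OF D] by (simp add: q_zero)
    then have "cls (?T (hm r)) = cls (\<lambda>j. 0)" using DT[OF rR] by (simp add: cls_zero)
    then have "J (\<lambda>j. ?T (hm r) j - 0)" using LT[OF hm_Lam[OF rR]] by (subst (asm) cls_eq) auto
    then have "m11 (?T (hm r) i) $ N + m22 (?T (hm r) (i - 1)) $ N = 0" by (simp add: J_def)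
    moreover have "hm r i = M2 (fps_X ^ N) 0 0 0" "hm r (i - 1) = - M2 0 0 0 (fps_X ^ N)"
      using N1 mod_succ_neq[of "i - 1"] unfolding r_def hm_diff by (simp_all add: hm_single prep_apath munit_def)
    moreover have "(a * (fps_X * fps_deriv (fps_X ^ N))) $ N = a $ 0 * of_nat N" for a :: "'k fps"
      by (subst vo_mult_nth_left) (simp_all add: vo_X_deriv)
    ultimately have "P i $ 0 * of_nat N - P (i - 1) $ 0 * of_nat N = 0"
      by (simp add: dfun_def dd_def)
    then show ?thesis using N_nz by simp
  qed
  then have dp: "dparam \<mu> P" using per by (simp add: dparam_def)
  have "D = der \<mu> P"
    by (rule derivation_eqI[OF D der_derivation[OF dp]]) (use a b D0 der_gens[OF dp] in \<open>auto simp: P_def\<close>)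
  then show ?thesis using that dp by blast
qed

section \<open>The first Hochschild cohomology\<close>

abbreviation H :: "('k, 'k HH1_elem) module" where "H \<equiv> HH1_A m N"
abbreviation DA :: "('k, 'k kQ set \<Rightarrow> 'k kQ set) module" where "DA \<equiv> der_alg A"

lemma nalg_ideal_inner_A: "nalg_ideal DA (inner_derivations A)"
  by (rule A.nalg_ideal_inner[OF ring_A])

sublocale DA: nalg DA by (rule A.nalg_der_alg)

lemma H_carrier: "carrier H = HH1_class A ` derivations A"
  and hc_zero: "\<zero>\<^bsub>H\<^esub> = HH1_class A \<zero>\<^bsub>DA\<^esub>"
  and hc_add: "\<lbrakk>D \<in> derivations A; D' \<in> derivations A\<rbrakk> \<Longrightarrow> HH1_class A D \<oplus>\<^bsub>H\<^esub> HH1_class A D' = HH1_class A (D \<oplus>\<^bsub>DA\<^esub> D')"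
  and hc_mult: "\<lbrakk>D \<in> derivations A; D' \<in> derivations A\<rbrakk> \<Longrightarrow> HH1_class A D \<otimes>\<^bsub>H\<^esub> HH1_class A D' = HH1_class A (D \<otimes>\<^bsub>DA\<^esub> D')"
  and hc_smult: "D \<in> derivations A \<Longrightarrow> a \<odot>\<^bsub>H\<^esub> HH1_class A D = HH1_class A (a \<odot>\<^bsub>DA\<^esub> D)"
  unfolding HH1_A_def HH1_def HH1_class_def
  using nalg_ideal.quot_simps[OF nalg_ideal_inner_A] by (simp_all only: A.der_alg_simps(1))

lemma nalg_H: "nalg H"
  unfolding HH1_A_def HH1_def by (rule nalg_ideal.nalg_quot[OF nalg_ideal_inner_A])

sublocale H: nalg H by (rule nalg_H)

lemma hc_eq: "\<lbrakk>D \<in> derivations A; D' \<in> derivations A\<rbrakk> \<Longrightarrow>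
    HH1_class A D = HH1_class A D' \<longleftrightarrow> D \<ominus>\<^bsub>DA\<^esub> D' \<in> inner_derivations A"
  unfolding HH1_class_def using nalg_ideal.coset_eq_iff[OF nalg_ideal_inner_A] by (simp only: A.der_alg_simps(1))

definition okP :: "(int \<Rightarrow> 'k fps) \<Rightarrow> bool" where
  "okP P \<longleftrightarrow> (\<forall>j. P (j mod int m) = P j \<and> P j $ 0 = P (j - 1) $ 0)"

text \<open>For given \<open>P\<close> the class of a derivation depends on \<open>\<mu>\<close> only
  through the mean over \<open>j\<close> of \<open>2 \<mu>\<^sub>j(0) - P\<^sub>j(0)\<close>,
  which is \<open>x\<close> for \<open>can x P\<close>.\<close>

definition can :: "'k \<Rightarrow> (int \<Rightarrow> 'k fps) \<Rightarrow> int \<Rightarrow> 'k fps" where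
  "can x P j = P j - fps_const ((P j $ 0 - x) / 2)"

definition hcls :: "'k \<Rightarrow> (int \<Rightarrow> 'k fps) \<Rightarrow> 'k HH1_elem" where
  "hcls x P = HH1_class A (der (can x P) P)"

lemma dparam_can [simp]: "okP P \<Longrightarrow> dparam (can x P) P"
  by (auto simp: dparam_def okP_def can_def)

lemma can_nth: "2 * can x P j $ 0 = P j $ 0 + x"
proof -
  have half: "2 * ((P j $ 0 - x) / 2) = P j $ 0 - x" using two_nz by simp
  have "can x P j $ 0 = P j $ 0 - (P j $ 0 - x) / 2" by (simp add: can_def)
  then show ?thesis by (simp only: right_diff_distrib[of 2 "P j $ 0"] half) simp
qed

lemma okP_const [simp]: "okP (\<lambda>_. a)"
  and okP_add [simp]: "okP P \<Longrightarrow> okP Q \<Longrightarrow> okP (\<lambda>j. P j + Q j)"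
  and okP_scale [simp]: "okP P \<Longrightarrow> okP (\<lambda>j. fps_const c * P j)"
  and okP_bracket [simp]: "okP P \<Longrightarrow> okP Q \<Longrightarrow> okP (\<lambda>j. brk (P j) (Q j))"
  by (simp_all add: okP_def brk_def)

lemma der_add:
  assumes "dparam \<mu> P" "dparam \<nu> Q"
  shows "der \<mu> P \<oplus>\<^bsub>DA\<^esub> der \<nu> Q = der (\<lambda>j. \<mu> j + \<nu> j) (\<lambda>j. P j + Q j)"
proof (rule fun_eq_cls)
  have d: "dparam (\<lambda>j. \<mu> j + \<nu> j) (\<lambda>j. P j + Q j)" using assms by (simp add: dparam_def)
  fix M assume M: "Lam M"
  then show "(der \<mu> P \<oplus>\<^bsub>DA\<^esub> der \<nu> Q) (cls M) = der (\<lambda>j. \<mu> j + \<nu> j) (\<lambda>j. P j + Q j) (cls M)"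
    using assms d dparam_Lam[OF assms(1) M] dparam_Lam[OF assms(2) M]
    by (simp add: der_cls cls_add) (simp add: dfun_def[abs_def] dd_param_add)
qed (simp add: der_undefined)

lemma der_smult:
  assumes "dparam \<mu> P"
  shows "a \<odot>\<^bsub>DA\<^esub> der \<mu> P = der (\<lambda>j. fps_const a * \<mu> j) (\<lambda>j. fps_const a * P j)"
proof (rule fun_eq_cls)
  have d: "dparam (\<lambda>j. fps_const a * \<mu> j) (\<lambda>j. fps_const a * P j)" using assms by (simp add: dparam_def)
  fix M assume M: "Lam M"
  then show "(a \<odot>\<^bsub>DA\<^esub> der \<mu> P) (cls M) = der (\<lambda>j. fps_const a * \<mu> j) (\<lambda>j. fps_const a * P j) (cls M)"
    using assms d dparam_Lam[OF assms M]
    by (simp add: der_cls cls_smult) (simp add: dfun_def[abs_def] dd_param_scale)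
qed (simp add: der_undefined)

lemma der_bracket:
  assumes "dparam \<mu> P" "dparam \<nu> Q"
  shows "der \<mu> P \<otimes>\<^bsub>DA\<^esub> der \<nu> Q =
    der (\<lambda>j. fps_X * (P j * fps_deriv (\<nu> j) - Q j * fps_deriv (\<mu> j))) (\<lambda>j. brk (P j) (Q j))"
    (is "_ = der ?\<mu> ?P")
proof (rule fun_eq_cls)
  have d: "dparam ?\<mu> ?P" using assms by (simp add: dparam_def brk_def)
  fix M assume M: "Lam M"
  note L = dparam_Lam[OF assms(1) M] dparam_Lam[OF assms(2) M]
  then show "(der \<mu> P \<otimes>\<^bsub>DA\<^esub> der \<nu> Q) (cls M) = der ?\<mu> ?P (cls M)"
    using assms d M dparam_Lam[OF assms(1) L(2)] dparam_Lam[OF assms(2) L(1)]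
    by (simp add: der_cls cls_minus) (simp add: dfun_def[abs_def] dd_bracket)
qed (simp add: der_undefined)

lemma der_minus:
  assumes "dparam \<mu> P" "dparam \<nu> Q"
  shows "der \<mu> P \<ominus>\<^bsub>DA\<^esub> der \<nu> Q = der (\<lambda>j. \<mu> j - \<nu> j) (\<lambda>j. P j - Q j)"
proof -
  have d: "dparam (\<lambda>j. fps_const (- 1) * \<nu> j) (\<lambda>j. fps_const (- 1) * Q j)" using assms(2) by (simp add: dparam_def)
  have "der \<mu> P \<ominus>\<^bsub>DA\<^esub> der \<nu> Q = der \<mu> P \<oplus>\<^bsub>DA\<^esub> (- 1) \<odot>\<^bsub>DA\<^esub> der \<nu> Q"
    using DA.minus_smult[of "der \<nu> Q"] der_derivation[OF assms(2)] by (simp only: a_minus_def A.der_alg_simps(1))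
  also have "\<dots> = der (\<lambda>j. \<mu> j + fps_const (- 1) * \<nu> j) (\<lambda>j. P j + fps_const (- 1) * Q j)"
    by (simp only: der_smult[OF assms(2)] der_add[OF assms(1) d])
  finally show ?thesis by (simp flip: fps_const_neg)
qed

lemma inner_der_in: "b \<in> carrier A \<Longrightarrow> inner_der A b \<in> inner_derivations A"
  by (auto simp: inner_derivations_eq)

text \<open>By \<open>der_inner\<close>, changing \<open>\<mu>\<close> by a periodic
  \<open>g\<close> whose constant terms sum to zero changes the derivation by an inner one. The
  difference to \<open>can ?x P\<close> is of this kind because \<open>?x\<close> is the mean; this
  is where \<open>m\<close> and 2 are inverted.\<close>

lemma class_der:
  assumes d: "dparam \<mu> P"
  shows "HH1_class A (der \<mu> P) = hcls ((\<Sum>i\<in>V. 2 * \<mu> i $ 0 - P i $ 0) / of_nat m) P"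
proof -
  let ?x = "(\<Sum>i\<in>V. 2 * \<mu> i $ 0 - P i $ 0) / of_nat m"
  have ok: "okP P" using d by (simp add: okP_def dparam_def)
  let ?g = "\<lambda>j. \<mu> j - can ?x P j"
  have "2 * (\<Sum>i\<in>V. ?g i $ 0) = (\<Sum>i\<in>V. (2 * \<mu> i $ 0 - P i $ 0) - ?x)"
    unfolding sum_distrib_left by (rule sum.cong) (simp_all only: fps_sub_nth right_diff_distrib can_nth diff_diff_add)
  also have "\<dots> = (\<Sum>i\<in>V. 2 * \<mu> i $ 0 - P i $ 0) - of_nat m * ?x"
    by (simp only: sum_subtractf[of "\<lambda>i. 2 * \<mu> i $ 0 - P i $ 0" "\<lambda>_. ?x"]) simp
  also have "\<dots> = 0" using m_nz by simp
  finally have "2 * (\<Sum>i\<in>V. ?g i $ 0) = 0" .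
  then have "(\<Sum>i\<in>V. ?g i $ 0) = 0" using two_nz unfolding mult_eq_0_iff by blast
  moreover have "?g (j mod int m) = ?g j" for j
    using d by (simp add: dparam_def can_def)
  ultimately obtain b where b: "b \<in> carrier A" "der ?g (\<lambda>_. 0) = inner_der A b"
    using der_inner[of ?g] by blast
  have "der \<mu> P \<ominus>\<^bsub>DA\<^esub> der (can ?x P) P = inner_der A b"
    using b(2) by (simp only: der_minus[OF d dparam_can[OF ok]] diff_self)
  then show ?thesis unfolding hcls_def
    using b(1) by (subst hc_eq) (auto intro: der_derivation d dparam_can ok inner_der_in)
qed

text \<open>Subtracting the inner derivation of \<open>derivation_vert_inner\<close> yields a
  derivation of the same class that vanishes on the trivial paths, so that
  \<open>derivation_eq_der\<close> and \<open>class_der\<close> apply.\<close>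

lemma H_surj:
  assumes "h \<in> carrier H" obtains x P where "okP P" "h = hcls x P"
proof -
  obtain D where D: "D \<in> derivations A" "h = HH1_class A D" using assms by (auto simp: H_carrier)
  obtain b where b: "b \<in> carrier A" "\<And>i. i \<in> V \<Longrightarrow> D (A_vert m N i) = inner_der A b (A_vert m N i)"
    using derivation_vert_inner[OF D(1)] by blast
  have bD: "inner_der A b \<in> derivations A" by (rule A.inner_der_derivation[OF ring_A b(1)])
  define D0 where "D0 = D \<ominus>\<^bsub>DA\<^esub> inner_der A b"
  have D0: "D0 \<in> derivations A" using DA.minus_closed[of D "inner_der A b"] D bD by (simp add: D0_def)
  have "D = inner_der A b \<oplus>\<^bsub>DA\<^esub> D0"
  proof -
    have c: "D \<in> carrier DA" "inner_der A b \<in> carrier DA" using D bD by simp_all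
    then show ?thesis
      unfolding D0_def a_minus_def by (simp add: DA.a_lcomm[of "inner_der A b" D] DA.r_neg del: A.der_alg_simps)
  qed
  then have hD: "h = HH1_class A D0"
    using nalg_ideal.coset_eqI[OF nalg_ideal_inner_A, of D0 "inner_der A b"] D0 inner_der_in[OF b(1)]
    by (simp add: D(2) HH1_class_def del: A.der_alg_simps(2-))
  have "D0 (A_vert m N i) = \<zero>\<^bsub>A\<^esub>" if i: "i \<in> V" for i
  proof -
    have "D0 = D \<oplus>\<^bsub>DA\<^esub> (- 1) \<odot>\<^bsub>DA\<^esub> inner_der A b"
      using DA.minus_smult[of "inner_der A b"] bD by (simp only: D0_def a_minus_def A.der_alg_simps(1))
    then show ?thesis using A.derivationsD(1)[OF bD] b(2)[OF i]
      by (simp add: A.minus_smult A.r_neg)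
  qed
  then obtain \<mu> P where "dparam \<mu> P" "D0 = der \<mu> P" using derivation_eq_der[OF D0] by metis
  moreover from this(1) have "okP P" by (simp add: okP_def dparam_def)
  ultimately show ?thesis using that hD class_der by metis
qed

lemma hcls_carrier [simp]: "okP P \<Longrightarrow> hcls x P \<in> carrier H"
  by (simp add: hcls_def H_carrier der_derivation)

text \<open>For the difference of the two derivations, twice the constant term of the diagonal
  parameter minus that of the series is \<open>x - x'\<close> in every copy, so being inner requires
  \<open>of_nat m * (x - x') = 0\<close>. Conversely, if the scalars and the truncated series agree,
  so do the constant terms; then \<open>?g\<close> and \<open>?Q\<close> coincide and
  \<open>der_zero\<close> applies.\<close>

lemma hcls_eq:
  assumes P: "okP P" "okP P'"
  shows "hcls x P = hcls x' P' \<longleftrightarrow> x = x' \<and> (\<forall>j. vo N (P j - P' j))"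
proof -
  let ?g = "\<lambda>j. can x P j - can x' P' j" and ?Q = "\<lambda>j. P j - P' j"
  have d: "dparam ?g ?Q" using P by (simp add: dparam_def okP_def can_def)
  have eq: "hcls x P = hcls x' P' \<longleftrightarrow> der ?g ?Q \<in> inner_derivations A"
    unfolding hcls_def using P by (subst hc_eq) (auto intro: der_derivation simp: der_minus)
  show ?thesis
  proof
    assume "hcls x P = hcls x' P'"
    then obtain b where b: "b \<in> carrier A" "der ?g ?Q = inner_der A b"
      using eq by (auto simp: inner_derivations_eq)
    have "2 * ?g i $ 0 - ?Q i $ 0 = x - x'" for i
      by (simp only: fps_sub_nth right_diff_distrib can_nth) simp
    then have "of_nat m * (x - x') = 0" using der_inner_conv(2)[OF d b] by simp
    then show "x = x' \<and> (\<forall>j. vo N (?Q j))"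
      using der_inner_conv(1)[OF d b] m_nz by simp
  next
    assume a: "x = x' \<and> (\<forall>j. vo N (?Q j))"
    then have "P j $ 0 = P' j $ 0" for j using vo_nth[of N "?Q j" 0] N1 by simp
    then have "?g j = ?Q j" for j using a by (simp add: can_def)
    then have "der ?g ?Q = \<zero>\<^bsub>DA\<^esub>" using a by (subst der_zero[OF d]) auto
    also have "\<dots> = inner_der A \<zero>\<^bsub>A\<^esub>" by (rule A.inner_der_zero[OF ring_A, symmetric])
    finally show "hcls x P = hcls x' P'" unfolding eq by (simp add: inner_der_in)
  qed
qed

lemma hcls_cong: "\<lbrakk>okP P; okP P'; x = x'; \<And>j. vo N (P j - P' j)\<rbrakk> \<Longrightarrow> hcls x P = hcls x' P'"
  by (simp add: hcls_eq)

lemma hcls_add: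
  assumes "okP P" "okP Q" shows "hcls x P \<oplus>\<^bsub>H\<^esub> hcls y Q = hcls (x + y) (\<lambda>j. P j + Q j)"
proof -
  have "can (x + y) (\<lambda>j. P j + Q j) = (\<lambda>j. can x P j + can y Q j)"
  proof
    have "(P j $ 0 + Q j $ 0 - (x + y)) / 2 = (P j $ 0 - x) / 2 + (Q j $ 0 - y) / 2" for j
      by (simp add: add_divide_distrib[symmetric] algebra_simps)
    then show "can (x + y) (\<lambda>j. P j + Q j) j = can x P j + can y Q j" for j
      by (simp add: can_def algebra_simps flip: fps_const_add)
  qed
  then show ?thesis
    using assms by (simp add: hcls_def hc_add der_derivation der_add del: A.der_alg_simps)
qed

lemma hcls_smult:
  assumes "okP P" shows "a \<odot>\<^bsub>H\<^esub> hcls x P = hcls (a * x) (\<lambda>j. fps_const a * P j)"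
proof -
  have "can (a * x) (\<lambda>j. fps_const a * P j) = (\<lambda>j. fps_const a * can x P j)"
    by (rule ext) (simp add: can_def algebra_simps diff_divide_distrib)
  then show ?thesis
    using assms by (simp add: hcls_def hc_smult der_derivation der_smult del: A.der_alg_simps)
qed

text \<open>\<open>can\<close> differs from \<open>P\<close> by a constant, which the derivative
  removes. The diagonal parameter of the commutator is therefore the bracket itself, and this is
  \<open>can 0\<close> as it has no constant term. So \<open>x\<close> and \<open>y\<close> drop
  out, and C is central.\<close>

lemma hcls_bracket:
  assumes "okP P" "okP Q"
  shows "hcls x P \<otimes>\<^bsub>H\<^esub> hcls y Q = hcls 0 (\<lambda>j. brk (P j) (Q j))"
proof -
  have "can 0 (\<lambda>j. brk (P j) (Q j)) =
     (\<lambda>j. fps_X * (P j * fps_deriv (can y Q j) - Q j * fps_deriv (can x P j)))"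
    by (rule ext) (simp add: can_def brk_def)
  then show ?thesis
    using assms by (simp add: hcls_def hc_mult der_derivation der_bracket del: A.der_alg_simps)
qed

lemma hcls_zero: "\<zero>\<^bsub>H\<^esub> = hcls 0 (\<lambda>_. 0)"
proof -
  have "der (can 0 (\<lambda>_. 0)) (\<lambda>_. 0) = \<zero>\<^bsub>DA\<^esub>"
    by (subst der_zero) (auto simp: can_def)
  then show ?thesis by (simp add: hcls_def hc_zero)
qed

section \<open>The classes of the distinguished derivations\<close>

lemma cls_pow: "Lam M \<Longrightarrow> cls M [^]\<^bsub>A\<^esub> (n :: nat) = cls (\<lambda>j. M j ^ n) \<and> Lam (\<lambda>j. M j ^ n)"
proof (induction n)
  case 0
  interpret r: ring A by (rule ring_A)
  show ?case by (simp add: cls_one)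
next
  case (Suc n)
  interpret r: ring A by (rule ring_A)
  show ?case using Suc by (simp add: cls_mult Lam_mult power_Suc2 del: power_Suc)
qed

text \<open>Here \<open>\<mu>\<close> and \<open>P\<close> are both 1, and 2 - 1 = 1; in
  \<open>psi_class_eq\<close> they are 0 and -1, which again gives 1. Half the sum and half the
  difference then have the coordinates wanted for C and E_0.\<close>

lemma phi_class_eq: "phi_class m N = hcls 1 (\<lambda>_. 1 :: 'k fps)"
proof -
  have d: "dparam (\<lambda>_. 1) (\<lambda>_. 1)" by (simp add: dparam_def)
  have "cls (Mb 0 i) = \<zero>\<^bsub>A\<^esub>" for i unfolding cls_zero by (rule arg_cong[where f = cls]) (auto simp: Mb_def zero_mat2_def)
  then have "arrow_derivation m N (A_arr m N) (\<lambda>_. \<zero>\<^bsub>A\<^esub>) = der (\<lambda>_. 1) (\<lambda>_. 1)"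
    by (intro arrow_derivation_eq d) (simp_all add: A_gens)
  then show ?thesis using m_nz by (simp add: phi_class_def class_der[OF d])
qed

lemma psi_class_eq: "psi_class m N = hcls 1 (\<lambda>_. - 1 :: 'k fps)"
proof -
  have d: "dparam (\<lambda>_. 0) (\<lambda>_. - 1)" by (simp add: dparam_def)
  have "cls (Ma 0 i) = \<zero>\<^bsub>A\<^esub>" for i unfolding cls_zero by (rule arg_cong[where f = cls]) (auto simp: Ma_def zero_mat2_def)
  moreover have "(\<lambda>j. - Mb 1 i j) = Mb (- 1) i" for i by (rule ext, rule mat2.expand) (simp add: Mb_def)
  ultimately have "arrow_derivation m N (\<lambda>_. \<zero>\<^bsub>A\<^esub>) (\<lambda>i. \<ominus>\<^bsub>A\<^esub> A_bar m N i) = der (\<lambda>_. 0) (\<lambda>_. - 1)"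
    by (intro arrow_derivation_eq d) (simp_all add: A_gens cls_uminus)
  then show ?thesis using m_nz by (simp add: psi_class_def class_der[OF d])
qed

lemma C_class_eq: "C_class m N = hcls 1 (\<lambda>_. 0 :: 'k fps)"
proof -
  have "C_class m N = (1 / 2 :: 'k) \<odot>\<^bsub>H\<^esub> (hcls 1 (\<lambda>_. 1) \<oplus>\<^bsub>H\<^esub> hcls 1 (\<lambda>_. - 1))"
    by (simp add: C_class_def Let_def HH1_A_def phi_class_eq psi_class_eq)
  also have "\<dots> = hcls (1 / 2 * (1 + 1)) (\<lambda>_. fps_const (1 / 2) * (1 + - 1))"
    by (simp only: hcls_add[OF okP_const okP_const] hcls_smult[OF okP_const])
  finally show ?thesis using two_nz by simp
qed

lemma E0_class_eq: "E0_class m N = hcls 0 (\<lambda>_. 1 :: 'k fps)"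
proof -
  have "E0_class m N = (1 / 2 :: 'k) \<odot>\<^bsub>H\<^esub> (hcls 1 (\<lambda>_. 1) \<oplus>\<^bsub>H\<^esub> (- 1) \<odot>\<^bsub>H\<^esub> hcls 1 (\<lambda>_. - 1))"
    using H.minus_smult[of "hcls 1 (\<lambda>_. - 1)"]
    by (simp add: E0_class_def Let_def phi_class_eq psi_class_eq a_minus_def flip: HH1_A_def)
  also have "\<dots> = hcls (1 / 2 * (1 + - 1 * 1)) (\<lambda>_. fps_const (1 / 2) * (1 + fps_const (- 1) * - 1))"
    by (simp only: hcls_add[OF okP_const okP_const] hcls_smult[OF okP_const])
  also have "fps_const (1 / 2) * (1 + fps_const (- 1) * - 1) = (1 :: 'k fps)"
    using two_nz by (simp add: numeral_fps_const flip: fps_const_neg)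
  finally show ?thesis by simp
qed

text \<open>The value on a_j has t^s in place of the entry 1, and the reverse goes to 0, so
  \<open>\<mu>\<close> and \<open>P\<close> are both t^s in copy \<open>j\<close>. As
  \<open>s \<ge> 1\<close>, there are no constant terms and the scalar is 0.\<close>

lemma E_class_eq:
  assumes j: "j \<in> V" and s: "s \<ge> 1"
  shows "E_class m N j s = hcls 0 (\<lambda>i. if i mod int m = j then fps_X ^ s else 0 :: 'k fps)"
proof -
  let ?P = "\<lambda>i. if i mod int m = j then fps_X ^ s else 0 :: 'k fps"
  have d: "dparam ?P ?P" using s by (auto simp: dparam_def)
  have "Ma 1 j i * (Mb 1 j i * Ma 1 j i) ^ n = Ma (fps_X ^ n) j i" for i n
  proof (induction n)
    case (Suc n)
    have "Ma 1 j i * (Mb 1 j i * Ma 1 j i) ^ Suc n = Ma (fps_X ^ n) j i * (Mb 1 j i * Ma 1 j i)"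
      by (simp only: power_Suc2 Suc[symmetric] mult.assoc)
    also have "\<dots> = Ma (fps_X ^ Suc n) j i"
      by (rule mat2.expand) (simp add: Ma_def Mb_def)
    finally show ?case .
  qed simp
  then have "A_arr m N j \<cdot> (A_bar m N j \<cdot> A_arr m N j) [^]\<^bsub>A\<^esub> s = cls (Ma (fps_X ^ s) j)"
    using cls_pow[of "\<lambda>i. Mb 1 j i * Ma 1 j i" s] by (simp add: A_gens cls_mult Lam_mult)
  moreover have "cls (Ma 0 i) = \<zero>\<^bsub>A\<^esub>" "cls (Mb 0 i) = \<zero>\<^bsub>A\<^esub>" for i
    unfolding cls_zero by (rule arg_cong[where f = cls]; auto simp: Ma_def Mb_def zero_mat2_def)+
  ultimately have "arrow_derivation m N
      (\<lambda>i. if i = j then A_arr m N j \<cdot> (A_bar m N j \<cdot> A_arr m N j) [^]\<^bsub>A\<^esub> s else \<zero>\<^bsub>A\<^esub>)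
      (\<lambda>_. \<zero>\<^bsub>A\<^esub>) = der ?P ?P"
    using j by (intro arrow_derivation_eq d) auto
  moreover have "(\<Sum>i\<in>V. 2 * ?P i $ 0 - ?P i $ 0) = 0" using s by (intro sum.neutral) auto
  ultimately show ?thesis by (simp add: E_class_def Let_def class_der[OF d])
qed

section \<open>The embedding and the pullback\<close>

definition aN :: "'k fps \<Rightarrow> 'k fa_elem" where "aN = aq (N - 1)"

lemma aN_eq: "aN P = aN Q \<longleftrightarrow> vo N (P - Q)"
  using N1 unfolding aN_def aq_eq by simp

lemma aN_nth_0: "aN P = aN Q \<Longrightarrow> P $ 0 = Q $ 0"
  using N1 vo_nth[of N "P - Q" 0] by (simp add: aN_eq)

lemma lie_algebra_corner: "lie_algebra (corner N :: ('k, _) module)"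
  unfolding corner_def by (intro lie_algebra_prod_alg lie_algebra_lie_line lie_algebra_lie_a)

lemma lie_algebra_base: "lie_algebra (base :: ('k, _) module)"
  unfolding base_def by (intro lie_algebra_prod_alg lie_algebra_lie_line)

lemma lie_algebra_target: "lie_algebra (target m N :: ('k, _) module)"
  unfolding target_def
  by (intro lie_algebra_prod_alg lie_algebra_lie_line lie_algebra_Prod_alg lie_algebra_lie_a)

lemma lie_algebra_H: "lie_algebra H"
  unfolding lie_algebra_iff
proof (intro conjI ballI nalg_H)
  fix x assume "x \<in> carrier H"
  then show "x \<otimes>\<^bsub>H\<^esub> x = \<zero>\<^bsub>H\<^esub>" by (elim H_surj) (simp add: hcls_bracket hcls_zero)
next
  fix x y z assume "x \<in> carrier H" "y \<in> carrier H" "z \<in> carrier H"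
  then obtain a P b Q c U where *: "okP P" "x = hcls a P" "okP Q" "y = hcls b Q" "okP U" "z = hcls c U"
    by (metis H_surj)
  show "x \<otimes>\<^bsub>H\<^esub> (y \<otimes>\<^bsub>H\<^esub> z) \<oplus>\<^bsub>H\<^esub> y \<otimes>\<^bsub>H\<^esub> (z \<otimes>\<^bsub>H\<^esub> x) \<oplus>\<^bsub>H\<^esub> z \<otimes>\<^bsub>H\<^esub> (x \<otimes>\<^bsub>H\<^esub> y) = \<zero>\<^bsub>H\<^esub>"
    using * by (simp add: hcls_bracket hcls_add hcls_zero brk_jacobi)
qed

lemma lie_a_N:
  "carrier (lie_a (N - 1) :: ('k, _) module) = range aN" "\<zero>\<^bsub>lie_a (N - 1)\<^esub> = aN 0" "a_L (N - 1) s = aN (fps_X ^ s)"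
  "aN P \<oplus>\<^bsub>lie_a (N - 1)\<^esub> aN Q = aN (P + Q)" "aN P \<otimes>\<^bsub>lie_a (N - 1)\<^esub> aN Q = aN (brk P Q)"
  "a \<odot>\<^bsub>lie_a (N - 1)\<^esub> aN P = aN (fps_const a * P)"
  unfolding aN_def by (rule lie_a_carrier lie_a_zero a_L_eq lie_a_add lie_a_bracket lie_a_smult)+

lemmas lie_a_N' = lie_a_N[unfolded One_nat_def]

section \<open>The projections of the corner Lie algebras\<close>

lemma corner_simps:
  "carrier (corner N :: ('k, _) module) = UNIV \<times> range aN"
  "(x, aN P) \<oplus>\<^bsub>corner N\<^esub> (y, aN Q) = (x + y, aN (P + Q))"
  "(x, aN P) \<otimes>\<^bsub>corner N\<^esub> (y, aN Q) = (0, aN (brk P Q))"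
  "a \<odot>\<^bsub>corner N\<^esub> (x, aN P) = (a * x, aN (fps_const a * P))"
  by (simp_all add: corner_def prod_alg_def lie_line_def lie_a_N')

lemma base_simps:
  "carrier (base :: ('k, _) module) = UNIV"
  "(x, y) \<oplus>\<^bsub>base\<^esub> (x', y') = (x + x' :: 'k, y + y' :: 'k)"
  "z \<otimes>\<^bsub>base\<^esub> z' = (0 :: 'k, 0 :: 'k)"
  "a \<odot>\<^bsub>base\<^esub> (x, y) = (a * x :: 'k, a * y :: 'k)"
  by (simp_all add: base_def prod_alg_def lie_line_def)

lemma cornerE:
  assumes "z \<in> carrier (corner N :: ('k, _) module)" obtains x P where "z = (x, aN P)"
  using assms by (cases z) (auto simp: corner_simps)

text \<open>The constant term does not depend on the series chosen, by \<open>aN_nth_0\<close>,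
  which rests on N >= 1.\<close>

definition corner_map :: "'k \<times> 'k fa_elem \<Rightarrow> 'k \<times> 'k" where
  "corner_map = (\<lambda>z\<in>carrier (corner N). (fst z, (SOME P. snd z = aN P) $ 0))"

lemma corner_map_aN: "corner_map (x, aN P) = (x, P $ 0)"
proof -
  have "aN P = aN (SOME Q. aN P = aN Q)" by (rule someI) simp
  from aN_nth_0[OF this] show ?thesis by (simp add: corner_map_def corner_simps)
qed

lemma corner_map_hom: "corner_map \<in> lie_homs (corner N) base"
proof (rule lie_homsI)
  fix z w :: "'k \<times> 'k fa_elem" and a :: 'k
  show "corner_map (z \<oplus>\<^bsub>corner N\<^esub> w) = corner_map z \<oplus>\<^bsub>base\<^esub> corner_map w"
    "corner_map (z \<otimes>\<^bsub>corner N\<^esub> w) = corner_map z \<otimes>\<^bsub>base\<^esub> corner_map w"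
    if "z \<in> carrier (corner N)" "w \<in> carrier (corner N)"
    using that by (auto elim!: cornerE simp: corner_simps base_simps corner_map_aN)
  show "corner_map (a \<odot>\<^bsub>corner N\<^esub> z) = a \<odot>\<^bsub>base\<^esub> corner_map z" if "z \<in> carrier (corner N)"
    using that by (auto elim!: cornerE simp: corner_simps base_simps corner_map_aN)
qed (auto simp: base_simps corner_map_def)

lemma corner_map_surj: "corner_map ` carrier (corner N) = carrier base"
proof -
  have "(x, y) \<in> corner_map ` carrier (corner N)" for x y
    by (rule image_eqI[of _ _ "(x, aN (fps_const y))"]) (auto simp: corner_map_aN corner_simps)
  then show ?thesis by (auto simp: base_simps)
qed

lemma is_corner_map: "is_corner_map N corner_map"
  using lie_homsD(1)[OF corner_map_hom]
  by (auto simp: is_corner_map_def lie_a_N' corner_map_aN simp del: power_0)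

lemma aN_trunc: "aN P = aN (\<Sum>s<N. fps_const (P $ s) * fps_X ^ s)"
  by (auto simp: aN_eq vo_def fps_sum_nth fps_X_power_nth if_distrib[where f = "(*) _"] cong: if_cong)

text \<open>By \<open>aN_trunc\<close> the vectors c and L_s with s < N span the corner, so the
  prescribed values determine a linear map; extensionality fixes it outside the carrier.\<close>

lemma corner_map_unique:
  assumes "is_corner_map N \<pi>" shows "\<pi> = corner_map"
proof
  have lin: "\<pi> \<in> linear_maps (corner N) base"
    and one: "\<pi> (1, aN 0) = (1, 0)" and L: "s < N \<Longrightarrow> \<pi> (0, aN (fps_X ^ s)) = (0, if s = 0 then 1 else 0)" for s
    using assms by (cases s; force simp: is_corner_map_def lie_a_N' simp del: power_Suc)+
  note D = linear_mapsD[OF lin]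
  have 0: "\<pi> (0, aN 0) = (0, 0)"
    using D(4)[of "(1, aN 0)" 0] one by (simp add: corner_simps base_simps)
  have *: "\<pi> (0, aN (\<Sum>s\<in>S. fps_const (c s) * fps_X ^ s)) = (0, \<Sum>s\<in>S. if s = 0 then c s else 0)"
    if "finite S" "S \<subseteq> {..<N}" for S c
    using that
  proof (induction S)
    case (insert s S)
    have "\<pi> (0, aN (fps_const (c s) * fps_X ^ s)) = (0, if s = 0 then c s else 0)"
      using D(4)[of "(0, aN (fps_X ^ s))" "c s"] L[of s] insert by (simp add: corner_simps base_simps)
    then show ?case
      using D(3)[of "(0, aN (fps_const (c s) * fps_X ^ s))" "(0, aN (\<Sum>s\<in>S. fps_const (c s) * fps_X ^ s))"] insert
      by (auto simp: corner_simps base_simps)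
  qed (simp add: 0)
  have "\<pi> (x, aN P) = (x, P $ 0)" for x P
  proof -
    have "\<pi> (0, aN P) = (0, P $ 0)"
      using *[of "{..<N}" "\<lambda>s. P $ s"] N1 by (subst aN_trunc) simp
    moreover have "\<pi> (x, aN 0) = (x, 0)"
      using D(4)[of "(1, aN 0)" x] one by (simp add: corner_simps base_simps)
    ultimately show ?thesis
      using D(3)[of "(x, aN 0)" "(0, aN P)"] by (simp add: corner_simps base_simps)
  qed
  then show "\<pi> z = corner_map z" for z
    using D(2)[of z] by (cases "z \<in> carrier (corner N)") (auto elim!: cornerE simp: corner_map_aN, auto simp: corner_map_def)
qed

section \<open>The embedding into the direct sum\<close>

definition emb :: "'k HH1_elem \<Rightarrow> 'k \<times> (int \<Rightarrow> 'k fa_elem)" where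
  "emb = (\<lambda>h\<in>carrier H. let z = (SOME z. okP (snd z) \<and> h = hcls (fst z) (snd z)) in
     (fst z, \<lambda>j\<in>V. aN (snd z j)))"

lemma emb_hcls:
  assumes "okP P" shows "emb (hcls x P) = (x, \<lambda>j\<in>V. aN (P j))"
proof -
  let ?z = "SOME z. okP (snd z) \<and> hcls x P = hcls (fst z) (snd z)"
  have "okP (snd ?z) \<and> hcls x P = hcls (fst ?z) (snd ?z)"
    by (rule someI[of _ "(x, P)"]) (simp add: assms)
  then have "x = fst ?z" "\<And>j. aN (P j) = aN (snd ?z j)"
    using assms by (auto simp: hcls_eq aN_eq)
  then show ?thesis using assms by (simp add: emb_def Let_def)
qed

lemma target_simps:
  "carrier (target m N :: ('k, _) module) = UNIV \<times> (\<Pi>\<^sub>E j\<in>V. range aN)"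
  "(x, \<lambda>j\<in>V. aN (P j)) \<oplus>\<^bsub>target m N\<^esub> (y, \<lambda>j\<in>V. aN (Q j)) = (x + y, \<lambda>j\<in>V. aN (P j + Q j))"
  "(x, \<lambda>j\<in>V. aN (P j)) \<otimes>\<^bsub>target m N\<^esub> (y, \<lambda>j\<in>V. aN (Q j)) = (0, \<lambda>j\<in>V. aN (brk (P j) (Q j)))"
  "a \<odot>\<^bsub>target m N\<^esub> (x, \<lambda>j\<in>V. aN (P j)) = (a * x, \<lambda>j\<in>V. aN (fps_const a * P j))"
  by (auto simp: target_def prod_alg_def Prod_alg_def lie_line_def lie_a_N'
      intro!: restrict_ext)

lemma emb_hom: "emb \<in> lie_homs H (target m N)"
proof (rule lie_homsI)
  fix h h' and a :: 'k
  show "emb h \<in> carrier (target m N)" if "h \<in> carrier H"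
    using that by (elim H_surj) (auto simp: emb_hcls target_simps)
  show "emb (h \<oplus>\<^bsub>H\<^esub> h') = emb h \<oplus>\<^bsub>target m N\<^esub> emb h'" "emb (h \<otimes>\<^bsub>H\<^esub> h') = emb h \<otimes>\<^bsub>target m N\<^esub> emb h'"
    if "h \<in> carrier H" "h' \<in> carrier H"
    using that by (elim H_surj; simp add: emb_hcls hcls_add hcls_bracket target_simps)+
  show "emb (a \<odot>\<^bsub>H\<^esub> h) = a \<odot>\<^bsub>target m N\<^esub> emb h" if "h \<in> carrier H"
    using that by (elim H_surj) (simp add: emb_hcls hcls_smult target_simps)
qed (simp add: emb_def)

lemma okP_mod: "okP P \<Longrightarrow> P (j mod int m) = P j"
  by (simp add: okP_def)

lemma hcls_eqI:
  assumes "okP P" "okP Q" "x = y" "\<And>j. j \<in> V \<Longrightarrow> aN (P j) = aN (Q j)"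
  shows "hcls x P = hcls y Q"
proof -
  have "vo N (P j - Q j)" for j
    using assms(4)[of "j mod int m"] okP_mod[OF assms(1), of j] okP_mod[OF assms(2), of j] by (simp add: aN_eq)
  then show ?thesis using assms by (intro hcls_cong) auto
qed

lemma inj_emb: "inj_on emb (carrier H)"
proof (rule inj_onI)
  fix h h' assume h: "h \<in> carrier H" "h' \<in> carrier H" and eq: "emb h = emb h'"
  obtain x P y Q where *: "okP P" "h = hcls x P" "okP Q" "h' = hcls y Q" by (metis H_surj h)
  have 1: "(x, \<lambda>j\<in>V. aN (P j)) = (y, \<lambda>j\<in>V. aN (Q j))"
    using eq * by (simp add: emb_hcls)
  have "aN (P j) = aN (Q j)" if "j \<in> V" for j
    using fun_cong[OF arg_cong[OF 1, of snd], of j] that by simp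
  then have "hcls x P = hcls y Q" using 1 by (intro hcls_eqI *) auto
  then show "h = h'" using * by simp
qed

lemma finsum_target_L:
  "(\<Oplus>\<^bsub>target m N\<^esub>j\<in>V. target_L m N j 0) = (0 :: 'k, \<lambda>j\<in>V. aN 1)"
proof -
  interpret T: nalg "target m N :: ('k, _) module" using lie_algebra_target by (simp add: lie_algebra_iff)
  have L: "target_L m N j s = (0 :: 'k, \<lambda>i\<in>V. aN (if i = j then fps_X ^ s else 0))" for j s
    by (auto simp: target_L_def lie_a_N' intro!: restrict_ext)
  have c: "target_L m N j s \<in> carrier (target m N :: ('k, _) module)" for j s
    by (auto simp: L target_simps)
  have "(\<Oplus>\<^bsub>target m N\<^esub>j\<in>S. target_L m N j 0) = (0 :: 'k, \<lambda>i\<in>V. aN (if i \<in> S then 1 else 0))"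
    if "finite S" for S
    using that
  proof (induction S)
    case empty
    have "\<zero>\<^bsub>target m N\<^esub> = (0 :: 'k, \<lambda>i\<in>V. aN 0)"
      by (simp add: target_def prod_alg_def Prod_alg_def lie_line_def lie_a_N')
    then show ?case by (simp only: T.finsum_empty empty_iff if_False)
  next
    case (insert j S)
    have "aN ((if i = j then fps_X ^ 0 else 0) + (if i \<in> S then 1 else 0)) = aN (if i \<in> insert j S then 1 else 0)" for i
      using insert by auto
    then have eq1: "target_L m N j 0 \<oplus>\<^bsub>target m N\<^esub> (0 :: 'k, \<lambda>i\<in>V. aN (if i \<in> S then 1 else 0)) =
        (0, \<lambda>i\<in>V. aN (if i \<in> insert j S then 1 else 0))"
      by (simp only: L target_simps add_0_left)
    have eq2: "(\<Oplus>\<^bsub>target m N\<^esub>j\<in>insert j S. target_L m N j 0 :: 'k \<times> _) =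
        target_L m N j 0 \<oplus>\<^bsub>target m N\<^esub> (\<Oplus>\<^bsub>target m N\<^esub>j\<in>S. target_L m N j 0)"
      using insert.hyps c by (intro T.finsum_insert) auto
    show ?case unfolding eq2 insert.IH by (rule eq1)
  qed
  from this[of "V"] show ?thesis by (auto intro!: restrict_ext)
qed

lemma okP_E: "s \<ge> 1 \<Longrightarrow> okP (\<lambda>i. if i mod int m = j then fps_X ^ s else 0)"
  by (auto simp: okP_def)

lemma is_embedding_map: "is_embedding_map m N emb"
  unfolding is_embedding_map_def
proof (intro conjI ballI)
  show "emb \<in> linear_maps H (target m N)" by (rule lie_homsD(1)[OF emb_hom])
  show "emb (E_class m N j s) = target_L m N j s" if "j \<in> V" "s \<in> {1..N - 1}" for j s
    using that by (subst E_class_eq) (auto simp: emb_hcls okP_E target_L_def lie_a_N' intro!: restrict_ext)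
  show "emb (E0_class m N) = (\<Oplus>\<^bsub>target m N\<^esub>j\<in>V. target_L m N j 0)"
    by (simp only: E0_class_eq emb_hcls okP_const finsum_target_L)
  show "emb (C_class m N) = target_c m N"
    by (simp add: C_class_eq emb_hcls target_c_def lie_a_N')
qed

text \<open>With p the common constant term of the series, \<open>hcls x P\<close> is x C + p E_0
  plus the sum over j and 1 <= s <= N-1 of \<open>P j $ s\<close> times E_{1,j,s}. The classes with
  prescribed values therefore span.\<close>

lemma emb_unique:
  assumes \<Phi>: "is_embedding_map m N \<Phi>" shows "\<Phi> = emb"
proof
  have lin: "\<Phi> \<in> linear_maps H (target m N)" using \<Phi> by (simp add: is_embedding_map_def)
  note D = linear_mapsD[OF lin] and D' = linear_mapsD[OF lie_homsD(1)[OF emb_hom]]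
  let ?S = "{h \<in> carrier H. \<Phi> h = emb h}"
  have add: "h \<oplus>\<^bsub>H\<^esub> h' \<in> ?S" if "h \<in> ?S" "h' \<in> ?S" for h h'
    using that D(3)[of h h'] D'(3)[of h h'] by simp
  have smult: "a \<odot>\<^bsub>H\<^esub> h \<in> ?S" if "h \<in> ?S" for a h
    using that D(4)[of h a] D'(4)[of h a] by simp
  have C: "hcls 1 (\<lambda>_. 0) \<in> ?S" and E0: "hcls 0 (\<lambda>_. 1) \<in> ?S"
    using \<Phi> is_embedding_map by (simp_all add: is_embedding_map_def flip: C_class_eq E0_class_eq) (simp_all add: C_class_eq E0_class_eq)
  let ?e = "\<lambda>p i. if i mod int m = fst p then fps_X ^ snd p else 0 :: 'k fps"
  have E: "hcls 0 (?e p) \<in> ?S" if "p \<in> V \<times> {1..N - 1}" for p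
  proof -
    have "\<Phi> (E_class m N (fst p) (snd p)) = emb (E_class m N (fst p) (snd p))"
      using \<Phi> is_embedding_map that by (auto simp: is_embedding_map_def)
    then show ?thesis using that E_class_eq[of "fst p" "snd p"] by (auto simp: okP_E)
  qed
  have sums: "hcls 0 (\<lambda>i. \<Sum>p\<in>T. fps_const (c p) * ?e p i) \<in> ?S \<and> okP (\<lambda>i. \<Sum>p\<in>T. fps_const (c p) * ?e p i)"
    if "finite T" "T \<subseteq> V \<times> {1..N - 1}" for T c
    using that
  proof (induction T)
    case empty
    have "0 \<odot>\<^bsub>H\<^esub> hcls 1 (\<lambda>_. 0) \<in> ?S" by (rule smult[OF C])
    then show ?case by (simp add: hcls_smult)
  next
    case (insert p T)
    have ok: "okP (?e p)" using insert by (intro okP_E) auto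
    have "c p \<odot>\<^bsub>H\<^esub> hcls 0 (?e p) \<oplus>\<^bsub>H\<^esub> hcls 0 (\<lambda>i. \<Sum>p\<in>T. fps_const (c p) * ?e p i) \<in> ?S"
      using insert by (intro add smult E) auto
    then show ?case
      using insert okP_add[OF okP_scale[OF ok, of "c p"], of "\<lambda>i. \<Sum>p\<in>T. fps_const (c p) * ?e p i"]
      by (simp add: hcls_smult[OF ok] hcls_add[OF okP_scale[OF ok]] del: okP_add okP_scale)
  qed
  have "\<Phi> h = emb h" if h: "h \<in> carrier H" for h
  proof -
    obtain x P where P: "okP P" "h = hcls x P" by (rule H_surj[OF h])
    let ?T = "V \<times> {1..N - 1}"
    \<comment> \<open>Coefficients from 1 on; the constant term is common to all copies and is
      carried by E_0.\<close>
    let ?Q = "\<lambda>i. \<Sum>p\<in>?T. fps_const (P (fst p) $ snd p) * ?e p i"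
    have Q: "hcls 0 ?Q \<in> ?S" "okP ?Q" using sums[of ?T "\<lambda>p. P (fst p) $ snd p"] by auto
    have nth: "?Q i $ n = (if n \<in> {1..N - 1} then P i $ n else 0)" for i n
    proof -
      have "?Q i $ n = (\<Sum>p\<in>?T. if p = (i mod int m, n) then P i $ n else 0)"
        unfolding fps_sum_nth using okP_mod[OF P(1), of i] by (intro sum.cong) (auto simp: fps_X_power_nth)
      then show ?thesis by (simp add: sum.delta)
    qed
    have P0: "P i $ 0 = P 0 $ 0" for i
      by (rule cyclic_const[of "\<lambda>i. P i $ 0"]) (use P(1) in \<open>auto simp: okP_def\<close>)
    have "x \<odot>\<^bsub>H\<^esub> hcls 1 (\<lambda>_. 0) \<oplus>\<^bsub>H\<^esub> (P 0 $ 0 \<odot>\<^bsub>H\<^esub> hcls 0 (\<lambda>_. 1) \<oplus>\<^bsub>H\<^esub> hcls 0 ?Q) \<in> ?S"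
      by (intro add smult C E0 Q)
    also have "x \<odot>\<^bsub>H\<^esub> hcls 1 (\<lambda>_. 0) \<oplus>\<^bsub>H\<^esub> (P 0 $ 0 \<odot>\<^bsub>H\<^esub> hcls 0 (\<lambda>_. 1) \<oplus>\<^bsub>H\<^esub> hcls 0 ?Q) =
      hcls x (\<lambda>i. fps_const (P 0 $ 0) + ?Q i)"
      using Q(2) okP_add[OF okP_const[of "fps_const (P 0 $ 0)"] Q(2)]
      by (simp add: hcls_smult[OF okP_const] hcls_add[OF okP_const] del: okP_add)
    also have "\<dots> = h"
      unfolding P(2)
    proof (rule hcls_cong)
      show "okP (\<lambda>i. fps_const (P 0 $ 0) + ?Q i)" by (rule okP_add[OF okP_const Q(2)])
      show "vo N (fps_const (P 0 $ 0) + ?Q i - P i)" for i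
        unfolding vo_def
      proof (intro allI impI)
        show "(fps_const (P 0 $ 0) + ?Q i - P i) $ n = 0" if "n < N" for n
          unfolding fps_sub_nth fps_add_nth nth using that by (cases n) (auto simp: P0[of i])
      qed
    qed (use P in auto)
    finally show ?thesis by simp
  qed
  then show "\<Phi> h = emb h" for h using D(2)[of h] D'(2)[of h] by (cases "h \<in> carrier H") auto
qed

section \<open>The pullback property\<close>

definition leg :: "int \<Rightarrow> 'k HH1_elem \<Rightarrow> 'k \<times> 'k fa_elem" where
  "leg j = (\<lambda>h\<in>carrier H. (fst (emb h), snd (emb h) j))"

lemma leg_hcls: "\<lbrakk>okP P; j \<in> V\<rbrakk> \<Longrightarrow> leg j (hcls x P) = (x, aN (P j))"
  by (simp add: leg_def emb_hcls)

lemma leg_hom: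
  assumes j: "j \<in> V" shows "leg j \<in> lie_homs H (corner N)"
proof (rule lie_homsI)
  fix h h' and a :: 'k
  show "leg j h \<in> carrier (corner N)" if "h \<in> carrier H"
    using that j by (elim H_surj) (auto simp: leg_hcls corner_simps)
  show "leg j (h \<oplus>\<^bsub>H\<^esub> h') = leg j h \<oplus>\<^bsub>corner N\<^esub> leg j h'" "leg j (h \<otimes>\<^bsub>H\<^esub> h') = leg j h \<otimes>\<^bsub>corner N\<^esub> leg j h'"
    if "h \<in> carrier H" "h' \<in> carrier H"
    using that j by (elim H_surj; simp add: leg_hcls hcls_add hcls_bracket corner_simps)+
  show "leg j (a \<odot>\<^bsub>H\<^esub> h) = a \<odot>\<^bsub>corner N\<^esub> leg j h" if "h \<in> carrier H"
    using that j by (elim H_surj) (simp add: leg_hcls hcls_smult corner_simps)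
qed (simp add: leg_def)

text \<open>Every leg repeats the scalar, so the one at vertex 0 recovers it; together the legs
  recover the truncated series in all copies.\<close>

lemma leg_joint_inj:
  assumes "h \<in> carrier H" "h' \<in> carrier H" "\<And>j. j \<in> V \<Longrightarrow> leg j h = leg j h'"
  shows "h = h'"
proof -
  obtain x P y Q where *: "okP P" "h = hcls x P" "okP Q" "h' = hcls y Q" by (metis H_surj assms(1,2))
  have "x = y \<and> aN (P j) = aN (Q j)" if "j \<in> V" for j
    using assms(3)[OF that] * that by (simp add: leg_hcls)
  moreover have "0 \<in> V" using m3 by simp
  ultimately have "x = y" "\<And>j. j \<in> V \<Longrightarrow> aN (P j) = aN (Q j)" by blast+
  then have "hcls x P = hcls y Q" by (intro hcls_eqI *)
  then show ?thesis using * by simp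
qed

text \<open>A compatible family is glued pointwise: equality under \<open>corner_map\<close> says
  that the scalars and the constant terms agree in all copies, which is what \<open>hcls\<close> and
  \<open>okP\<close> demand. Joint injectivity of the legs gives uniqueness and reduces the
  homomorphism laws for \<open>u\<close> to those for \<open>g\<close> and the legs.\<close>

lemma pullback_universal:
  fixes Y :: "('k, 'x) module"
  assumes Y: "lie_algebra Y" and g: "\<And>j. j \<in> V \<Longrightarrow> g j \<in> lie_homs Y (corner N)"
    and comp: "\<And>i j y. \<lbrakk>i \<in> V; j \<in> V; y \<in> carrier Y\<rbrakk> \<Longrightarrow> corner_map (g i y) = corner_map (g j y)"
  shows "\<exists>!u. u \<in> lie_homs Y H \<and> (\<forall>j\<in>V. \<forall>y\<in>carrier Y. leg j (u y) = g j y)"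
proof -
  interpret Y: nalg Y using Y by (simp add: lie_algebra_iff)
  have zero: "0 \<in> V" using m3 by simp
  have ex: "\<exists>h\<in>carrier H. \<forall>j\<in>V. leg j h = g j y" if y: "y \<in> carrier Y" for y
  proof -
    have "\<exists>x P. g (j mod int m) y = (x, aN P)" for j
      using linear_mapsD(1)[OF lie_homsD(1)[OF g] y, of "j mod int m"] by (auto elim: cornerE)
    then obtain x P where xP: "\<And>j. g (j mod int m) y = (x (j mod int m), aN (P (j mod int m)))"
      by (metis mod_mod_trivial)
    have eq: "x (j mod int m) = x 0 \<and> P (j mod int m) $ 0 = P 0 $ 0" for j
      using comp[OF _ zero y, of "j mod int m"] xP[of j] xP[of 0] m3 by (simp add: corner_map_aN)
    have ok: "okP (\<lambda>j. P (j mod int m))" by (simp add: okP_def eq)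
    have "leg j (hcls (x 0) (\<lambda>j. P (j mod int m))) = g j y" if "j \<in> V" for j
      using leg_hcls[OF ok that] xP[of j] eq[of j] that by simp
    then show ?thesis using ok by (intro bexI[of _ "hcls (x 0) (\<lambda>j. P (j mod int m))"]) auto
  qed
  define u where "u = (\<lambda>y\<in>carrier Y. SOME h. h \<in> carrier H \<and> (\<forall>j\<in>V. leg j h = g j y))"
  have u': "u y \<in> carrier H \<and> (\<forall>j\<in>V. leg j (u y) = g j y)" if "y \<in> carrier Y" for y
  proof -
    have ex': "\<exists>h. h \<in> carrier H \<and> (\<forall>j\<in>V. leg j h = g j y)" using ex[OF that] by blast
    have e: "u y = (SOME h. h \<in> carrier H \<and> (\<forall>j\<in>V. leg j h = g j y))"
      using that by (simp add: u_def)
    show ?thesis unfolding e by (rule someI_ex[OF ex'])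
  qed
  then have u: "u y \<in> carrier H" "\<And>j. j \<in> V \<Longrightarrow> leg j (u y) = g j y" if "y \<in> carrier Y" for y
    using that by blast+
  have hom: "u \<in> lie_homs Y H"
  proof (rule lie_homsI)
    fix y y' and a :: 'k
    show "u (y \<oplus>\<^bsub>Y\<^esub> y') = u y \<oplus>\<^bsub>H\<^esub> u y'" "u (y \<otimes>\<^bsub>Y\<^esub> y') = u y \<otimes>\<^bsub>H\<^esub> u y'" if "y \<in> carrier Y" "y' \<in> carrier Y"
      using that u linear_mapsD(3)[OF lie_homsD(1)[OF g]] linear_mapsD(3)[OF lie_homsD(1)[OF leg_hom]]
        lie_homsD(2)[OF g] lie_homsD(2)[OF leg_hom]
      by (intro leg_joint_inj; simp)+
    show "u (a \<odot>\<^bsub>Y\<^esub> y) = a \<odot>\<^bsub>H\<^esub> u y" if "y \<in> carrier Y"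
      using that u linear_mapsD(4)[OF lie_homsD(1)[OF g]] linear_mapsD(4)[OF lie_homsD(1)[OF leg_hom]]
      by (intro leg_joint_inj) simp_all
  qed (simp_all add: u, simp add: u_def)
  show ?thesis
  proof (intro ex1I[of _ u] conjI ballI hom u(2))
    fix v assume v: "v \<in> lie_homs Y H \<and> (\<forall>j\<in>V. \<forall>y\<in>carrier Y. leg j (v y) = g j y)"
    note V = linear_mapsD[OF lie_homsD(1)[OF conjunct1[OF v]]]
    show "v = u"
    proof
      fix y
      show "v y = u y"
      proof (cases "y \<in> carrier Y")
        case True
        then show ?thesis by (intro leg_joint_inj V(1) u(1)) (use v u(2) in auto)
      qed (simp add: u_def V(2))
    qed
  qed
qed

lemma HH1_pullback:
  "is_lie_pullback TYPE('x) V (\<lambda>_. corner N) base (\<lambda>_. corner_map) H leg"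
  unfolding is_lie_pullback_def
proof (intro conjI ballI allI impI)
  show "V \<noteq> {}" using m3 by simp
  fix i j h assume ij: "i \<in> V" "j \<in> V" and h: "h \<in> carrier H"
  obtain x P where P: "okP P" "h = hcls x P" by (rule H_surj[OF h])
  have "P i $ 0 = P j $ 0"
    by (rule cyclic_const[of "\<lambda>i. P i $ 0"]) (use P(1) in \<open>auto simp: okP_def\<close>)
  then show "corner_map (leg i h) = corner_map (leg j h)"
    using ij P by (simp add: leg_hcls corner_map_aN)
next
  fix Y :: "('k, 'x) module" and g
  assume "lie_algebra Y \<and> (\<forall>i\<in>V. g i \<in> lie_homs Y (corner N)) \<and>
    (\<forall>i\<in>V. \<forall>j\<in>V. \<forall>y\<in>carrier Y. corner_map (g i y) = corner_map (g j y))"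
  then show "\<exists>!u. u \<in> lie_homs Y H \<and> (\<forall>j\<in>V. \<forall>y\<in>carrier Y. leg j (u y) = g j y)"
    by (intro pullback_universal) blast+
qed (auto intro: lie_algebra_base lie_algebra_corner corner_map_hom lie_algebra_H leg_hom)

end

theorem theorem9p1p6:
  fixes N m :: nat
  assumes "N \<ge> 1" and "m \<ge> 3"
    and "\<not> CHAR('k::field) dvd 2" and "\<not> CHAR('k) dvd N" and "\<not> CHAR('k) dvd m"
  shows "\<exists>(\<Phi> :: 'k HH1_elem \<Rightarrow> 'k \<times> (int \<Rightarrow> 'k fa_elem)) (\<pi> :: 'k \<times> 'k fa_elem \<Rightarrow> 'k \<times> 'k).
    is_embedding_map m N \<Phi> \<and> (\<forall>\<Phi>'. is_embedding_map m N \<Phi>' \<longrightarrow> \<Phi>' = \<Phi>) \<and>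
    lie_algebra (HH1_A m N :: ('k, 'k HH1_elem) module) \<and>
    lie_algebra (target m N :: ('k, 'k \<times> (int \<Rightarrow> 'k fa_elem)) module) \<and>
    \<Phi> \<in> lie_homs (HH1_A m N) (target m N) \<and>
    inj_on \<Phi> (carrier (HH1_A m N)) \<and>
    is_corner_map N \<pi> \<and> (\<forall>\<pi>'. is_corner_map N \<pi>' \<longrightarrow> \<pi>' = \<pi>) \<and>
    \<pi> \<in> lie_homs (corner N) base \<and>
    \<pi> ` carrier (corner N) = carrier base \<and>
    is_lie_pullback TYPE('x) {0..<int m} (\<lambda>_. corner N) base (\<lambda>_. \<pi>) (HH1_A m N)
      (\<lambda>j. \<lambda>x\<in>carrier (HH1_A m N). (fst (\<Phi> x), snd (\<Phi> x) j))"
proof -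
  have "(of_nat 2 :: 'k) \<noteq> 0" "(of_nat N :: 'k) \<noteq> 0" "(of_nat m :: 'k) \<noteq> 0"
    using assms by (simp_all only: of_nat_eq_0_iff_char_dvd not_False_eq_True)
  then interpret quiver_alg m N "TYPE('k)"
    using assms by unfold_locales auto
  have leg: "(\<lambda>j. \<lambda>x\<in>carrier H. (fst (emb x), snd (emb x) j)) = leg"
    by (simp add: leg_def fun_eq_iff)
  show ?thesis
    by (intro exI[of _ emb] exI[of _ corner_map] conjI allI impI is_embedding_map emb_unique lie_algebra_H
        lie_algebra_target emb_hom inj_emb is_corner_map corner_map_unique corner_map_hom corner_map_surj
        HH1_pullback[folded leg])
qed

end
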